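(* Let $X$ be a u.l.f.\ metric space and suppose $A\subseteq\mathrm{C}^*_u(X)$ is a Roe Cartan subalgebra. Then there is a unitary $v\in\mathrm{C}^*_u(X)$ such that $vAv^*=\ell_\infty(X)$.
   Context: $\mathrm{C}^*_u(X)$ is the norm closure of finite-propagation operators on $\ell_2(X)$; $\ell_\infty(X)\subseteq\mathrm{C}^*_u(X)$ is the algebra of diagonal (multiplication) operators with respect to the basis $(\delta_x)_{x\in X}$. A $\mathrm{C}^*$-subalgebra $A\subseteq B$ is a Cartan subalgebra (masa) if it is a maximal abelian subalgebra, contains an approximate unit of $B$, there is a faithful conditional expectation $B\to A$, and $B$ is generated as a $\mathrm{C}^*$-algebra by the normaliser $\{b\in B\mid bAb^*\cup b^*Ab\subseteq A\}$. $A$ is co-separable in $B$ if there is a countable $S\subseteq B$ with $B=\mathrm{C}^*(A,S)$. A Roe Cartan subalgebra of $\mathrm{C}^*_u(X)$ is a co-separable Cartan masa of $\mathrm{C}^*_u(X)$ which is $^*$-isomorphic to $\ell_\infty(\mathbb N)$. *)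

theory Defs
  imports "HOL-Analysis.Analysis"
begin

text \<open>A bounded operator T on l2(X) is identified with its matrix
  M x y = <T delta_y, delta_x>. The operator is recovered by
  (T f) x = sum_y M x y * f y.\<close>

type_synonym 'a mat = "'a \<Rightarrow> 'a \<Rightarrow> complex"

definition l2 :: "('a \<Rightarrow> complex) set" where
  "l2 = {f. (\<lambda>x. (cmod (f x))\<^sup>2) summable_on UNIV}"

definition l2norm :: "('a \<Rightarrow> complex) \<Rightarrow> real" where
  "l2norm f = sqrt (infsum (\<lambda>x. (cmod (f x))\<^sup>2) UNIV)"

definition l2inner :: "('a \<Rightarrow> complex) \<Rightarrow> ('a \<Rightarrow> complex) \<Rightarrow> complex" where
  "l2inner f g = infsum (\<lambda>x. f x * cnj (g x)) UNIV"

definition mat_app :: "'a mat \<Rightarrow> ('a \<Rightarrow> complex) \<Rightarrow> ('a \<Rightarrow> complex)" where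
  "mat_app M f = (\<lambda>x. infsum (\<lambda>y. M x y * f y) UNIV)"

definition bounded_mat :: "'a mat \<Rightarrow> bool" where
  "bounded_mat M \<longleftrightarrow>
     (\<forall>f\<in>l2. \<forall>x. (\<lambda>y. M x y * f y) summable_on UNIV) \<and>
     (\<forall>f\<in>l2. mat_app M f \<in> l2) \<and>
     (\<exists>K. \<forall>f\<in>l2. l2norm (mat_app M f) \<le> K * l2norm f)"

definition opnorm :: "'a mat \<Rightarrow> real" where
  "opnorm M = Sup {l2norm (mat_app M f) | f. f \<in> l2 \<and> l2norm f \<le> 1}"

definition mzero :: "'a mat" where "mzero = (\<lambda>x y. 0)"
definition mid :: "'a mat" where "mid = (\<lambda>x y. if x = y then 1 else 0)"
definition madd :: "'a mat \<Rightarrow> 'a mat \<Rightarrow> 'a mat" where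
  "madd M N = (\<lambda>x y. M x y + N x y)"
definition mminus :: "'a mat \<Rightarrow> 'a mat \<Rightarrow> 'a mat" where
  "mminus M N = (\<lambda>x y. M x y - N x y)"
definition msmult :: "complex \<Rightarrow> 'a mat \<Rightarrow> 'a mat" where
  "msmult c M = (\<lambda>x y. c * M x y)"
definition mmult :: "'a mat \<Rightarrow> 'a mat \<Rightarrow> 'a mat" where
  "mmult M N = (\<lambda>x z. infsum (\<lambda>y. M x y * N y z) UNIV)"
definition madj :: "'a mat \<Rightarrow> 'a mat" where
  "madj M = (\<lambda>x y. cnj (M y x))"

definition positive_mat :: "'a mat \<Rightarrow> bool" where
  "positive_mat M \<longleftrightarrow> bounded_mat M \<and>
     (\<forall>f\<in>l2. Im (l2inner (mat_app M f) f) = 0 \<and> Re (l2inner (mat_app M f) f) \<ge> 0)"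

definition cstar_subalg :: "'a mat set \<Rightarrow> bool" where
  "cstar_subalg B \<longleftrightarrow>
     (\<forall>M\<in>B. bounded_mat M) \<and> mzero \<in> B \<and>
     (\<forall>M\<in>B. \<forall>N\<in>B. madd M N \<in> B) \<and>
     (\<forall>c. \<forall>M\<in>B. msmult c M \<in> B) \<and>
     (\<forall>M\<in>B. \<forall>N\<in>B. mmult M N \<in> B) \<and>
     (\<forall>M\<in>B. madj M \<in> B) \<and>
     (\<forall>u M. (\<forall>n. u n \<in> B) \<and> bounded_mat M \<and>
            (\<lambda>n. opnorm (mminus (u n) M)) \<longlonglongrightarrow> 0 \<longrightarrow> M \<in> B)"

definition cstar_gen :: "'a mat set \<Rightarrow> 'a mat set" where
  "cstar_gen S = \<Inter>{B. cstar_subalg B \<and> S \<subseteq> B}"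

definition abelian :: "'a mat set \<Rightarrow> bool" where
  "abelian A \<longleftrightarrow> (\<forall>a\<in>A. \<forall>b\<in>A. mmult a b = mmult b a)"

definition ulf :: "'a::metric_space itself \<Rightarrow> bool" where
  "ulf _ \<longleftrightarrow> (\<forall>r::real. \<exists>N::nat. \<forall>x::'a.
      finite {y. dist x y \<le> r} \<and> card {y. dist x y \<le> r} \<le> N)"

definition finite_prop :: "('a::metric_space) mat \<Rightarrow> bool" where
  "finite_prop M \<longleftrightarrow> (\<exists>r. \<forall>x y. dist x y > r \<longrightarrow> M x y = 0)"

definition uroe :: "('a::metric_space) mat set" where
  "uroe = {M. bounded_mat M \<and>
     (\<forall>\<epsilon>>0. \<exists>N. bounded_mat N \<and> finite_prop N \<and> opnorm (mminus M N) < \<epsilon>)}"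

definition linf_diag :: "'a mat set" where
  "linf_diag = {M. bounded_mat M \<and> (\<forall>x y. x \<noteq> y \<longrightarrow> M x y = 0)}"

definition normaliser :: "'a mat set \<Rightarrow> 'a mat set \<Rightarrow> 'a mat set" where
  "normaliser A B = {b\<in>B. (\<forall>a\<in>A. mmult (mmult b a) (madj b) \<in> A) \<and>
                            (\<forall>a\<in>A. mmult (mmult (madj b) a) b \<in> A)}"

text \<open>A (net-indexed) approximate unit of B consisting of positive contractions
  in A; a net is encoded by a proper filter on the operators.\<close>
definition has_approx_unit_in :: "'a mat set \<Rightarrow> 'a mat set \<Rightarrow> bool" where
  "has_approx_unit_in A B \<longleftrightarrow>
     (\<exists>F :: 'a mat filter. F \<noteq> bot \<and>
        eventually (\<lambda>e. e \<in> A \<and> positive_mat e \<and> opnorm e \<le> 1) F \<and>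
        (\<forall>b\<in>B. ((\<lambda>e. opnorm (mminus (mmult e b) b)) \<longlongrightarrow> 0) F \<and>
                ((\<lambda>e. opnorm (mminus (mmult b e) b)) \<longlongrightarrow> 0) F))"

definition faithful_cond_exp :: "('a mat \<Rightarrow> 'a mat) \<Rightarrow> 'a mat set \<Rightarrow> 'a mat set \<Rightarrow> bool" where
  "faithful_cond_exp E B A \<longleftrightarrow>
     (\<forall>b\<in>B. E b \<in> A) \<and>
     (\<forall>a\<in>A. E a = a) \<and>
     (\<forall>b\<in>B. \<forall>c\<in>B. E (madd b c) = madd (E b) (E c)) \<and>
     (\<forall>z. \<forall>b\<in>B. E (msmult z b) = msmult z (E b)) \<and>
     (\<forall>b\<in>B. opnorm (E b) \<le> opnorm b) \<and>
     (\<forall>b\<in>B. positive_mat b \<longrightarrow> positive_mat (E b)) \<and>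
     (\<forall>a\<in>A. \<forall>a'\<in>A. \<forall>b\<in>B. E (mmult (mmult a b) a') = mmult (mmult a (E b)) a') \<and>
     (\<forall>b\<in>B. E (mmult (madj b) b) = mzero \<longrightarrow> b = mzero)"

definition cartan_masa :: "'a mat set \<Rightarrow> 'a mat set \<Rightarrow> bool" where
  "cartan_masa A B \<longleftrightarrow>
     A \<subseteq> B \<and> cstar_subalg A \<and> abelian A \<and>
     (\<forall>C. cstar_subalg C \<and> abelian C \<and> A \<subseteq> C \<and> C \<subseteq> B \<longrightarrow> C = A) \<and>
     has_approx_unit_in A B \<and>
     (\<exists>E. faithful_cond_exp E B A) \<and>
     B = cstar_gen (normaliser A B)"

definition co_separable :: "'a mat set \<Rightarrow> 'a mat set \<Rightarrow> bool" where
  "co_separable A B \<longleftrightarrow> (\<exists>S. countable S \<and> S \<subseteq> B \<and> B = cstar_gen (A \<union> S))"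

definition linf_nat :: "(nat \<Rightarrow> complex) set" where
  "linf_nat = {f. bounded (range f)}"

definition star_iso_linf_nat :: "'a mat set \<Rightarrow> bool" where
  "star_iso_linf_nat A \<longleftrightarrow> (\<exists>\<phi>. bij_betw \<phi> A linf_nat \<and>
     (\<forall>a\<in>A. \<forall>b\<in>A. \<phi> (madd a b) = (\<lambda>n. \<phi> a n + \<phi> b n)) \<and>
     (\<forall>c. \<forall>a\<in>A. \<phi> (msmult c a) = (\<lambda>n. c * \<phi> a n)) \<and>
     (\<forall>a\<in>A. \<forall>b\<in>A. \<phi> (mmult a b) = (\<lambda>n. \<phi> a n * \<phi> b n)) \<and>
     (\<forall>a\<in>A. \<phi> (madj a) = (\<lambda>n. cnj (\<phi> a n))))"

definition roe_cartan :: "('a::metric_space) mat set \<Rightarrow> bool" where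
  "roe_cartan A \<longleftrightarrow> cartan_masa A uroe \<and> co_separable A uroe \<and> star_iso_linf_nat A"

definition unitary_mat :: "'a mat \<Rightarrow> bool" where
  "unitary_mat v \<longleftrightarrow> mmult v (madj v) = mid \<and> mmult (madj v) v = mid"

end

theory Submission
  imports Defs
begin

text \<open>
  The minimal projections of \<open>A\<close> have rank one and are spanned by an orthonormal basis \<open>\<xi>\<close>, in which
  \<open>A\<close> is the algebra of all bounded diagonal operators. Write \<open>q\<^sub>J\<close> for its projections.

  Peaks: normalisers are monomial matrices in the basis \<open>\<xi>\<close>, so every operator of the uniform
  Roe algebra is approximated by matrices with boundedly many entries in each column. By a Baire
  category argument the bound is uniform over the multiplications by signs on the space. If some \<open>\<xi>\<^sub>n\<close> had
  only small coordinates, random signs would spread \<open>\<xi>\<^sub>n\<close> over many basis vectors. Hence there are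
  \<open>\<delta> > 0\<close> and points \<open>h n\<close> with \<open>\<bar>\<xi>\<^sub>n (h n)\<bar> \<ge> \<delta>\<close>.

  Almost commutation: by Baire category again, slowly varying functions \<open>f\<close> on the space almost commute
  with all \<open>q\<^sub>J\<close> uniformly in \<open>J\<close>. Averaging over \<open>J\<close> shows that \<open>f\<close> is close in norm to the diagonal
  operator with entries \<open>\<langle>f \<xi>\<^sub>n, \<xi>\<^sub>n\<rangle>\<close>. Applied to cut-off functions around finite sets, this gives
  Hall's condition in both directions for the relation \<open>d(x, h n) \<le> L\<close>, by comparing ranks. So there
  is a bijection \<open>g\<close> at bounded distance from \<open>h\<close>, and \<open>v\<close> is the unitary mapping \<open>\<xi>\<^sub>n\<close> to the
  point mass at \<open>g n\<close>.

  Membership: on a set \<open>S\<close> of indices with \<open>h\<close> sufficiently separated on \<open>S\<close>, almost diagonality makes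
  the off-diagonal part of the matrix \<open>\<xi>\<^sub>m (h n)\<close> small, so \<open>v q\<^sub>S\<close> is approximated by \<open>q\<^sub>S\<close> followed
  by a finite propagation matrix. Finitely many such sets \<open>S\<close> cover all indices, and the errors have
  orthogonal ranges.
\<close>

subsection \<open>The Hilbert space of square-summable functions\<close>

text \<open>Membership in \<open>uroe\<close> yields approximations for one operator at a time,
  whereas the argument needs one threshold for all \<open>q J\<close> and one sparsity bound for all
  sign multiplications. Both families depend on the subset continuously only in the strong sense,
  not in norm. This is still enough for Baire category: an excess of norm or a failure of sparsity
  is witnessed by one vector and finitely many coordinates, so it persists on a cylinder. Passing
  from a cylinder to all subsets differs in the two uses. For projections, the finitely many
  exceptional indices are corrected by finitely many extra thresholds. Minimal projections have rank
  one because \<open>uroe\<close> contains every rank one operator: the projection onto a vector in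
  the range of an atom commutes with A and lies in A by maximality. A peak of height d may be small,
  but almost diagonality upgrades it to concentration: almost all mass of \<open>xi n\<close> lies
  near \<open>h n\<close>. All later estimates rest on this.\<close>

lemma l2I:
  assumes "\<And>F. finite F \<Longrightarrow> (\<Sum>x\<in>F. (cmod (f x))^2) \<le> K^2" "0 \<le> K"
  shows "f \<in> l2" "l2norm f \<le> K"
proof -
  have s: "(\<lambda>x. (cmod (f x))^2) summable_on UNIV"
    by (rule nonneg_bdd_above_summable_on) (auto simp: bdd_above_def intro!: exI[of _ "K^2"] assms)
  then show "f \<in> l2" by (simp add: l2_def)
  have "infsum (\<lambda>x. (cmod (f x))^2) UNIV \<le> K^2"
    using s assms by (intro infsum_le_finite_sums) auto
  then show "l2norm f \<le> K" unfolding l2norm_def using assms(2) real_le_lsqrt by (simp add: real_sqrt_le_iff real_le_lsqrt infsum_nonneg)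
qed

lemma l2_sum_le:
  assumes "f \<in> l2" "finite F"
  shows "(\<Sum>x\<in>F. (cmod (f x))^2) \<le> (l2norm f)^2"
  using assms by (simp add: l2norm_def infsum_nonneg l2_def finite_sum_le_infsum)

lemma l2_mult_summable:
  assumes "f \<in> l2" "g \<in> l2"
  shows "(\<lambda>x. f x * g x) summable_on UNIV"
proof -
  have s: "(\<lambda>x. (cmod (f x))^2 + (cmod (g x))^2) summable_on UNIV"
    using assms by (intro summable_on_add) (auto simp: l2_def)
  have "(\<lambda>x. norm (f x * g x)) summable_on UNIV"
  proof (rule Infinite_Sum.abs_summable_on_comparison_test[where g="\<lambda>x. (cmod (f x))^2 + (cmod (g x))^2"])
    show "(\<lambda>x. norm ((cmod (f x))^2 + (cmod (g x))^2)) summable_on UNIV"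
      using s by simp
    fix x
    have "0 \<le> (cmod (f x) - cmod (g x))^2" by simp
    then have "2 * (cmod (f x) * cmod (g x)) \<le> (cmod (f x))^2 + (cmod (g x))^2"
      by (simp add: power2_diff)
    moreover have "0 \<le> cmod (f x) * cmod (g x)" by simp
    ultimately have "cmod (f x) * cmod (g x) \<le> (cmod (f x))^2 + (cmod (g x))^2" by linarith
    then show "norm (f x * g x) \<le> norm ((cmod (f x))^2 + (cmod (g x))^2)"
      by (simp add: norm_mult)
  qed
  then show ?thesis by (rule abs_summable_summable)
qed

lemma l2_cnj: "f \<in> l2 \<Longrightarrow> (\<lambda>x. cnj (f x)) \<in> l2"
  by (simp add: l2_def)

lemma l2_add:
  assumes "f \<in> l2" "g \<in> l2" shows "(\<lambda>x. f x + g x) \<in> l2"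
proof -
  have "(\<lambda>x. 2 * (cmod (f x))^2 + 2 * (cmod (g x))^2) summable_on UNIV"
    using assms by (intro summable_on_add summable_on_cmult_right) (auto simp: l2_def)
  then show ?thesis unfolding l2_def mem_Collect_eq
  proof (rule summable_on_comparison_test)
    fix x
    have "(cmod (f x + g x))^2 \<le> (cmod (f x) + cmod (g x))^2"
      by (simp add: norm_triangle_ineq)
    also have "\<dots> \<le> 2 * (cmod (f x))^2 + 2 * (cmod (g x))^2"
      using zero_le_power2[of "cmod (f x) - cmod (g x)"] by (simp add: power2_sum power2_diff)
    finally show "(cmod (f x + g x))^2 \<le> 2 * (cmod (f x))^2 + 2 * (cmod (g x))^2" .
  qed auto
qed

lemma l2_scale: "f \<in> l2 \<Longrightarrow> (\<lambda>x. c * f x) \<in> l2"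
  by (simp add: l2_def norm_mult power_mult_distrib summable_on_cmult_right)

text \<open>Turning the vectors into a type gives access to the real Hilbert space classes and to
  \<open>blinfun\<close>. The complex structure is carried beside them by \<open>*\<^sub>c\<close>,
  \<open>cinner\<close> and the predicate \<open>clin\<close>.\<close>

typedef 'a ell2 = "l2 :: ('a \<Rightarrow> complex) set"
  morphisms cf Abs_ell2
  by (intro exI[of _ "\<lambda>_. 0"]) (simp add: l2_def)

setup_lifting type_definition_ell2

lemma cf_l2 [simp]: "cf f \<in> l2" by (rule cf)

instantiation ell2 :: (type) real_vector
begin
lift_definition zero_ell2 :: "'a ell2" is "\<lambda>_. 0" by (simp add: l2_def)
lift_definition plus_ell2 :: "'a ell2 \<Rightarrow> 'a ell2 \<Rightarrow> 'a ell2" is "\<lambda>f g x. f x + g x" by (rule l2_add)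
lift_definition uminus_ell2 :: "'a ell2 \<Rightarrow> 'a ell2" is "\<lambda>f x. - f x" using l2_scale[of _ "-1"] by simp
lift_definition minus_ell2 :: "'a ell2 \<Rightarrow> 'a ell2 \<Rightarrow> 'a ell2" is "\<lambda>f g x. f x - g x"
  using l2_add l2_scale[of _ "-1"] by fastforce
lift_definition scaleR_ell2 :: "real \<Rightarrow> 'a ell2 \<Rightarrow> 'a ell2" is "\<lambda>c f x. of_real c * f x" by (rule l2_scale)
instance by standard (transfer; auto simp: algebra_simps)+
end

lift_definition cs :: "complex \<Rightarrow> 'a ell2 \<Rightarrow> 'a ell2" (infixr "*\<^sub>c" 75) is "\<lambda>c f x. c * f x" by (rule l2_scale)

lemma cf_simps [simp]:
  "cf 0 x = 0" "cf (f + g) x = cf f x + cf g x" "cf (- f) x = - cf f x"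
  "cf (f - g) x = cf f x - cf g x" "cf (r *\<^sub>R f) x = of_real r * cf f x" "cf (c *\<^sub>c f) x = c * cf f x"
  by (transfer; simp)+

lemma cf_sum [simp]: "cf (sum f S) x = (\<Sum>i\<in>S. cf (f i) x)"
  by (induction S rule: infinite_finite_induct) auto

lemma ell2_eqI: "(\<And>x. cf f x = cf g x) \<Longrightarrow> f = g"
  by (transfer) auto

definition cinner :: "'a ell2 \<Rightarrow> 'a ell2 \<Rightarrow> complex" where
  "cinner f g = infsum (\<lambda>x. cf f x * cnj (cf g x)) UNIV"

lemma cinner_has_sum: "((\<lambda>x. cf f x * cnj (cf g x)) has_sum cinner f g) UNIV"
  unfolding cinner_def by (intro has_sum_infsum l2_mult_summable l2_cnj cf_l2)

lemma cinner_eqI: "((\<lambda>x. cf f x * cnj (cf g x)) has_sum s) UNIV \<Longrightarrow> cinner f g = s"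
  using cinner_has_sum has_sum_unique by blast

lemma cinner_add_left: "cinner (f + g) h = cinner f h + cinner g h"
  by (rule cinner_eqI) (simp add: distrib_right has_sum_add cinner_has_sum)

lemma cinner_scale_left [simp]: "cinner (c *\<^sub>c f) h = c * cinner f h"
  by (rule cinner_eqI) (simp add: mult.assoc has_sum_cmult_right cinner_has_sum)

lemma cinner_commute: "cinner f g = cnj (cinner g f)"
proof (rule cinner_eqI)
  have "((\<lambda>x. cnj (cf g x * cnj (cf f x))) has_sum cnj (cinner g f)) UNIV"
    using cinner_has_sum[of g f] by (simp only: has_sum_cnj_iff)
  then show "((\<lambda>x. cf f x * cnj (cf g x)) has_sum cnj (cinner g f)) UNIV"
    by (simp add: mult.commute)
qed

lemma scaleR_cs: "r *\<^sub>R f = complex_of_real r *\<^sub>c f"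
  by (rule ell2_eqI) simp

lemma cinner_self: "cinner f f = of_real ((l2norm (cf f))^2)"
proof (rule cinner_eqI)
  have "((\<lambda>x. (cmod (cf f x))^2) has_sum (l2norm (cf f))^2) UNIV"
    using cf_l2[of f] by (simp add: l2norm_def infsum_nonneg l2_def)
  then have "((\<lambda>x. complex_of_real ((cmod (cf f x))^2)) has_sum of_real ((l2norm (cf f))^2)) UNIV"
    by (rule has_sum_of_real)
  then show "((\<lambda>x. cf f x * cnj (cf f x)) has_sum of_real ((l2norm (cf f))^2)) UNIV"
    by (simp only: complex_norm_square)
qed

lemma l2norm_nonneg: "0 \<le> l2norm f"
  by (simp add: l2norm_def infsum_nonneg)

instantiation ell2 :: (type) real_inner
begin
definition inner_ell2 :: "'a ell2 \<Rightarrow> 'a ell2 \<Rightarrow> real" where "inner_ell2 f g = Re (cinner f g)"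
definition norm_ell2 :: "'a ell2 \<Rightarrow> real" where "norm_ell2 f = l2norm (cf f)"
definition dist_ell2 :: "'a ell2 \<Rightarrow> 'a ell2 \<Rightarrow> real" where "dist_ell2 f g = norm (f - g)"
definition sgn_ell2 :: "'a ell2 \<Rightarrow> 'a ell2" where "sgn_ell2 f = f /\<^sub>R norm f"
definition uniformity_ell2 :: "('a ell2 \<times> 'a ell2) filter"
  where "uniformity_ell2 = (INF e\<in>{0 <..}. principal {(x, y). dist x y < e})"
definition open_ell2 :: "'a ell2 set \<Rightarrow> bool"
  where "open_ell2 U \<longleftrightarrow> (\<forall>x\<in>U. eventually (\<lambda>(x', y). x' = x \<longrightarrow> y \<in> U) uniformity)"
instance
proof
  fix f g h :: "'a ell2" and r :: real
  show "dist f g = norm (f - g)" by (simp add: dist_ell2_def)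
  show "sgn f = f /\<^sub>R norm f" by (simp add: sgn_ell2_def)
  show "inner f g = inner g f"
    unfolding inner_ell2_def by (subst cinner_commute) simp
  show "inner (f + g) h = inner f h + inner g h" by (simp add: inner_ell2_def cinner_add_left)
  show "inner (r *\<^sub>R f) g = r * inner f g" by (simp add: inner_ell2_def scaleR_cs)
  show "0 \<le> inner f f" by (simp add: inner_ell2_def cinner_self)
  show "norm f = sqrt (inner f f)" by (simp add: inner_ell2_def cinner_self norm_ell2_def l2norm_nonneg)
  show "inner f f = 0 \<longleftrightarrow> f = 0"
  proof
    assume "inner f f = 0"
    then have "(l2norm (cf f))^2 = 0" by (simp add: inner_ell2_def cinner_self)
    then have "(cmod (cf f x))^2 \<le> 0" for x using l2_sum_le[of "cf f" "{x}"] by simp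
    then show "f = 0" by (intro ell2_eqI) simp
  qed (simp add: inner_ell2_def cinner_def)
qed (auto simp: uniformity_ell2_def open_ell2_def)
end

lemma cinner_norm: "cinner f f = of_real ((norm f)^2)"
  by (simp add: cinner_self norm_ell2_def)

lemma cinner_add_right: "cinner f (g + h) = cinner f g + cinner f h"
  using cinner_commute cinner_add_left by (metis complex_cnj_add)

lemma cinner_scale_right [simp]: "cinner f (c *\<^sub>c h) = cnj c * cinner f h"
  using cinner_commute cinner_scale_left by (metis complex_cnj_mult)

lemma cinner_0 [simp]: "cinner 0 f = 0" "cinner f 0 = 0"
  by (simp_all add: cinner_def)

lemma cs_simps: "c *\<^sub>c (f + g) = c *\<^sub>c f + c *\<^sub>c g" "(c + d) *\<^sub>c f = c *\<^sub>c f + d *\<^sub>c f"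
  "c *\<^sub>c (f - g) = c *\<^sub>c f - c *\<^sub>c g" "(c - d) *\<^sub>c f = c *\<^sub>c f - d *\<^sub>c f"
  by (rule ell2_eqI, simp add: algebra_simps)+

lemma cs_simps2 [simp]: "c *\<^sub>c d *\<^sub>c f = (c * d) *\<^sub>c f" "0 *\<^sub>c f = 0" "c *\<^sub>c 0 = 0" "1 *\<^sub>c f = f"
  by (rule ell2_eqI, simp add: algebra_simps)+

lemma minus_cs: "- f = (-1) *\<^sub>c f"
  by (rule ell2_eqI) simp

lemma cinner_minus_left: "cinner (- f) h = - cinner f h"
  by (simp add: minus_cs)
lemma cinner_minus_right: "cinner h (- f) = - cinner h f"
  by (simp add: minus_cs)
lemma cinner_diff_left: "cinner (f - g) h = cinner f h - cinner g h"
  using cinner_add_left[of f "-g"] by (simp add: cinner_minus_left)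
lemma cinner_diff_right: "cinner f (g - h) = cinner f g - cinner f h"
  using cinner_add_right[of f g "-h"] by (simp add: cinner_minus_right)
lemma cinner_sum_left: "cinner (sum f S) h = (\<Sum>i\<in>S. cinner (f i) h)"
  by (induction S rule: infinite_finite_induct) (auto simp: cinner_add_left)
lemma cinner_sum_right: "cinner h (sum f S) = (\<Sum>i\<in>S. cinner h (f i))"
  by (induction S rule: infinite_finite_induct) (auto simp: cinner_add_right)

lemma norm_cs [simp]: "norm (c *\<^sub>c f) = cmod c * norm f"
proof -
  have "complex_of_real ((norm (c *\<^sub>c f))^2) = (c * cnj c) * cinner f f"
    using cinner_norm[of "c *\<^sub>c f"] by (simp add: mult_ac)
  also have "\<dots> = of_real ((cmod c * norm f)^2)"
    by (simp add: cinner_norm power_mult_distrib flip: complex_norm_square)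
  finally have "complex_of_real ((norm (c *\<^sub>c f))^2) = of_real ((cmod c * norm f)^2)" .
  then have "(norm (c *\<^sub>c f))^2 = (cmod c * norm f)^2" using of_real_eq_iff by blast
  then show ?thesis by (simp add: power2_eq_iff_nonneg)
qed

lemma cinner_CS: "cmod (cinner f g) \<le> norm f * norm g"
proof (cases "cinner f g = 0")
  case False
  define c where "c = cnj (cinner f g) / cmod (cinner f g)"
  have c: "cmod c = 1" using False by (simp add: c_def norm_divide)
  have "cinner (c *\<^sub>c f) g = of_real (cmod (cinner f g))"
    using False by (simp add: c_def mult.commute[of "cnj _"] complex_norm_square[symmetric] power2_eq_square)
  then have "cmod (cinner f g) = inner (c *\<^sub>c f) g" by (simp add: inner_ell2_def)
  also have "\<dots> \<le> norm (c *\<^sub>c f) * norm g" by (rule norm_cauchy_schwarz)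
  finally show ?thesis using c by simp
qed simp

lemma bounded_linear_cinner: "bounded_linear (\<lambda>w. cinner w v)"
  by (rule bounded_linear_intro[where K="norm v"])
    (auto simp: cinner_add_left scaleR_cs cinner_CS scaleR_conv_of_real)

lemma cf_norm_le: "cmod (cf f x) \<le> norm f"
proof -
  have "(cmod (cf f x))^2 \<le> (norm f)^2" using l2_sum_le[of "cf f" "{x}"] by (simp add: norm_ell2_def)
  then show ?thesis by (simp add: power2_le_iff_abs_le)
qed

lemma ell2_sum_le: "finite F \<Longrightarrow> (\<Sum>x\<in>F. (cmod (cf f x))^2) \<le> (norm f)^2"
  by (simp add: norm_ell2_def l2_sum_le)

lemma ell2_norm_has_sum: "((\<lambda>x. (cmod (cf f x))^2) has_sum (norm f)^2) UNIV"
  using cf_l2[of f] by (simp add: norm_ell2_def l2norm_def infsum_nonneg l2_def)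

lemma ell2_norm_leI:
  assumes "\<And>F. finite F \<Longrightarrow> (\<Sum>x\<in>F. (cmod (cf f x))^2) \<le> K^2" "0 \<le> K"
  shows "norm f \<le> K"
  unfolding norm_ell2_def by (rule l2I(2)) (use assms in auto)

lift_definition ket :: "'a \<Rightarrow> 'a ell2" is "\<lambda>x y. if y = x then 1 else 0"
proof (rule l2I(1)[where K=1])
  fix x :: 'a and F :: "'a set" assume "finite F"
  then show "(\<Sum>y\<in>F. (cmod (if y = x then 1 else 0))^2) \<le> 1^2"
    by (simp add: if_distrib[of "\<lambda>z. (cmod z)^2"] sum.delta' cong: if_cong)
qed simp

lemma cf_ket: "cf (ket x) y = (if y = x then 1 else 0)"
  by transfer simp

lemma cinner_ket_right [simp]: "cinner f (ket x) = cf f x"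
proof (rule cinner_eqI)
  have "((\<lambda>y. cf f y * cnj (cf (ket x) y)) has_sum (\<Sum>y\<in>{x}. cf f y * cnj (cf (ket x) y))) {x}"
    by (rule has_sum_finite) simp
  then show "((\<lambda>y. cf f y * cnj (cf (ket x) y)) has_sum cf f x) UNIV"
    by (subst has_sum_cong_neutral[where S="UNIV" and T="{x}"]) (auto simp: cf_ket)
qed

lemma cinner_ket_left [simp]: "cinner (ket x) f = cnj (cf f x)"
  using cinner_commute cinner_ket_right by metis

lemma norm_ket [simp]: "norm (ket x) = 1"
  using cinner_norm[of "ket x"] by (simp add: cf_ket power2_eq_1_iff norm_ge_zero flip: of_real_power)
    (smt (verit) norm_ge_zero)

instance ell2 :: (type) complete_space
proof
  fix X :: "nat \<Rightarrow> 'a ell2" assume X: "Cauchy X"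
  have "Cauchy (\<lambda>n. cf (X n) x)" for x
  proof (rule metric_CauchyI)
    fix e :: real assume "e > 0"
    then obtain M where M: "\<forall>m\<ge>M. \<forall>n\<ge>M. dist (X m) (X n) < e" using X unfolding Cauchy_def by blast
    have "dist (cf (X m) x) (cf (X n) x) < e" if "m \<ge> M" "n \<ge> M" for m n
      using M that cf_norm_le[of "X m - X n" x] by (fastforce simp: dist_norm)
    then show "\<exists>M. \<forall>m\<ge>M. \<forall>n\<ge>M. dist (cf (X m) x) (cf (X n) x) < e" by blast
  qed
  then have "\<forall>x. \<exists>l. (\<lambda>n. cf (X n) x) \<longlonglongrightarrow> l" using Cauchy_convergent convergent_def by blast
  then obtain l where l: "\<And>x. (\<lambda>n. cf (X n) x) \<longlonglongrightarrow> l x" by metis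
  \<comment> \<open>A Fatou argument: bounds on finite partial sums pass to the coordinatewise
    limit. It gives both that the limit lies in \<open>l2\<close> and that convergence holds in
    norm.\<close>
  have bd: "(\<Sum>x\<in>F. (cmod (cf (X n) x - l x))^2) \<le> e^2"
    if "finite F" "e \<ge> 0" "\<forall>m\<ge>n. norm (X n - X m) \<le> e" for F n e
  proof (rule LIMSEQ_le_const2)
    show "(\<lambda>m. \<Sum>x\<in>F. (cmod (cf (X n) x - cf (X m) x))^2) \<longlonglongrightarrow> (\<Sum>x\<in>F. (cmod (cf (X n) x - l x))^2)"
      by (intro tendsto_intros l)
    have "(\<Sum>x\<in>F. (cmod (cf (X n) x - cf (X m) x))^2) \<le> e^2" if "m \<ge> n" for m
    proof -
      have "(\<Sum>x\<in>F. (cmod (cf (X n) x - cf (X m) x))^2) \<le> (norm (X n - X m))^2"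
        using ell2_sum_le[OF \<open>finite F\<close>, of "X n - X m"] by simp
      also have "\<dots> \<le> e^2" using \<open>\<forall>m\<ge>n. norm (X n - X m) \<le> e\<close> that by (intro power_mono) auto
      finally show ?thesis .
    qed
    then show "\<exists>N. \<forall>m\<ge>N. (\<Sum>x\<in>F. (cmod (cf (X n) x - cf (X m) x))^2) \<le> e^2" by blast
  qed
  have ex: "\<exists>M. \<forall>n\<ge>M. \<forall>m\<ge>n. norm (X n - X m) \<le> e" if "e > 0" for e
    using X that unfolding Cauchy_def dist_norm by (meson less_imp_le order_trans)
  obtain M where M: "\<forall>n\<ge>M. \<forall>m\<ge>n. norm (X n - X m) \<le> 1" using ex[of 1] by auto
  have dl: "(\<lambda>x. cf (X M) x - l x) \<in> l2" by (rule l2I(1)[where K=1]) (use bd[of _ 1 M] M in auto)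
  have "(\<lambda>x. cf (X M) x + (-1) * (cf (X M) x - l x)) \<in> l2" by (intro l2_add l2_scale dl) simp
  then have ll: "l \<in> l2" by (simp)
  define L where "L = Abs_ell2 l"
  have L: "cf L x = l x" for x using ll by (simp add: L_def Abs_ell2_inverse)
  have "X \<longlonglongrightarrow> L"
  proof (rule metric_LIMSEQ_I)
    fix e :: real assume "e > 0"
    then obtain M where M: "\<forall>n\<ge>M. \<forall>m\<ge>n. norm (X n - X m) \<le> e/2" using ex[of "e/2"] by auto
    have "norm (X n - L) \<le> e/2" if "n \<ge> M" for n
      by (rule ell2_norm_leI) (use bd[of _ "e/2" n] M that \<open>e>0\<close> in \<open>auto simp: L\<close>)
    then show "\<exists>no. \<forall>n\<ge>no. dist (X n) L < e" using \<open>e>0\<close> by (force simp: dist_norm)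
  qed
  then show "convergent X" by (auto simp: convergent_def)
qed

subsection \<open>Bounded matrices as operators\<close>

text \<open>A \<open>blinfun\<close> is only real-linear, so complex homogeneity is a separate
  predicate; an operator is determined by a complex orthonormal basis only when it holds.\<close>

definition clin :: "('a ell2 \<Rightarrow>\<^sub>L 'b ell2) \<Rightarrow> bool" where
  "clin T \<longleftrightarrow> (\<forall>c f. blinfun_apply T (c *\<^sub>c f) = c *\<^sub>c T f)"

definition mat_of :: "('a ell2 \<Rightarrow>\<^sub>L 'a ell2) \<Rightarrow> 'a mat" where
  "mat_of T = (\<lambda>x y. cf (T (ket y)) x)"

text \<open>Meaningful only under \<open>bounded_mat M\<close>, where it inverts
  \<open>mat_of\<close>; otherwise \<open>Abs_ell2\<close> and \<open>Blinfun\<close> may be applied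
  outside their domains.\<close>

definition opr :: "'a mat \<Rightarrow> 'a ell2 \<Rightarrow>\<^sub>L 'a ell2" where
  "opr M = Blinfun (\<lambda>f. Abs_ell2 (mat_app M (cf f)))"

section \<open>Orthonormal systems and orthonormal bases\<close>

definition orthonormal :: "('i \<Rightarrow> 'a ell2) \<Rightarrow> bool" where
  "orthonormal b \<longleftrightarrow> (\<forall>i j. cinner (b i) (b j) = (if i = j then 1 else 0))"

lemma orthonormal_ket: "orthonormal ket"
  by (auto simp: orthonormal_def cf_ket)

lemma orthonormal_cinner_sum:
  assumes "orthonormal b" "finite F"
  shows "cinner (\<Sum>i\<in>F. c i *\<^sub>c b i) (b j) = (if j \<in> F then c j else 0)"
  using assms by (simp add: cinner_sum_left orthonormal_def if_distrib[of "\<lambda>z. _ * z"] cong: if_cong)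

lemma orthonormal_norm_sum:
  assumes "orthonormal b" "finite F"
  shows "(norm (\<Sum>i\<in>F. c i *\<^sub>c b i))^2 = (\<Sum>i\<in>F. (cmod (c i))^2)"
proof -
  have "complex_of_real ((norm (\<Sum>i\<in>F. c i *\<^sub>c b i))^2) = (\<Sum>i\<in>F. c i * cnj (c i))"
    unfolding cinner_norm[symmetric]
    by (subst cinner_sum_right) (auto simp: orthonormal_cinner_sum[OF assms] mult.commute intro!: sum.cong)
  also have "\<dots> = complex_of_real (\<Sum>i\<in>F. (cmod (c i))^2)"
    by (simp only: of_real_sum complex_norm_square)
  finally show ?thesis using of_real_eq_iff by blast
qed

lemma pythagoras:
  assumes "cinner f g = 0" shows "(norm (f + g))^2 = (norm f)^2 + (norm g)^2"
proof -
  have "cinner g f = 0" using assms cinner_commute[of g f] by simp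
  then have "cinner (f + g) (f + g) = cinner f f + cinner g g"
    using assms by (simp add: cinner_add_left cinner_add_right)
  then have "complex_of_real ((norm (f + g))^2) = of_real ((norm f)^2 + (norm g)^2)"
    by (simp only: cinner_norm of_real_add)
  then show ?thesis using of_real_eq_iff by blast
qed

text \<open>The residual is orthogonal to each \<open>b i\<close> with i in F, so Pythagoras
  applies. Nonnegativity of the left side is Bessel's inequality; its limit gives norm convergence
  of expansions.\<close>

lemma orthonormal_residual:
  assumes "orthonormal b" "finite F"
  shows "(norm (u - (\<Sum>i\<in>F. cinner u (b i) *\<^sub>c b i)))^2 = (norm u)^2 - (\<Sum>i\<in>F. (cmod (cinner u (b i)))^2)"
proof -
  let ?s = "\<Sum>i\<in>F. cinner u (b i) *\<^sub>c b i"
  have "cinner (u - ?s) (b j) = 0" if "j \<in> F" for j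
    using that by (simp add: cinner_diff_left orthonormal_cinner_sum[OF assms])
  then have "cinner (u - ?s) ?s = 0"
    by (subst cinner_sum_right) simp
  from pythagoras[OF this] show ?thesis
    by (simp add: orthonormal_norm_sum[OF assms])
qed

lemma bessel:
  assumes "orthonormal b" "finite F"
  shows "(\<Sum>i\<in>F. (cmod (cinner u (b i)))^2) \<le> (norm u)^2"
  using orthonormal_residual[OF assms, of u] zero_le_power2[of "norm (u - (\<Sum>i\<in>F. cinner u (b i) *\<^sub>c b i))"]
  by linarith

text \<open>Completeness is encoded as Parseval's identity with an unordered sum. For
  \<open>ket\<close> this is just the formula for the norm, and for every index type it yields
  \<open>expansion\<close>; for \<open>xi\<close> it is obtained from totality by
  \<open>onb_nat\<close>.\<close>

locale onb =
  fixes b :: "'i \<Rightarrow> 'a ell2"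
  assumes ortho: "orthonormal b"
    and parseval: "\<And>u. ((\<lambda>i. (cmod (cinner u (b i)))^2) has_sum (norm u)^2) UNIV"
begin

lemma cinner_b: "cinner (b i) (b j) = (if i = j then 1 else 0)"
  using ortho by (auto simp: orthonormal_def)

lemma norm_b [simp]: "norm (b i) = 1"
proof -
  have "complex_of_real ((norm (b i))^2) = 1" using cinner_norm[of "b i"] by (simp add: cinner_b)
  then have "(norm (b i))^2 = 1" using of_real_eq_1_iff by blast
  then show ?thesis by (simp add: abs_square_eq_1)
qed

lemma expansion: "((\<lambda>i. cinner u (b i) *\<^sub>c b i) has_sum u) UNIV"
proof -
  have "((\<lambda>F. (norm u)^2 - (\<Sum>i\<in>F. (cmod (cinner u (b i)))^2)) \<longlongrightarrow> (norm u)^2 - (norm u)^2) (finite_subsets_at_top UNIV)"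
    using parseval[of u] unfolding has_sum_def by (intro tendsto_diff tendsto_const)
  then have "((\<lambda>F. sqrt ((norm u)^2 - (\<Sum>i\<in>F. (cmod (cinner u (b i)))^2))) \<longlongrightarrow> sqrt 0) (finite_subsets_at_top UNIV)"
    by (intro tendsto_real_sqrt) simp
  moreover have "\<forall>\<^sub>F F in finite_subsets_at_top UNIV. sqrt ((norm u)^2 - (\<Sum>i\<in>F. (cmod (cinner u (b i)))^2))
        = norm (u - (\<Sum>i\<in>F. cinner u (b i) *\<^sub>c b i))"
    by (rule eventually_finite_subsets_at_top_weakI) (simp flip: orthonormal_residual[OF ortho])
  ultimately have "((\<lambda>F. norm (u - (\<Sum>i\<in>F. cinner u (b i) *\<^sub>c b i))) \<longlongrightarrow> 0) (finite_subsets_at_top UNIV)"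
    by (simp add: tendsto_cong)
  then have "((\<lambda>F. norm ((\<Sum>i\<in>F. cinner u (b i) *\<^sub>c b i) - u)) \<longlongrightarrow> 0) (finite_subsets_at_top UNIV)"
    by (simp add: norm_minus_commute)
  then have "((\<lambda>F. (\<Sum>i\<in>F. cinner u (b i) *\<^sub>c b i)) \<longlongrightarrow> u) (finite_subsets_at_top UNIV)"
    by (rule LIM_zero_cancel[OF tendsto_norm_zero_cancel])
  then show ?thesis by (simp add: has_sum_def)
qed

lemma cparseval: "((\<lambda>i. cinner u (b i) * cnj (cinner v (b i))) has_sum cinner u v) UNIV"
proof -
  from has_sum_bounded_linear[OF bounded_linear_cinner expansion[of u], of v]
  have "((\<lambda>i. cinner u (b i) * cinner (b i) v) has_sum cinner u v) UNIV" by (simp add: o_def)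
  moreover have "cinner (b i) v = cnj (cinner v (b i))" for i by (rule cinner_commute)
  ultimately show ?thesis by (simp only:)
qed

lemma norm_leI:
  assumes "\<And>F. finite F \<Longrightarrow> (\<Sum>i\<in>F. (cmod (cinner u (b i)))^2) \<le> K^2" "0 \<le> K"
  shows "norm u \<le> K"
proof -
  have "(norm u)^2 \<le> K^2"
    by (rule has_sum_le_finite_sums[OF parseval]) (simp add: assms(1))
  then show ?thesis using assms(2) by (simp add: power2_le_iff_abs_le)
qed

lemma eqI: "(\<And>i. cinner u (b i) = cinner v (b i)) \<Longrightarrow> u = v"
  using norm_leI[of "u - v" 0] by (simp add: cinner_diff_left)

lemma blinfun_eqI:
  fixes S T :: "'a ell2 \<Rightarrow>\<^sub>L 'c ell2"
  assumes "clin S" "clin T" "\<And>i. S (b i) = T (b i)"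
  shows "S = T"
proof (rule blinfun_eqI)
  fix u
  have "((\<lambda>i. cinner u (b i) *\<^sub>c S (b i)) has_sum S u) UNIV" if "clin S" for S :: "'a ell2 \<Rightarrow>\<^sub>L 'c ell2"
    using has_sum_bounded_linear[OF blinfun.bounded_linear_right expansion[of u], of S] that
    by (simp add: o_def clin_def)
  from this[OF assms(1)] this[OF assms(2)] show "S u = T u"
    by (simp only: assms(3)) (rule has_sum_unique)
qed

end

text \<open>Riesz-Fischer: by Bessel the partial sums are Cauchy, their limit has the coefficients
  of u, and totality identifies the two. The residual identity then turns norm convergence into
  Parseval.\<close>

lemma onb_nat:
  fixes b :: "nat \<Rightarrow> 'a ell2"
  assumes b: "orthonormal b" and total: "\<And>u. (\<And>i. cinner u (b i) = 0) \<Longrightarrow> u = 0"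
  shows "onb b"
proof
  show "orthonormal b" by fact
  fix u
  define s where "s N = (\<Sum>i<N. cinner u (b i) *\<^sub>c b i)" for N
  let ?c = "\<lambda>i. (cmod (cinner u (b i)))^2"
  have sm: "summable ?c"
    using bessel[OF b, of _ u] by (intro summableI_nonneg_bounded[where x="(norm u)^2"]) auto
  have d: "(norm (s N - s M))^2 = (\<Sum>i\<in>{M..<N}. ?c i)" if "M \<le> N" for M N
  proof -
    have "s N - s M = (\<Sum>i\<in>{M..<N}. cinner u (b i) *\<^sub>c b i)"
      unfolding s_def lessThan_atLeast0 using that by (intro sum_diff_nat_ivl) auto
    then show ?thesis by (simp add: orthonormal_norm_sum[OF b])
  qed
  have "Cauchy s"
  proof (rule CauchyI')
    fix e :: real assume "e > 0"
    then obtain M where M: "\<And>m n. m \<ge> M \<Longrightarrow> norm (sum ?c {m..<n}) < e^2"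
      using sm[unfolded summable_Cauchy, rule_format, of "e^2"] by auto
    have "norm (s m - s n) < e" if "m \<ge> M" "n > m" for m n
    proof -
      have "(norm (s n - s m))^2 < e^2"
        using d[of m n] M[of m n] that by (simp add: sum_nonneg)
      then show ?thesis using \<open>e>0\<close> by (simp add: norm_minus_commute power2_less_imp_less)
    qed
    then show "\<exists>M. \<forall>m\<ge>M. \<forall>n>m. dist (s m) (s n) < e" by (auto simp: dist_norm)
  qed
  then obtain l where l: "s \<longlonglongrightarrow> l" using Cauchy_convergent convergent_def by blast
  have "cinner (u - l) (b j) = 0" for j
  proof -
    have "(\<lambda>N. cinner (s N) (b j)) \<longlonglongrightarrow> cinner l (b j)"
      by (rule bounded_linear.tendsto[OF bounded_linear_cinner l])
    moreover have "\<forall>\<^sub>F N in sequentially. cinner (s N) (b j) = cinner u (b j)"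
      using eventually_gt_at_top[of j]
      by eventually_elim (simp add: s_def orthonormal_cinner_sum[OF b])
    ultimately have "cinner l (b j) = cinner u (b j)"
      by (intro LIMSEQ_unique[OF _ tendsto_eventually])
    then show ?thesis by (simp add: cinner_diff_left)
  qed
  then have "u = l" using total[of "u - l"] by simp
  then have "(\<lambda>N. (norm (u - s N))^2) \<longlonglongrightarrow> 0"
    using tendsto_power[OF tendsto_norm[OF tendsto_diff[OF tendsto_const[of u] l]], of 2] by simp
  then have "(\<lambda>N. (norm u)^2 - (\<Sum>i<N. ?c i)) \<longlonglongrightarrow> 0"
    unfolding s_def by (simp add: orthonormal_residual[OF b])
  then have "(\<lambda>N. (norm u)^2 - ((norm u)^2 - (\<Sum>i<N. ?c i))) \<longlonglongrightarrow> (norm u)^2 - 0"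
    by (intro tendsto_diff tendsto_const)
  then have "?c sums (norm u)^2" by (simp add: sums_def)
  then show "(?c has_sum (norm u)^2) UNIV"
    by (rule sums_nonneg_imp_has_sum) simp
qed

section \<open>Operators and their matrices in the standard basis\<close>

interpretation ket: onb ket
  by standard (auto simp: orthonormal_ket ell2_norm_has_sum)

lemma clin_has_sum:
  assumes "clin T"
  shows "((\<lambda>y. cf f y *\<^sub>c T (ket y)) has_sum T f) UNIV"
  using has_sum_bounded_linear[OF blinfun.bounded_linear_right ket.expansion[of f], of T] assms
  by (simp add: o_def clin_def)

lemma bounded_linear_cf: "bounded_linear (\<lambda>f. cf f x)"
  by (rule bounded_linear_intro[where K=1]) (auto simp: cf_norm_le scaleR_conv_of_real)

lemma bounded_linear_cs: "bounded_linear ((*\<^sub>c) c)"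
  by (rule bounded_linear_intro[where K="cmod c"]) (auto simp: cs_simps scaleR_cs mult.commute)

lemma mat_of_has_sum:
  assumes "clin T"
  shows "((\<lambda>y. mat_of T x y * cf f y) has_sum cf (T f) x) UNIV"
  using has_sum_bounded_linear[OF bounded_linear_cf clin_has_sum[OF assms, of f], of x]
  by (simp add: o_def mat_of_def mult.commute)

lemma bounded_mat_mat_of:
  assumes "clin T" shows "bounded_mat (mat_of T)"
proof -
  have e: "mat_app (mat_of T) (cf f) = cf (T f)" for f
    using mat_of_has_sum[OF assms] by (auto simp: mat_app_def infsumI)
  have s: "(\<lambda>y. mat_of T x y * cf f y) summable_on UNIV" for x f
    using mat_of_has_sum[OF assms] by (meson has_sum_imp_summable)
  have r: "\<exists>h. f = cf h" if "f \<in> l2" for f :: "'a \<Rightarrow> complex"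
    using that Abs_ell2_inverse by metis
  show ?thesis unfolding bounded_mat_def
  proof (intro conjI ballI allI)
    show "\<exists>K. \<forall>f\<in>l2. l2norm (mat_app (mat_of T) f) \<le> K * l2norm f"
    proof (intro exI ballI)
      fix f :: "'a \<Rightarrow> complex" assume "f \<in> l2"
      then obtain h where "f = cf h" using r by blast
      then show "l2norm (mat_app (mat_of T) f) \<le> norm T * l2norm f"
        using norm_blinfun[of T h] by (simp add: e norm_ell2_def)
    qed
  next
    fix f :: "'a \<Rightarrow> complex" and x assume "f \<in> l2"
    then obtain h where "f = cf h" using r by blast
    then show "(\<lambda>y. mat_of T x y * f y) summable_on UNIV" using s by simp
  next
    fix f :: "'a \<Rightarrow> complex" assume "f \<in> l2"
    then obtain h where "f = cf h" using r by blast
    then show "mat_app (mat_of T) f \<in> l2" by (simp add: e)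
  qed
qed

lemma
  assumes "bounded_mat M"
  shows opr_has_sum: "((\<lambda>y. M x y * cf f y) has_sum cf (opr M f) x) UNIV"
    and clin_opr: "clin (opr M)"
proof -
  obtain K where K: "\<forall>f\<in>l2. l2norm (mat_app M f) \<le> K * l2norm f" using assms bounded_mat_def by blast
  have e: "cf (Abs_ell2 (mat_app M (cf f))) = mat_app M (cf f)" for f
    using assms by (simp add: Abs_ell2_inverse bounded_mat_def)
  have s: "(\<lambda>y. M x y * cf f y) summable_on UNIV" for x f using assms by (simp add: bounded_mat_def)
  have "bounded_linear (\<lambda>f. Abs_ell2 (mat_app M (cf f)))"
  proof (rule bounded_linear_intro)
    fix f g show "Abs_ell2 (mat_app M (cf (f + g))) = Abs_ell2 (mat_app M (cf f)) + Abs_ell2 (mat_app M (cf g))"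
      by (rule ell2_eqI) (simp only: e cf_simps, simp add: mat_app_def distrib_left infsum_add s)
  next
    fix r f show "Abs_ell2 (mat_app M (cf (r *\<^sub>R f))) = r *\<^sub>R Abs_ell2 (mat_app M (cf f))"
      by (rule ell2_eqI) (simp only: e cf_simps, simp add: mat_app_def mult.left_commute infsum_cmult_right')
  next
    fix f show "norm (Abs_ell2 (mat_app M (cf f))) \<le> norm f * K"
      using K by (simp add: norm_ell2_def e mult.commute)
  qed
  then have o: "opr M f = Abs_ell2 (mat_app M (cf f))" for f
    by (simp add: opr_def bounded_linear_Blinfun_apply)
  show "((\<lambda>y. M x y * cf f y) has_sum cf (opr M f) x) UNIV"
    using s by (simp only: o e) (simp add: mat_app_def)
  show "clin (opr M)" unfolding clin_def
    by (intro allI ell2_eqI) (simp only: o e cf_simps, simp add: mat_app_def mult.left_commute infsum_cmult_right')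
qed

lemma mat_of_opr [simp]: "bounded_mat M \<Longrightarrow> mat_of (opr M) = M"
proof (intro ext)
  fix x y assume M: "bounded_mat M"
  have "((\<lambda>z. M x z * cf (ket y) z) has_sum M x y) UNIV"
    by (subst has_sum_cong_neutral[where S=UNIV and T="{y}" and g="\<lambda>z. M x z * cf (ket y) z"])
      (auto simp: cf_ket intro: has_sum_finiteI)
  then show "mat_of (opr M) x y = M x y"
    unfolding mat_of_def using opr_has_sum[OF M] has_sum_unique by blast
qed

lemma opr_mat_of [simp]: "clin T \<Longrightarrow> opr (mat_of T) = T"
proof (intro blinfun_eqI ell2_eqI)
  fix f x assume T: "clin T"
  show "cf (opr (mat_of T) f) x = cf (T f) x"
    using opr_has_sum[OF bounded_mat_mat_of[OF T]] mat_of_has_sum[OF T] has_sum_unique by blast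
qed

lemma opr_app: "bounded_mat M \<Longrightarrow> mat_app M (cf f) = cf (opr M f)"
  by (rule ext) (simp add: mat_app_def infsumI[OF opr_has_sum])

lemma opr_eqI: "bounded_mat M \<Longrightarrow> bounded_mat N \<Longrightarrow> opr M = opr N \<Longrightarrow> M = N"
  using mat_of_opr by metis

lemma opnorm_opr:
  assumes "bounded_mat M" shows "opnorm M = norm (opr M)"
proof -
  have S: "{l2norm (mat_app M f) | f. f \<in> l2 \<and> l2norm f \<le> 1} = {norm (opr M f) | f. norm f \<le> 1}" (is "?A = ?B")
  proof (intro equalityI subsetI)
    fix z assume "z \<in> ?A"
    then obtain f where f: "f \<in> l2" "l2norm f \<le> 1" "z = l2norm (mat_app M f)" by blast
    then obtain h where h: "f = cf h" using Abs_ell2_inverse by metis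
    have "z = norm (opr M h)" "norm h \<le> 1"
      using f unfolding h by (simp_all add: opr_app[OF assms] norm_ell2_def)
    then show "z \<in> ?B" by blast
  next
    fix z assume "z \<in> ?B"
    then obtain f where "norm f \<le> 1" "z = norm (opr M f)" by blast
    then show "z \<in> ?A"
      by (simp add: norm_ell2_def flip: opr_app[OF assms]) (use cf_l2 in blast)
  qed
  have le: "z \<le> norm (opr M)" if z: "z \<in> ?B" for z
  proof -
    obtain f where f: "norm f \<le> 1" "z = norm (opr M f)" using z by blast
    have "norm (opr M f) \<le> norm (opr M) * norm f" by (rule norm_blinfun)
    also have "\<dots> \<le> norm (opr M)" using f(1) by (simp add: mult_left_le)
    finally show ?thesis using f by simp
  qed
  have bdd: "bdd_above ?B" using le by (meson bdd_above.I)
  have ne: "?B \<noteq> {}" by (auto intro!: exI[of _ 0])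
  have pos: "0 \<le> Sup ?B"
    by (rule cSup_upper2[OF _ _ bdd, of "norm (opr M 0)"]) (auto intro!: exI[of _ 0])
  have "norm (opr M) \<le> Sup ?B"
  proof (rule norm_blinfun_bound[OF pos])
    fix f show "norm (opr M f) \<le> Sup ?B * norm f"
    proof (cases "f = 0")
      case False
      have "norm (opr M ((1 / norm f) *\<^sub>R f)) \<le> Sup ?B"
        using False by (intro cSup_upper[OF _ bdd]) (auto intro!: exI[of _ "(1 / norm f) *\<^sub>R f"])
      then show ?thesis using False by (simp add: blinfun.scaleR_right field_simps)
    qed simp
  qed
  moreover have "Sup ?B \<le> norm (opr M)" by (rule cSup_least[OF ne le])
  ultimately show ?thesis unfolding opnorm_def S by simp
qed

section \<open>Adjoints and the matrix operations\<close>

definition adj :: "('a ell2 \<Rightarrow>\<^sub>L 'a ell2) \<Rightarrow> ('a ell2 \<Rightarrow>\<^sub>L 'a ell2)" where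
  "adj T = Blinfun (\<lambda>g. Abs_ell2 (\<lambda>y. cinner g (T (ket y))))"

lemma
  assumes T: "clin T"
  shows cinner_adj: "cinner (adj T g) f = cinner g (T f)"
    and clin_adj: "clin (adj T)"
proof -
  \<comment> \<open>\<open>?t\<close> is the truncation to F of the prospective vector
    \<open>adj T g\<close>. Its squared norm equals \<open>cinner (T ?t) g\<close>, which is at most
    \<open>norm T * norm ?t * norm g\<close>, and one factor \<open>norm ?t\<close> cancels.\<close>
  have b: "(\<Sum>y\<in>F. (cmod (cinner g (T (ket y))))^2) \<le> (norm T * norm g)^2" if F: "finite F" for F g
  proof -
    define a where "a y = cnj (cinner (T (ket y)) g)" for y
    let ?t = "\<Sum>y\<in>F. a y *\<^sub>c ket y"
    have n: "(norm ?t)^2 = (\<Sum>y\<in>F. (cmod (a y))^2)"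
      by (rule orthonormal_norm_sum[OF orthonormal_ket F])
    have "cinner (T ?t) g = (\<Sum>y\<in>F. a y * cnj (a y))"
      using T by (simp add: blinfun.sum_right clin_def cinner_sum_left a_def)
    also have "\<dots> = of_real ((norm ?t)^2)" by (simp only: n of_real_sum complex_norm_square)
    finally have "(norm ?t)^2 = cmod (cinner (T ?t) g)" by (simp add: norm_power)
    also have "\<dots> \<le> norm T * norm ?t * norm g"
      using cinner_CS[of "T ?t" g] norm_blinfun[of T ?t] by (meson mult_right_mono norm_ge_zero order_trans)
    finally have "norm ?t * norm ?t \<le> (norm T * norm g) * norm ?t" by (simp add: power2_eq_square mult_ac)
    then have "norm ?t \<le> norm T * norm g"
      by (cases "norm ?t = 0") (auto simp: mult_le_cancel_right)
    then have "(norm ?t)^2 \<le> (norm T * norm g)^2" by (intro power_mono) auto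
    moreover have "cmod (cinner g (T (ket y))) = cmod (a y)" for y
      unfolding a_def by (subst cinner_commute) simp
    ultimately show ?thesis by (simp only: n)
  qed
  have l: "(\<lambda>y. cinner g (T (ket y))) \<in> l2" and ln: "l2norm (\<lambda>y. cinner g (T (ket y))) \<le> norm T * norm g" for g
    by (rule l2I[OF b]; simp)+
  have e: "cf (Abs_ell2 (\<lambda>y. cinner g (T (ket y)))) = (\<lambda>y. cinner g (T (ket y)))" for g
    using l by (simp add: Abs_ell2_inverse)
  have "bounded_linear (\<lambda>g. Abs_ell2 (\<lambda>y. cinner g (T (ket y))))"
  proof (rule bounded_linear_intro[where K="norm T"])
    fix g h r
    show "Abs_ell2 (\<lambda>y. cinner (g + h) (T (ket y))) = Abs_ell2 (\<lambda>y. cinner g (T (ket y))) + Abs_ell2 (\<lambda>y. cinner h (T (ket y)))"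
      by (rule ell2_eqI) (simp only: e cf_simps, simp only: cinner_add_left)
    show "Abs_ell2 (\<lambda>y. cinner (r *\<^sub>R g) (T (ket y))) = r *\<^sub>R Abs_ell2 (\<lambda>y. cinner g (T (ket y)))"
      by (rule ell2_eqI) (simp only: e cf_simps, simp only: scaleR_cs cinner_scale_left)
    show "norm (Abs_ell2 (\<lambda>y. cinner g (T (ket y)))) \<le> norm g * norm T"
      using ln[of g] by (simp add: norm_ell2_def e mult.commute)
  qed
  then have a: "cf (adj T g) y = cinner g (T (ket y))" for g y
    by (simp add: adj_def bounded_linear_Blinfun_apply e)
  show "clin (adj T)" unfolding clin_def by (intro allI ell2_eqI) (simp add: a)
  have bl: "bounded_linear (\<lambda>w. cnj (cinner w g))"
    by (rule bounded_linear_intro[where K="norm g"])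
      (auto simp: cinner_add_left scaleR_cs cinner_CS scaleR_conv_of_real)
  show "cinner (adj T g) f = cinner g (T f)"
  proof (rule cinner_eqI)
    show "((\<lambda>x. cf (adj T g) x * cnj (cf f x)) has_sum cinner g (T f)) UNIV"
      using has_sum_bounded_linear[OF bl clin_has_sum[OF T, of f]]
      by (simp add: o_def a cinner_commute[symmetric] mult.commute)
  qed
qed

lemma madj_mat_of: "clin T \<Longrightarrow> madj (mat_of T) = mat_of (adj T)"
proof (intro ext)
  fix x y assume "clin T"
  then have "cinner (adj T (ket y)) (ket x) = cinner (ket y) (T (ket x))" by (rule cinner_adj)
  then show "madj (mat_of T) x y = mat_of (adj T) x y" by (simp add: madj_def mat_of_def)
qed

lemma clin_simps:
  "clin S \<Longrightarrow> clin T \<Longrightarrow> clin (S o\<^sub>L T)" "clin S \<Longrightarrow> clin T \<Longrightarrow> clin (S + T)" "clin S \<Longrightarrow> clin T \<Longrightarrow> clin (S - T)"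
  "clin id_blinfun" "clin 0"
  by (auto simp: clin_def blinfun.add_left blinfun.diff_left cs_simps)

lift_definition scale_op :: "complex \<Rightarrow> 'a ell2 \<Rightarrow>\<^sub>L 'a ell2" is "\<lambda>c f. c *\<^sub>c f" by (rule bounded_linear_cs)

lemma clin_scale_op: "clin (scale_op c)"
  unfolding clin_def by transfer (simp add: mult.commute)

lemma
  assumes M: "bounded_mat M" and N: "bounded_mat N"
  shows mmult_mat_of: "mmult M N = mat_of (opr M o\<^sub>L opr N)"
    and madd_mat_of: "madd M N = mat_of (opr M + opr N)"
    and mminus_mat_of: "mminus M N = mat_of (opr M - opr N)"
    and msmult_mat_of: "msmult c M = mat_of (scale_op c o\<^sub>L opr M)"
    and madj_opr: "madj M = mat_of (adj (opr M))"
proof -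
  have c: "cf (opr M (ket y)) x = M x y" for x y using mat_of_opr[OF M] by (simp add: mat_of_def fun_eq_iff)
  have d: "cf (opr N (ket y)) x = N x y" for x y using mat_of_opr[OF N] by (simp add: mat_of_def fun_eq_iff)
  show "mmult M N = mat_of (opr M o\<^sub>L opr N)"
    unfolding mmult_def mat_of_def using opr_has_sum[OF M, of _ "opr N (ket _)"]
    by (intro ext infsumI) (simp add: d)
  show "madd M N = mat_of (opr M + opr N)" "mminus M N = mat_of (opr M - opr N)"
    by (auto simp: madd_def mminus_def mat_of_def blinfun.add_left blinfun.diff_left c d)
  show "msmult c M = mat_of (scale_op c o\<^sub>L opr M)"
    by (auto simp: msmult_def mat_of_def scale_op.rep_eq c)
  show "madj M = mat_of (adj (opr M))"
    using madj_mat_of[OF clin_opr[OF M]] M by simp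
qed

lemma mid_mat_of: "mid = mat_of id_blinfun"
  by (auto simp: mid_def mat_of_def cf_ket)

lemma mzero_mat_of: "mzero = mat_of 0"
  by (auto simp: mzero_def mat_of_def)

lemma bounded_mzero [simp]: "bounded_mat mzero" and opr_mzero [simp]: "opr mzero = 0"
  and bounded_mid [simp]: "bounded_mat mid" and opr_mid [simp]: "opr mid = id_blinfun"
  by (simp_all add: mzero_mat_of mid_mat_of bounded_mat_mat_of clin_simps)

lemma
  assumes M: "bounded_mat M" and N: "bounded_mat N"
  shows bounded_mmult: "bounded_mat (mmult M N)" and opr_mmult: "opr (mmult M N) = opr M o\<^sub>L opr N"
    and bounded_madd: "bounded_mat (madd M N)" and opr_madd: "opr (madd M N) = opr M + opr N"
    and bounded_mminus: "bounded_mat (mminus M N)" and opr_mminus: "opr (mminus M N) = opr M - opr N"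
  using clin_opr[OF M] clin_opr[OF N]
  by (auto simp: mmult_mat_of[OF M N] madd_mat_of[OF M N] mminus_mat_of[OF M N] bounded_mat_mat_of clin_simps)

lemma
  assumes M: "bounded_mat M"
  shows bounded_madj: "bounded_mat (madj M)" and opr_madj: "opr (madj M) = adj (opr M)"
    and bounded_msmult: "bounded_mat (msmult c M)" and opr_msmult: "opr (msmult c M) = scale_op c o\<^sub>L opr M"
  using clin_opr[OF M]
  by (auto simp: madj_opr[OF M M] msmult_mat_of[OF M M] bounded_mat_mat_of clin_simps clin_adj clin_scale_op)

lemmas bounded_mat_ops = bounded_mmult bounded_madd bounded_mminus bounded_madj bounded_msmult

lemma opnorm_mminus: "bounded_mat M \<Longrightarrow> bounded_mat N \<Longrightarrow> opnorm (mminus M N) = norm (opr M - opr N)"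
  by (simp add: opnorm_opr bounded_mminus opr_mminus)

lemma cinner_opr: "bounded_mat M \<Longrightarrow> cinner (opr M f) g = cinner f (opr (madj M) g)"
proof -
  assume M: "bounded_mat M"
  have "cinner (opr M f) g = cnj (cinner g (opr M f))" by (rule cinner_commute)
  also have "\<dots> = cnj (cinner (opr (madj M) g) f)" by (simp add: opr_madj cinner_adj clin_opr M)
  also have "\<dots> = cinner f (opr (madj M) g)" by (rule cinner_commute[symmetric])
  finally show ?thesis .
qed

lemma madj_madj [simp]: "madj (madj M) = M"
  by (simp add: madj_def)

section \<open>Closure properties of C*-subalgebras\<close>

lemma cstar_subalg_bounded: "cstar_subalg {M. bounded_mat M}"
  by (simp add: cstar_subalg_def bounded_mat_ops)

lemma cstar_subalgD:
  assumes "cstar_subalg B"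
  shows "M \<in> B \<Longrightarrow> bounded_mat M" "mzero \<in> B" "M \<in> B \<Longrightarrow> N \<in> B \<Longrightarrow> madd M N \<in> B" "M \<in> B \<Longrightarrow> msmult c M \<in> B"
    "M \<in> B \<Longrightarrow> N \<in> B \<Longrightarrow> mmult M N \<in> B" "M \<in> B \<Longrightarrow> madj M \<in> B"
proof -
  note a = assms[unfolded cstar_subalg_def]
  show "M \<in> B \<Longrightarrow> bounded_mat M" using a[THEN conjunct1] by blast
  note a = a[THEN conjunct2]
  show "mzero \<in> B" using a[THEN conjunct1] .
  note a = a[THEN conjunct2]
  show "M \<in> B \<Longrightarrow> N \<in> B \<Longrightarrow> madd M N \<in> B" using a[THEN conjunct1] by blast
  note a = a[THEN conjunct2]
  show "M \<in> B \<Longrightarrow> msmult c M \<in> B" using a[THEN conjunct1] by blast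
  note a = a[THEN conjunct2]
  show "M \<in> B \<Longrightarrow> N \<in> B \<Longrightarrow> mmult M N \<in> B" using a[THEN conjunct1] by blast
  note a = a[THEN conjunct2]
  show "M \<in> B \<Longrightarrow> madj M \<in> B" using a[THEN conjunct1] by blast
qed

lemma cstar_gen_mem:
  assumes "M \<in> cstar_gen S" "cstar_subalg B" "S \<subseteq> B" shows "M \<in> B"
  using assms by (auto simp: cstar_gen_def)

lemma cstar_subalg_cstar_gen:
  assumes "S \<subseteq> {M. bounded_mat M}" shows "cstar_subalg (cstar_gen S)"
proof -
  have b: "M \<in> cstar_gen S \<Longrightarrow> bounded_mat M" for M
    using cstar_gen_mem[OF _ cstar_subalg_bounded assms] by simp
  have c: "M \<in> cstar_gen S \<longleftrightarrow> (\<forall>B. cstar_subalg B \<longrightarrow> S \<subseteq> B \<longrightarrow> M \<in> B)" for M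
    by (auto simp: cstar_gen_def)
  show ?thesis unfolding cstar_subalg_def
  proof (intro conjI allI impI ballI)
    fix u M assume *: "(\<forall>n. u n \<in> cstar_gen S) \<and> bounded_mat M \<and> (\<lambda>n. opnorm (mminus (u n) M)) \<longlonglongrightarrow> 0"
    show "M \<in> cstar_gen S" unfolding c
    proof (intro allI impI)
      fix B assume "cstar_subalg B" "S \<subseteq> B"
      then have "\<forall>n. u n \<in> B" using * cstar_gen_mem by blast
      then show "M \<in> B" using * \<open>cstar_subalg B\<close> unfolding cstar_subalg_def by blast
    qed
  next
    show "M \<in> cstar_gen S \<Longrightarrow> bounded_mat M" for M by (rule b)
    show "mzero \<in> cstar_gen S" unfolding c by (simp add: cstar_subalgD)
    fix M N z assume "M \<in> cstar_gen S" "N \<in> cstar_gen S"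
    then have *: "\<And>B. cstar_subalg B \<Longrightarrow> S \<subseteq> B \<Longrightarrow> M \<in> B \<and> N \<in> B" unfolding c by blast
    show "madd M N \<in> cstar_gen S" "mmult M N \<in> cstar_gen S"
      unfolding c using * by (simp_all add: cstar_subalgD)
  next
    fix M z assume "M \<in> cstar_gen S"
    then have *: "\<And>B. cstar_subalg B \<Longrightarrow> S \<subseteq> B \<Longrightarrow> M \<in> B" unfolding c by blast
    show "msmult z M \<in> cstar_gen S" "madj M \<in> cstar_gen S"
      unfolding c using * by (simp_all add: cstar_subalgD)
  qed
qed

lemma cstar_subalg_closed:
  assumes "cstar_subalg B" "bounded_mat M" "\<And>e. e > 0 \<Longrightarrow> \<exists>N\<in>B. norm (opr M - opr N) \<le> e"
  shows "M \<in> B"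
proof -
  have "\<exists>N\<in>B. norm (opr M - opr N) \<le> inverse (real (Suc n))" for n
    using assms(3)[of "inverse (real (Suc n))"] by simp
  then obtain u where u: "\<And>n. u n \<in> B" "\<And>n. norm (opr M - opr (u n)) \<le> inverse (real (Suc n))" by metis
  have b: "bounded_mat (u n)" for n by (rule cstar_subalgD(1)[OF assms(1) u(1)])
  have "(\<lambda>n. opnorm (mminus (u n) M)) \<longlonglongrightarrow> 0"
  proof (rule Lim_null_comparison[OF _ LIMSEQ_inverse_real_of_nat])
    show "\<forall>\<^sub>F n in sequentially. norm (opnorm (mminus (u n) M)) \<le> inverse (real (Suc n))"
      using u(2) by (simp add: opnorm_mminus b assms(2) norm_minus_commute)
  qed
  then show ?thesis using u(1) assms(1,2) unfolding cstar_subalg_def by blast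
qed

subsection \<open>Combinatorial tools\<close>

text \<open>Rado's argument: the subfamilies satisfying Hall's condition have a minimal element, and
  submodularity of the size of the union forces its members to be singletons.\<close>

theorem hall_infinite:
  fixes E :: "'i \<Rightarrow> 'b set"
  assumes fin: "\<And>i. finite (E i)" and hall: "\<And>F. finite F \<Longrightarrow> card F \<le> card (\<Union>i\<in>F. E i)"
  shows "\<exists>f. inj f \<and> (\<forall>i. f i \<in> E i)"
proof -
  \<comment> \<open>\<open>M\<close> is a set of deleted pairs and \<open>D M\<close> the family
    left over. A minimal subfamily is therefore a maximal \<open>M\<close>, which Zorn's lemma
    provides.\<close>
  define D where "D M i = {x \<in> E i. (i, x) \<notin> M}" for M i
  define \<A> where "\<A> = {M. \<forall>F. finite F \<longrightarrow> card F \<le> card (\<Union>i\<in>F. D M i)}"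
  have finD: "finite (D M i)" for M i using fin[of i] by (simp add: D_def)
  have "\<exists>M\<in>\<A>. \<forall>X\<in>\<A>. M \<subseteq> X \<longrightarrow> X = M"
  proof (rule subset_Zorn_nonempty)
    have "{} \<in> \<A>" using hall by (simp add: \<A>_def D_def)
    then show "\<A> \<noteq> {}" by blast
  next
    fix \<C> assume C: "\<C> \<noteq> {}" "subset.chain \<A> \<C>"
    have "card F \<le> card (\<Union>i\<in>F. D (\<Union>\<C>) i)" if F: "finite F" for F
    proof -
      \<comment> \<open>Hall's condition at F sees only the finitely many pairs over F, and those
        deleted by the union of the chain are already deleted by one of its members.\<close>
      have "finite ((SIGMA i:F. E i) \<inter> \<Union>\<C>)" using F fin by blast
      then obtain B where B: "B \<in> \<C>" "(SIGMA i:F. E i) \<inter> \<Union>\<C> \<subseteq> B"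
        using finite_subset_Union_chain[of "(SIGMA i:F. E i) \<inter> \<Union>\<C>" \<C>] C by blast
      have "D (\<Union>\<C>) i = D B i" if "i \<in> F" for i using B that by (auto simp: D_def)
      moreover have "B \<in> \<A>" using B C by (auto simp: subset.chain_def)
      ultimately show ?thesis using F by (simp add: \<A>_def)
    qed
    then show "\<Union>\<C> \<in> \<A>" by (simp add: \<A>_def)
  qed
  then obtain M where M: "M \<in> \<A>" and max: "\<And>X. X \<in> \<A> \<Longrightarrow> M \<subseteq> X \<Longrightarrow> X = M" by blast
  have H: "card F \<le> card (\<Union>i\<in>F. D M i)" if "finite F" for F using M that by (simp add: \<A>_def)
  \<comment> \<open>By maximality of \<open>M\<close>, deleting one more pair breaks Hall's
    condition at some F. This F must contain i; G is the rest of it, so a strict inequality against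
    \<open>card F\<close> becomes a weak one against \<open>card G\<close>.\<close>
  have viol: "\<exists>G. finite G \<and> i \<notin> G \<and> card ((D M i - {x}) \<union> (\<Union>j\<in>G. D M j)) \<le> card G" if x: "x \<in> D M i" for i x
  proof -
    have "insert (i, x) M \<notin> \<A>" using max[of "insert (i, x) M"] x by (auto simp: D_def)
    then obtain F where F: "finite F" "card (\<Union>j\<in>F. D (insert (i, x) M) j) < card F"
      by (auto simp: \<A>_def not_le)
    have D': "D (insert (i, x) M) j = (if j = i then D M i - {x} else D M j)" for j by (auto simp: D_def)
    have "i \<in> F"
    proof (rule ccontr)
      assume "i \<notin> F"
      then have "(\<Union>j\<in>F. D (insert (i, x) M) j) = (\<Union>j\<in>F. D M j)" using D' by auto
      then show False using F H[OF F(1)] by simp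
    qed
    moreover have "(\<Union>j\<in>F. D (insert (i, x) M) j) = (D M i - {x}) \<union> (\<Union>j\<in>F - {i}. D M j)"
      using \<open>i \<in> F\<close> by (auto simp: D' split: if_splits)
    ultimately show ?thesis using F by (intro exI[of _ "F - {i}"]) (auto simp: card_Diff_singleton)
  qed
  have single: "x = y" if xy: "x \<in> D M i" "y \<in> D M i" for i x y
  proof (rule ccontr)
    assume "x \<noteq> y"
    obtain G1 where G1: "finite G1" "i \<notin> G1" "card ((D M i - {x}) \<union> (\<Union>j\<in>G1. D M j)) \<le> card G1" using viol[OF xy(1)] by blast
    obtain G2 where G2: "finite G2" "i \<notin> G2" "card ((D M i - {y}) \<union> (\<Union>j\<in>G2. D M j)) \<le> card G2" using viol[OF xy(2)] by blast
    let ?U1 = "(D M i - {x}) \<union> (\<Union>j\<in>G1. D M j)" and ?U2 = "(D M i - {y}) \<union> (\<Union>j\<in>G2. D M j)"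
    have f: "finite ?U1" "finite ?U2" using G1 G2 finD by auto
    have "?U1 \<union> ?U2 = (\<Union>j\<in>insert i (G1 \<union> G2). D M j)" using \<open>x \<noteq> y\<close> by auto
    then have "card (G1 \<union> G2) + 1 \<le> card (?U1 \<union> ?U2)" using H[of "insert i (G1 \<union> G2)"] G1 G2 by simp
    moreover have "card (G1 \<inter> G2) \<le> card (?U1 \<inter> ?U2)"
      using H[of "G1 \<inter> G2"] G1(1) card_mono[of "?U1 \<inter> ?U2" "\<Union>j\<in>G1 \<inter> G2. D M j"] f by force
    moreover have "card ?U1 + card ?U2 = card (?U1 \<union> ?U2) + card (?U1 \<inter> ?U2)" by (rule card_Un_Int[OF f])
    moreover have "card G1 + card G2 = card (G1 \<union> G2) + card (G1 \<inter> G2)" by (rule card_Un_Int) (use G1 G2 in auto)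
    ultimately show False using G1(3) G2(3) by linarith
  qed
  have ne: "\<exists>x. x \<in> D M i" for i
  proof (rule ccontr)
    assume "\<not> ?thesis"
    then have "D M i = {}" by blast
    then show False using H[of "{i}"] by simp
  qed
  then obtain f where f: "\<And>i. f i \<in> D M i" by metis
  have "inj f"
  proof (rule injI, rule ccontr)
    fix i j assume "f i = f j" "i \<noteq> j"
    have "x = f i" if "x \<in> D M i \<or> x \<in> D M j" for x
      using that single[OF _ f] \<open>f i = f j\<close> by metis
    then have "(\<Union>k\<in>{i,j}. D M k) \<subseteq> {f i}" by blast
    then have "card (\<Union>k\<in>{i,j}. D M k) \<le> card {f i}" by (intro card_mono) simp
    then have "card (\<Union>k\<in>{i,j}. D M k) \<le> 1" by simp
    then show False using H[of "{i,j}"] \<open>i \<noteq> j\<close> by simp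
  qed
  then show ?thesis using f by (auto simp: D_def)
qed

text \<open>Cantor-Bernstein: g is \<alpha> on the fixed point S and the inverse of \<beta>
  elsewhere. The explicit form matters, since every pair (i, g i) then comes from one of the two
  injections and inherits P.\<close>

lemma bij_of_two_injections:
  fixes \<alpha> :: "'i \<Rightarrow> 'b" and \<beta> :: "'b \<Rightarrow> 'i"
  assumes "inj \<alpha>" "inj \<beta>" "\<And>i. P i (\<alpha> i)" "\<And>y. P (\<beta> y) y"
  shows "\<exists>g. bij g \<and> (\<forall>i. P i (g i))"
proof -
  define S where "S = lfp (\<lambda>S. - \<beta> ` (- \<alpha> ` S))"
  have S: "S = - \<beta> ` (- \<alpha> ` S)" unfolding S_def by (rule lfp_unfold) (auto simp: mono_def)
  define g where "g i = (if i \<in> S then \<alpha> i else inv \<beta> i)" for i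
  have o: "\<exists>y. i = \<beta> y \<and> y \<notin> \<alpha> ` S" if "i \<notin> S" for i using S that by blast
  have inv: "inv \<beta> (\<beta> y) = y" for y using assms(2) by simp
  have "inj g"
  proof (rule injI)
    fix i j assume e: "g i = g j"
    show "i = j"
    proof (cases "i \<in> S"; cases "j \<in> S")
      assume "i \<notin> S" "j \<notin> S"
      then show ?thesis using e o[of i] o[of j] by (auto simp: g_def inv)
    next
      assume "i \<in> S" "j \<in> S"
      then show ?thesis using e assms(1) by (auto simp: g_def inj_def)
    next
      assume "i \<in> S" "j \<notin> S"
      then show ?thesis using e o[of j] by (auto simp: g_def inv)
    next
      assume "i \<notin> S" "j \<in> S"
      then show ?thesis using e o[of i] by (auto simp: g_def inv)
    qed
  qed
  moreover have "\<exists>i. g i = y" for y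
  proof (cases "y \<in> \<alpha> ` S")
    case True then show ?thesis by (auto simp: g_def)
  next
    case False
    then have "\<beta> y \<notin> S" using S by blast
    then show ?thesis by (intro exI[of _ "\<beta> y"]) (simp add: g_def inv)
  qed
  moreover have "P i (g i)" for i
  proof (cases "i \<in> S")
    case False
    then obtain y where "i = \<beta> y" using o by blast
    then show ?thesis using False assms(4) by (simp add: g_def inv)
  qed (simp add: g_def assms(3))
  ultimately show ?thesis by (intro exI[of _ g]) (auto simp: bij_def surj_def, metis)
qed

text \<open>The Baire category theorem for the Cantor space of all subsets of a set: the second
  hypothesis says that each \<^term>\<open>Z k\<close> is closed, the conclusion that some \<^term>\<open>Z k\<close> contains
  a basic open set.\<close>

lemma baire_cylinder:
  fixes Z :: "nat \<Rightarrow> 'i set \<Rightarrow> bool"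
  assumes cover: "\<And>J. \<exists>k. Z k J"
    and closed: "\<And>k J. \<not> Z k J \<Longrightarrow> \<exists>P. finite P \<and> (\<forall>J'. J' \<inter> P = J \<inter> P \<longrightarrow> \<not> Z k J')"
  shows "\<exists>k P J0. finite P \<and> (\<forall>J. J \<inter> P = J0 \<inter> P \<longrightarrow> Z k J)"
proof (rule ccontr)
  assume "\<not> ?thesis"
  note nt = this
  have neg: "\<exists>J. J \<inter> P = J0 \<inter> P \<and> \<not> Z k J" if "finite P" for k P J0
  proof (rule ccontr)
    assume "\<not> ?thesis"
    then have "\<forall>J. J \<inter> P = J0 \<inter> P \<longrightarrow> Z k J" by simp
    then show False using nt that by metis
  qed
  \<comment> \<open>A pair encodes the cylinder of all sets that agree with its first component on
    its finite second component. Each step shrinks the cylinder until it avoids one more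
    \<open>Z k\<close>.\<close>
  have step: "\<exists>Q. finite (snd Q) \<and> snd R \<subseteq> snd Q \<and> fst Q \<inter> snd R = fst R \<inter> snd R \<and>
      (\<forall>J. J \<inter> snd Q = fst Q \<inter> snd Q \<longrightarrow> \<not> Z k J)" if finR: "finite (snd R)" for k and R :: "'i set \<times> 'i set"
  proof -
    obtain J where J: "J \<inter> snd R = fst R \<inter> snd R" "\<not> Z k J" using neg[OF finR, of "fst R" k] by blast
    obtain P where P: "finite P" "\<forall>J'. J' \<inter> P = J \<inter> P \<longrightarrow> \<not> Z k J'" using closed[OF J(2)] by blast
    have "J' \<inter> (P \<union> snd R) = J \<inter> (P \<union> snd R) \<Longrightarrow> J' \<inter> P = J \<inter> P" for J' by blast
    then have "\<forall>J'. J' \<inter> (P \<union> snd R) = J \<inter> (P \<union> snd R) \<longrightarrow> \<not> Z k J'" using P(2) by metis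
    then show ?thesis using J(1) P(1) finR by (intro exI[of _ "(J, P \<union> snd R)"]) simp
  qed
  define S where "S k R Q \<longleftrightarrow> snd R \<subseteq> snd Q \<and> fst Q \<inter> snd R = fst R \<inter> snd R \<and>
      (\<forall>J. J \<inter> snd Q = fst Q \<inter> snd Q \<longrightarrow> \<not> Z k J)" for k and R Q :: "'i set \<times> 'i set"
  have "\<exists>R. \<forall>k. finite (snd (R k)) \<and> S k (R k) (R (Suc k))"
  proof (rule dependent_nat_choice)
    show "\<exists>R :: 'i set \<times> 'i set. finite (snd R)" by (intro exI[of _ "({}, {})"]) simp
    show "\<exists>Q. finite (snd Q) \<and> S k R Q" if "finite (snd R)" for R k
      using step[OF that, of k] unfolding S_def .
  qed
  then obtain R :: "nat \<Rightarrow> 'i set \<times> 'i set" where R: "\<And>k. snd (R k) \<subseteq> snd (R (Suc k))"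
    "\<And>k. fst (R (Suc k)) \<inter> snd (R k) = fst (R k) \<inter> snd (R k)"
    "\<And>k J. J \<inter> snd (R (Suc k)) = fst (R (Suc k)) \<inter> snd (R (Suc k)) \<Longrightarrow> \<not> Z k J" unfolding S_def by metis
  have mono: "snd (R k) \<subseteq> snd (R l)" if "k \<le> l" for k l by (rule lift_Suc_mono_le[of "\<lambda>k. snd (R k)", OF R(1) that])
  have agree: "fst (R l) \<inter> snd (R k) = fst (R k) \<inter> snd (R k)" if "k \<le> l" for k l
    using that
  proof (induction l rule: dec_induct)
    case (step l)
    have "fst (R (Suc l)) \<inter> snd (R k) = (fst (R (Suc l)) \<inter> snd (R l)) \<inter> snd (R k)" using mono[OF step(1)] by blast
    also have "\<dots> = fst (R l) \<inter> snd (R k)" using R(2)[of l] mono[OF step(1)] by blast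
    finally show ?case using step by simp
  qed simp
  \<comment> \<open>This J lies in all the nested cylinders, because stage k fixes membership on
    \<open>snd (R k)\<close> for good.\<close>
  define J where "J = (\<Union>k. fst (R k) \<inter> snd (R k))"
  have "J \<inter> snd (R k) = fst (R k) \<inter> snd (R k)" for k
  proof (intro equalityI subsetI)
    fix x assume x: "x \<in> J \<inter> snd (R k)"
    then obtain l where l: "x \<in> fst (R l)" "x \<in> snd (R l)" by (auto simp: J_def)
    show "x \<in> fst (R k) \<inter> snd (R k)"
      using x l agree[of k l] agree[of l k] by (cases "k \<le> l") auto
  qed (auto simp: J_def)
  then have "\<not> Z k J" for k using R(3) by blast
  then show False using cover by blast
qed

lemma sum_Pow_insert:
  assumes "finite Q" "x \<notin> Q"
  shows "(\<Sum>D\<in>Pow (insert x Q). f D) = (\<Sum>D\<in>Pow Q. f D + f (insert x D))"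
proof -
  have i: "inj_on (insert x) (Pow Q)" using assms(2) by (intro inj_onI) (metis Diff_insert_absorb PowD subsetD)
  have "(\<Sum>D\<in>Pow (insert x Q). f D) = (\<Sum>D\<in>Pow Q. f D) + (\<Sum>D\<in>insert x ` Pow Q. f D)"
    unfolding Pow_insert using assms by (intro sum.union_disjoint) auto
  then show ?thesis by (simp add: sum.reindex[OF i] sum.distrib)
qed

text \<open>Each off-diagonal entry survives in exactly a quarter of the blocks \<^term>\<open>J \<times> (P - J)\<close>, so the
  off-diagonal part is four times the average of these blocks.\<close>

lemma offdiag_average:
  fixes b :: "'i \<Rightarrow> 'i \<Rightarrow> complex"
  assumes P: "finite P" and le: "\<And>J. J \<subseteq> P \<Longrightarrow> cmod (\<Sum>n\<in>J. \<Sum>m\<in>P-J. b n m) \<le> e"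
  shows "cmod (\<Sum>n\<in>P. \<Sum>m\<in>P-{n}. b n m) \<le> 4 * e"
proof -
  \<comment> \<open>With membership outside {n, m} fixed, exactly one of the four choices on {n, m}
    takes n and omits m.\<close>
  have count: "4 * (\<Sum>J\<in>Pow P. if n \<in> J \<and> m \<notin> J then 1 else 0 :: complex) = 2 ^ card P"
    if nm: "n \<in> P" "m \<in> P" "n \<noteq> m" for n m
  proof -
    define Q where "Q = P - {n, m}"
    have Q: "P = insert n (insert m Q)" "finite Q" "m \<notin> Q" "n \<notin> insert m Q" using nm P by (auto simp: Q_def)
    have "(\<Sum>J\<in>Pow P. if n \<in> J \<and> m \<notin> J then 1 else 0 :: complex) = (\<Sum>J\<in>Pow Q. 1)"
      unfolding Q(1) sum_Pow_insert[OF finite.insertI[OF Q(2)] Q(4)] sum_Pow_insert[OF Q(2,3)]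
    proof (rule sum.cong[OF refl])
      fix J assume "J \<in> Pow Q"
      then have "n \<notin> J" "m \<notin> J" using Q by auto
      then show "(if n \<in> J \<and> m \<notin> J then 1 else 0) + (if n \<in> insert n J \<and> m \<notin> insert n J then 1 else 0)
        + ((if n \<in> insert m J \<and> m \<notin> insert m J then 1 else 0)
        + (if n \<in> insert n (insert m J) \<and> m \<notin> insert n (insert m J) then 1 else 0)) = (1::complex)"
        using nm by simp
    qed
    moreover have "card P = Suc (Suc (card Q))" unfolding Q(1) using Q by simp
    ultimately show ?thesis using Q by (simp add: card_Pow)
  qed
  have "(\<Sum>J\<in>Pow P. \<Sum>n\<in>J. \<Sum>m\<in>P-J. b n m) = (\<Sum>J\<in>Pow P. \<Sum>n\<in>P. \<Sum>m\<in>P. if n \<in> J \<and> m \<notin> J then b n m else 0)"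
  proof (rule sum.cong[OF refl])
    fix J assume J: "J \<in> Pow P"
    have "(\<Sum>n\<in>J. \<Sum>m\<in>P-J. b n m) = (\<Sum>n\<in>J. \<Sum>m\<in>P. if m \<notin> J then b n m else 0)"
      using P J by (intro sum.cong refl sum.mono_neutral_cong_left) auto
    also have "\<dots> = (\<Sum>n\<in>P. \<Sum>m\<in>P. if n \<in> J \<and> m \<notin> J then b n m else 0)"
      using P J by (intro sum.mono_neutral_cong_left) auto
    finally show "(\<Sum>n\<in>J. \<Sum>m\<in>P-J. b n m) = (\<Sum>n\<in>P. \<Sum>m\<in>P. if n \<in> J \<and> m \<notin> J then b n m else 0)" .
  qed
  also have "\<dots> = (\<Sum>n\<in>P. \<Sum>m\<in>P. \<Sum>J\<in>Pow P. if n \<in> J \<and> m \<notin> J then b n m else 0)"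
    by (subst sum.swap, rule sum.cong[OF refl], rule sum.swap)
  also have "\<dots> = (\<Sum>n\<in>P. \<Sum>m\<in>P. b n m * (\<Sum>J\<in>Pow P. if n \<in> J \<and> m \<notin> J then 1 else 0))"
    by (auto simp: sum_distrib_left intro!: sum.cong)
  also have "\<dots> = (\<Sum>n\<in>P. \<Sum>m\<in>P-{n}. b n m * (\<Sum>J\<in>Pow P. if n \<in> J \<and> m \<notin> J then 1 else 0))"
    using P by (intro sum.cong refl sum.mono_neutral_right) auto
  finally have "4 * (\<Sum>J\<in>Pow P. \<Sum>n\<in>J. \<Sum>m\<in>P-J. b n m) = (\<Sum>n\<in>P. \<Sum>m\<in>P-{n}. b n m * (4 * (\<Sum>J\<in>Pow P. if n \<in> J \<and> m \<notin> J then 1 else 0)))"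
    by (simp add: sum_distrib_left mult_ac)
  also have "\<dots> = (\<Sum>n\<in>P. \<Sum>m\<in>P-{n}. b n m * 2 ^ card P)"
  proof (intro sum.cong refl)
    fix n m assume "n \<in> P" "m \<in> P - {n}"
    then have "4 * (\<Sum>J\<in>Pow P. if n \<in> J \<and> m \<notin> J then 1 else 0 :: complex) = 2 ^ card P" by (intro count) auto
    then show "b n m * (4 * (\<Sum>J\<in>Pow P. if n \<in> J \<and> m \<notin> J then 1 else 0)) = b n m * 2 ^ card P" by (simp only:)
  qed
  also have "\<dots> = 2 ^ card P * (\<Sum>n\<in>P. \<Sum>m\<in>P-{n}. b n m)"
    by (simp add: sum_distrib_left mult.commute)
  finally have "cmod (4 * (\<Sum>J\<in>Pow P. \<Sum>n\<in>J. \<Sum>m\<in>P-J. b n m)) = cmod (2 ^ card P * (\<Sum>n\<in>P. \<Sum>m\<in>P-{n}. b n m))"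
    by (simp only:)
  then have "2 ^ card P * cmod (\<Sum>n\<in>P. \<Sum>m\<in>P-{n}. b n m) = 4 * cmod (\<Sum>J\<in>Pow P. \<Sum>n\<in>J. \<Sum>m\<in>P-J. b n m)"
    by (simp only: norm_mult norm_power norm_numeral)
  also have "cmod (\<Sum>J\<in>Pow P. \<Sum>n\<in>J. \<Sum>m\<in>P-J. b n m) \<le> (\<Sum>J\<in>Pow P. e)"
    by (rule sum_norm_le) (use le in auto)
  also have "(\<Sum>J\<in>Pow P. e) = 2 ^ card P * e" using P by (simp add: card_Pow)
  finally show ?thesis by simp
qed

text \<open>Signs are indexed by the set where they are positive, so that expectations become sums
  over \<open>Pow\<close> and \<open>baire_cylinder\<close> applies to sign patterns.\<close>

definition rsign :: "'a set \<Rightarrow> 'a \<Rightarrow> real" where "rsign D x = (if x \<in> D then 1 else -1)"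

lemma rsign_sum_insert:
  assumes "finite Q" "x \<notin> Q" "D \<subseteq> Q"
  shows "(\<Sum>y\<in>insert x Q. rsign D y * a y) = (\<Sum>y\<in>Q. rsign D y * a y) - a x"
    "(\<Sum>y\<in>insert x Q. rsign (insert x D) y * a y) = (\<Sum>y\<in>Q. rsign D y * a y) + a x"
proof -
  have "x \<notin> D" using assms by auto
  then show "(\<Sum>y\<in>insert x Q. rsign D y * a y) = (\<Sum>y\<in>Q. rsign D y * a y) - a x" using assms by (simp add: rsign_def)
  have "(\<Sum>y\<in>Q. rsign (insert x D) y * a y) = (\<Sum>y\<in>Q. rsign D y * a y)"
    using assms by (intro sum.cong) (auto simp: rsign_def)
  then show "(\<Sum>y\<in>insert x Q. rsign (insert x D) y * a y) = (\<Sum>y\<in>Q. rsign D y * a y) + a x" using assms by (simp add: rsign_def)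
qed

text \<open>Averaging over the sign of the new element removes odd powers. The induction step for
  the fourth moment uses the second moment, hence the conjunction; completing the square with
  constant 3 leaves a nonnegative fourth power to spare.\<close>

lemma rademacher_moments:
  fixes a :: "'a \<Rightarrow> real"
  assumes "finite Q"
  shows "(\<Sum>D\<in>Pow Q. (\<Sum>x\<in>Q. rsign D x * a x)^2) = 2 ^ card Q * (\<Sum>x\<in>Q. (a x)^2) \<and>
    (\<Sum>D\<in>Pow Q. (\<Sum>x\<in>Q. rsign D x * a x)^4) \<le> 3 * 2 ^ card Q * (\<Sum>x\<in>Q. (a x)^2)^2"
  using assms
proof (induction Q rule: finite_induct)
  case (insert x Q)
  let ?Y = "\<lambda>D. \<Sum>x\<in>Q. rsign D x * a x" and ?s = "\<Sum>x\<in>Q. (a x)^2"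
  have e2: "(u - v)^2 + (u + v)^2 = 2 * u^2 + 2 * v^2" for u v :: real by (simp add: power2_eq_square algebra_simps)
  have e4: "(u - v)^4 + (u + v)^4 = 2 * u^4 + 12 * v^2 * u^2 + 2 * v^4" for u v :: real
    by (simp add: power4_eq_xxxx power2_eq_square algebra_simps)
  have "(\<Sum>D\<in>Pow (insert x Q). (\<Sum>x\<in>insert x Q. rsign D x * a x)^2) = (\<Sum>D\<in>Pow Q. (?Y D - a x)^2 + (?Y D + a x)^2)"
    unfolding sum_Pow_insert[OF insert(1,2)]
    by (rule sum.cong[OF refl]) (simp only: rsign_sum_insert[OF insert(1,2)] Pow_iff)
  also have "\<dots> = (\<Sum>D\<in>Pow Q. 2 * (?Y D)^2 + 2 * (a x)^2)" by (simp only: e2)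
  also have "\<dots> = 2 * (\<Sum>D\<in>Pow Q. (?Y D)^2) + 2 ^ card Q * (2 * (a x)^2)"
    using insert(1) by (simp add: sum.distrib sum_distrib_left card_Pow)
  also have "\<dots> = 2 ^ card (insert x Q) * (\<Sum>x\<in>insert x Q. (a x)^2)"
    using insert by (simp add: algebra_simps)
  finally have A: "(\<Sum>D\<in>Pow (insert x Q). (\<Sum>x\<in>insert x Q. rsign D x * a x)^2) = 2 ^ card (insert x Q) * (\<Sum>x\<in>insert x Q. (a x)^2)" .
  have "(\<Sum>D\<in>Pow (insert x Q). (\<Sum>x\<in>insert x Q. rsign D x * a x)^4) = (\<Sum>D\<in>Pow Q. (?Y D - a x)^4 + (?Y D + a x)^4)"
    unfolding sum_Pow_insert[OF insert(1,2)]
    by (rule sum.cong[OF refl]) (simp only: rsign_sum_insert[OF insert(1,2)] Pow_iff)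
  also have "\<dots> = (\<Sum>D\<in>Pow Q. 2 * (?Y D)^4 + 12 * (a x)^2 * (?Y D)^2 + 2 * (a x)^4)" by (simp only: e4)
  also have "\<dots> = 2 * (\<Sum>D\<in>Pow Q. (?Y D)^4) + 12 * (a x)^2 * (\<Sum>D\<in>Pow Q. (?Y D)^2) + 2 ^ card Q * (2 * (a x)^4)"
    using insert(1) by (simp add: sum.distrib sum_distrib_left card_Pow)
  also have "\<dots> \<le> 2 * (3 * 2 ^ card Q * ?s^2) + 12 * (a x)^2 * (2 ^ card Q * ?s) + 2 ^ card Q * (2 * (a x)^4)"
    using insert by simp
  also have "\<dots> = 2 ^ card Q * (6 * ?s^2 + 12 * (a x)^2 * ?s + 2 * (a x)^4)" by (simp add: algebra_simps)
  also have "\<dots> \<le> 2 ^ card Q * (6 * (?s + (a x)^2)^2)"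
  proof (rule mult_left_mono)
    have "6 * (?s + (a x)^2)^2 - (6 * ?s^2 + 12 * (a x)^2 * ?s + 2 * (a x)^4) = 4 * (a x)^4"
      by (simp add: power2_eq_square power4_eq_xxxx algebra_simps)
    moreover have "0 \<le> (a x)^4" by simp
    ultimately show "6 * ?s^2 + 12 * (a x)^2 * ?s + 2 * (a x)^4 \<le> 6 * (?s + (a x)^2)^2" by linarith
  qed simp
  also have "\<dots> = 3 * 2 ^ card (insert x Q) * (\<Sum>x\<in>insert x Q. (a x)^2)^2"
    using insert(1,2) by (simp add: algebra_simps)
  finally show ?case using A by simp
qed simp

text \<open>The real case is applied to real and imaginary parts. The constant 6 is 2 * 3, the
  factor 2 coming from (R^2 + I^2)^2 \<le> 2 R^4 + 2 I^4.\<close>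

lemma rademacher_complex:
  fixes a :: "'a \<Rightarrow> complex"
  assumes Q: "finite Q"
  shows "(\<Sum>D\<in>Pow Q. (cmod (\<Sum>x\<in>Q. rsign D x * a x))^2) = 2 ^ card Q * (\<Sum>x\<in>Q. (cmod (a x))^2)"
    and "(\<Sum>D\<in>Pow Q. (cmod (\<Sum>x\<in>Q. rsign D x * a x))^4) \<le> 6 * 2 ^ card Q * (\<Sum>x\<in>Q. (cmod (a x))^2)^2"
proof -
  let ?R = "\<lambda>D. \<Sum>x\<in>Q. rsign D x * Re (a x)" and ?I = "\<lambda>D. \<Sum>x\<in>Q. rsign D x * Im (a x)"
  let ?r = "\<Sum>x\<in>Q. (Re (a x))^2" and ?i = "\<Sum>x\<in>Q. (Im (a x))^2"
  have n: "(cmod (\<Sum>x\<in>Q. rsign D x * a x))^2 = (?R D)^2 + (?I D)^2" for D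
    by (simp add: cmod_power2)
  have s: "(\<Sum>x\<in>Q. (cmod (a x))^2) = ?r + ?i" by (simp add: cmod_power2 sum.distrib)
  show "(\<Sum>D\<in>Pow Q. (cmod (\<Sum>x\<in>Q. rsign D x * a x))^2) = 2 ^ card Q * (\<Sum>x\<in>Q. (cmod (a x))^2)"
    unfolding n s sum.distrib using rademacher_moments[OF Q] by (simp add: algebra_simps)
  have "(cmod (\<Sum>x\<in>Q. rsign D x * a x))^4 \<le> 2 * (?R D)^4 + 2 * (?I D)^4" for D
  proof -
    have "(cmod (\<Sum>x\<in>Q. rsign D x * a x))^4 = ((?R D)^2 + (?I D)^2)^2"
      unfolding n[symmetric] by (simp flip: power_mult)
    also have "\<dots> = 2 * (?R D)^4 + 2 * (?I D)^4 - ((?R D)^2 - (?I D)^2)^2"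
      by (simp add: power2_eq_square power4_eq_xxxx algebra_simps)
    finally show ?thesis using zero_le_power2[of "(?R D)^2 - (?I D)^2"] by linarith
  qed
  then have "(\<Sum>D\<in>Pow Q. (cmod (\<Sum>x\<in>Q. rsign D x * a x))^4) \<le> (\<Sum>D\<in>Pow Q. 2 * (?R D)^4 + 2 * (?I D)^4)"
    by (rule sum_mono)
  also have "\<dots> = 2 * (\<Sum>D\<in>Pow Q. (?R D)^4) + 2 * (\<Sum>D\<in>Pow Q. (?I D)^4)" by (simp add: sum.distrib sum_distrib_left)
  also have "\<dots> \<le> 2 * (3 * 2 ^ card Q * ?r^2) + 2 * (3 * 2 ^ card Q * ?i^2)"
    using rademacher_moments[OF Q] by (intro add_mono mult_left_mono) auto
  also have "\<dots> \<le> 6 * 2 ^ card Q * (?r + ?i)^2"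
  proof -
    have "0 \<le> ?r * ?i" by (intro mult_nonneg_nonneg sum_nonneg) auto
    then have "?r^2 + ?i^2 \<le> (?r + ?i)^2" unfolding power2_sum by linarith
    then have "6 * 2 ^ card Q * (?r^2 + ?i^2) \<le> 6 * 2 ^ card Q * (?r + ?i)^2" by (intro mult_left_mono) auto
    then show ?thesis by (simp add: algebra_simps)
  qed
  finally show "(\<Sum>D\<in>Pow Q. (cmod (\<Sum>x\<in>Q. rsign D x * a x))^4) \<le> 6 * 2 ^ card Q * (\<Sum>x\<in>Q. (cmod (a x))^2)^2"
    unfolding s .
qed

text \<open>Vertex n has at most K earlier neighbours, so one of the K + 1 colours 0, ..., K is
  still free when n is reached.\<close>

lemma greedy_colouring:
  fixes E :: "nat \<Rightarrow> nat \<Rightarrow> bool"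
  assumes "\<And>n. card {m. m < n \<and> E m n} \<le> K"
  shows "\<exists>c. (\<forall>n. c n \<le> K) \<and> (\<forall>n. \<forall>m<n. E m n \<longrightarrow> c m \<noteq> (c n :: nat))"
proof -
  have "\<exists>c. \<forall>n. c n \<le> K \<and> (\<forall>m<n. E m n \<longrightarrow> c m \<noteq> c n)"
  proof (rule dependent_wellorder_choice[where P="\<lambda>c n r. r \<le> K \<and> (\<forall>m<n. E m n \<longrightarrow> c m \<noteq> r)"])
    fix n and c :: "nat \<Rightarrow> nat"
    have "card (c ` {m. m < n \<and> E m n}) \<le> K" using assms[of n] card_image_le[of "{m. m < n \<and> E m n}" c] by fastforce
    then have "\<not> {..K} \<subseteq> c ` {m. m < n \<and> E m n}"
      using card_mono[of "c ` {m. m < n \<and> E m n}" "{..K}"] by auto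
    then show "\<exists>r. r \<le> K \<and> (\<forall>m<n. E m n \<longrightarrow> c m \<noteq> r)" by auto
  qed auto
  then show ?thesis by blast
qed

text \<open>Gaussian elimination: more unknowns than equations leave a nonzero solution. This is the
  form in which ranks are compared in both halves of Hall's condition.\<close>

lemma homogeneous_system:
  fixes a :: "'i \<Rightarrow> 'y \<Rightarrow> complex"
  assumes "finite Y" "finite F" "card Y < card F"
  shows "\<exists>c. (\<exists>n\<in>F. c n \<noteq> 0) \<and> (\<forall>y\<in>Y. (\<Sum>n\<in>F. c n * a n y) = 0)"
  using assms
proof (induction Y arbitrary: F a rule: finite_induct)
  case empty
  then obtain n where "n \<in> F" by fastforce
  then show ?case by (intro exI[of _ "\<lambda>_. 1"]) auto
next
  case (insert y Y)
  show ?case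
  proof (cases "\<forall>n\<in>F. a n y = 0")
    case True
    have "card Y < card F" using insert by simp
    from insert(3)[OF insert(4) this, of a] True show ?thesis by auto
  next
    case False
    then obtain p where p: "p \<in> F" "a p y \<noteq> 0" by blast
    define G where "G = F - {p}"
    have G: "F = insert p G" "p \<notin> G" "finite G" using p insert by (auto simp: G_def)
    have "card Y < card G" using insert G by simp
    from insert(3)[OF G(3) this, of "\<lambda>n z. a n z - a n y / a p y * a p z"]
    obtain c where c: "\<exists>n\<in>G. c n \<noteq> 0" "\<forall>z\<in>Y. (\<Sum>n\<in>G. c n * (a n z - a n y / a p y * a p z)) = 0" by blast
    \<comment> \<open>The pivot unknown is recovered from equation y; the reduced coefficients above
      are chosen so that the remaining equations then hold too.\<close>
    define d where "d = (\<lambda>n. if n = p then - (\<Sum>n\<in>G. c n * a n y) / a p y else c n)"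
    have sG: "(\<Sum>n\<in>G. d n * a n z) = (\<Sum>n\<in>G. c n * a n z)" for z using G by (intro sum.cong) (auto simp: d_def)
    have e: "(\<Sum>n\<in>F. d n * a n z) = (\<Sum>n\<in>G. c n * a n z) - (\<Sum>n\<in>G. c n * a n y) / a p y * a p z" for z
      unfolding G(1) using G by (simp add: sG) (simp add: d_def)
    have "(\<Sum>n\<in>F. d n * a n z) = 0" if "z \<in> insert y Y" for z
    proof (cases "z = y")
      case True then show ?thesis using p by (simp add: e)
    next
      case False
      then have "(\<Sum>n\<in>G. c n * (a n z - a n y / a p y * a p z)) = 0" using that c by blast
      moreover have "(\<Sum>n\<in>G. c n * (a n z - a n y / a p y * a p z)) = (\<Sum>n\<in>G. c n * a n z) - (\<Sum>n\<in>G. c n * a n y / a p y * a p z)"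
        by (simp add: right_diff_distrib sum_subtractf mult.assoc)
      ultimately show ?thesis unfolding e by (simp only: sum_distrib_right sum_divide_distrib)
    qed
    moreover have "\<exists>n\<in>F. d n \<noteq> 0" using c(1) G by (auto simp: d_def)
    ultimately show ?thesis by blast
  qed
qed

subsection \<open>Matrices in the uniform Roe algebra\<close>

text \<open>Linear coordinate functionals define an operator as soon as their finite sums of squares
  are bounded. Schur-bounded matrices, rank one operators and the final unitary are all built in
  this way.\<close>

lemma clin_operator_exists:
  fixes F :: "'a ell2 \<Rightarrow> 'b \<Rightarrow> complex"
  assumes add: "\<And>u v x. F (u + v) x = F u x + F v x" and scale: "\<And>c u x. F (c *\<^sub>c u) x = c * F u x"
    and bd: "\<And>u G. finite G \<Longrightarrow> (\<Sum>x\<in>G. (cmod (F u x))^2) \<le> (K * norm u)^2" and K: "0 \<le> K"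
  shows "\<exists>T. clin T \<and> norm T \<le> K \<and> (\<forall>u x. cf (blinfun_apply T u) x = F u x)"
proof -
  have l: "F u \<in> l2" "l2norm (F u) \<le> K * norm u" for u
    by (rule l2I[OF bd]; simp add: K)+
  have e: "cf (Abs_ell2 (F u)) = F u" for u using l by (simp add: Abs_ell2_inverse)
  have "bounded_linear (\<lambda>u. Abs_ell2 (F u))"
  proof (rule bounded_linear_intro[where K=K])
    fix u v r
    show "Abs_ell2 (F (u + v)) = Abs_ell2 (F u) + Abs_ell2 (F v)"
      by (rule ell2_eqI) (simp only: e cf_simps add)
    show "Abs_ell2 (F (r *\<^sub>R u)) = r *\<^sub>R Abs_ell2 (F u)"
      by (rule ell2_eqI) (simp only: e cf_simps scaleR_cs scale)
    show "norm (Abs_ell2 (F u)) \<le> norm u * K"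
      using l(2)[of u] by (simp add: norm_ell2_def e mult.commute)
  qed
  then have T: "cf (Blinfun (\<lambda>u. Abs_ell2 (F u)) u) = F u" for u
    by (simp add: bounded_linear_Blinfun_apply e)
  have "norm (Blinfun (\<lambda>u. Abs_ell2 (F u))) \<le> K"
    by (rule norm_blinfun_bound[OF K]) (use l in \<open>simp add: norm_ell2_def T\<close>)
  moreover have "clin (Blinfun (\<lambda>u. Abs_ell2 (F u)))"
    unfolding clin_def by (intro allI ell2_eqI) (simp only: T cf_simps scale)
  ultimately show ?thesis using T by metis
qed

text \<open>A crude Schur test. Cauchy-Schwarz in a row costs one factor N, and each squared
  coordinate is then counted once per row meeting its column, at most N times; the square root of
  the total is c * N. \<open>R x\<close> contains the support of row x.\<close>

lemma schur_bound:
  fixes M :: "'a mat" and N :: nat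
  assumes row: "\<And>x. finite (R x) \<and> card (R x) \<le> N" and col: "\<And>y. finite {x. y \<in> R x} \<and> card {x. y \<in> R x} \<le> N"
    and supp: "\<And>x y. y \<notin> R x \<Longrightarrow> M x y = 0" and le: "\<And>x y. cmod (M x y) \<le> c" and c: "0 \<le> c"
  shows "bounded_mat M" "norm (opr M) \<le> c * N" "cf (opr M u) x = (\<Sum>y\<in>R x. M x y * cf u y)"
proof -
  let ?F = "\<lambda>u x. \<Sum>y\<in>R x. M x y * cf u y"
  have "\<exists>T. clin T \<and> norm T \<le> c * N \<and> (\<forall>u x. cf (blinfun_apply T u) x = ?F u x)"
  proof (rule clin_operator_exists)
    fix u :: "'a ell2" and G :: "'a set" assume G: "finite G"
    have "(cmod (?F u x))^2 \<le> (c^2 * N) * (\<Sum>y\<in>R x. (cmod (cf u y))^2)" for x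
    proof -
      have "cmod (?F u x) \<le> (\<Sum>y\<in>R x. c * cmod (cf u y))"
        by (rule sum_norm_le) (simp add: norm_mult le mult_right_mono)
      then have "(cmod (?F u x))^2 \<le> (\<Sum>y\<in>R x. c * cmod (cf u y))^2" by (intro power_mono) auto
      also have "\<dots> = c^2 * (\<Sum>y\<in>R x. cmod (cf u y))^2" by (simp add: sum_distrib_left[symmetric] power_mult_distrib)
      also have "\<dots> \<le> c^2 * ((\<Sum>y\<in>R x. (cmod (cf u y))^2) * card (R x))"
        using row by (intro mult_left_mono sum_squared_le_sum_of_squares) auto
      also have "\<dots> \<le> c^2 * ((\<Sum>y\<in>R x. (cmod (cf u y))^2) * N)"
        using row by (intro mult_left_mono) (auto intro: sum_nonneg)
      finally show ?thesis by (simp add: mult_ac)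
    qed
    then have "(\<Sum>x\<in>G. (cmod (?F u x))^2) \<le> (\<Sum>x\<in>G. (c^2 * N) * (\<Sum>y\<in>R x. (cmod (cf u y))^2))" by (rule sum_mono)
    also have "\<dots> = (c^2 * N) * (\<Sum>x\<in>G. \<Sum>y\<in>R x. (cmod (cf u y))^2)" by (simp add: sum_distrib_left)
    also have "(\<Sum>x\<in>G. \<Sum>y\<in>R x. (cmod (cf u y))^2) = (\<Sum>y\<in>(\<Union>x\<in>G. R x). \<Sum>x\<in>{x\<in>G. y \<in> R x}. (cmod (cf u y))^2)"
    proof -
      have "(\<Sum>x\<in>G. \<Sum>y\<in>R x. (cmod (cf u y))^2) = (\<Sum>x\<in>G. \<Sum>y\<in>{y\<in>(\<Union>x\<in>G. R x). y \<in> R x}. (cmod (cf u y))^2)"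
        by (intro sum.cong) auto
      also have "\<dots> = (\<Sum>y\<in>(\<Union>x\<in>G. R x). \<Sum>x\<in>{x\<in>G. y \<in> R x}. (cmod (cf u y))^2)"
        by (rule sum.swap_restrict) (use G row in auto)
      finally show ?thesis .
    qed
    also have "\<dots> \<le> (\<Sum>y\<in>(\<Union>x\<in>G. R x). N * (cmod (cf u y))^2)"
    proof (rule sum_mono)
      fix y
      have "card {x\<in>G. y \<in> R x} \<le> card {x. y \<in> R x}" by (rule card_mono) (use col[of y] in auto)
      then have "card {x\<in>G. y \<in> R x} \<le> N" using col[of y] by simp
      then have "real (card {x\<in>G. y \<in> R x}) \<le> real N" by simp
      then show "(\<Sum>x\<in>{x\<in>G. y \<in> R x}. (cmod (cf u y))^2) \<le> N * (cmod (cf u y))^2" by (simp add: mult_right_mono)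
    qed
    also have "\<dots> \<le> N * (norm u)^2"
      unfolding sum_distrib_left[symmetric] using G row by (intro mult_left_mono ell2_sum_le) auto
    finally have "(\<Sum>x\<in>G. (cmod (?F u x))^2) \<le> c^2 * N * (N * (norm u)^2)" by (simp add: mult_left_mono)
    then show "(\<Sum>x\<in>G. (cmod (?F u x))^2) \<le> (c * N * norm u)^2" by (simp add: power_mult_distrib power2_eq_square mult_ac)
  qed (auto simp: distrib_left sum.distrib sum_distrib_left c mult_ac)
  then obtain T where T: "clin T" "norm T \<le> c * N" "\<And>u x. cf (blinfun_apply T u) x = ?F u x" by blast
  have "mat_of T = M"
  proof (intro ext)
    fix x y
    have "mat_of T x y = (\<Sum>z\<in>R x. if z = y then M x z else 0)"
      unfolding mat_of_def T(3) by (intro sum.cong) (auto simp: cf_ket)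
    also have "\<dots> = M x y" using row[of x] supp by simp
    finally show "mat_of T x y = M x y" .
  qed
  then have "opr M = T" "bounded_mat M" using T(1) bounded_mat_mat_of by auto
  then show "bounded_mat M" "norm (opr M) \<le> c * N" "cf (opr M u) x = (\<Sum>y\<in>R x. M x y * cf u y)" using T by auto
qed

section \<open>Diagonal, rank one and commutator estimates\<close>

definition diagm :: "('a \<Rightarrow> complex) \<Rightarrow> 'a mat" where
  "diagm f = (\<lambda>x y. if x = y then f x else 0)"

lemma
  assumes "\<And>x. cmod (f x) \<le> c"
  shows bounded_diagm: "bounded_mat (diagm f)" and norm_diagm: "norm (opr (diagm f)) \<le> c"
    and cf_diagm: "cf (opr (diagm f) u) x = f x * cf u x"
proof -
  have c: "0 \<le> c" using norm_ge_zero assms order_trans by blast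
  have s: "{x. y \<in> {x}} = {y}" for y :: 'a by auto
  note S = schur_bound[of "\<lambda>x. {x}" 1 "diagm f" c]
  show "bounded_mat (diagm f)" by (rule S(1)) (auto simp: s diagm_def assms c)
  have "norm (opr (diagm f)) \<le> c * real 1" by (rule S(2)) (auto simp: s diagm_def assms c)
  then show "norm (opr (diagm f)) \<le> c" by simp
  have "cf (opr (diagm f) u) x = (\<Sum>y\<in>{x}. diagm f x y * cf u y)" by (rule S(3)) (auto simp: s diagm_def assms c)
  then show "cf (opr (diagm f) u) x = f x * cf u x" by (simp add: diagm_def)
qed

lemma finite_prop_uroe: "bounded_mat M \<Longrightarrow> finite_prop M \<Longrightarrow> M \<in> uroe"
  unfolding uroe_def by (auto simp: opnorm_mminus)

lemma uroe_bounded: "M \<in> uroe \<Longrightarrow> bounded_mat M"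
  by (simp add: uroe_def)

lemma diagm_uroe: "(\<And>x. cmod (f x) \<le> c) \<Longrightarrow> diagm f \<in> uroe"
  by (rule finite_prop_uroe[OF bounded_diagm]) (auto simp: finite_prop_def diagm_def intro!: exI[of _ 0])

definition rank_one :: "'a ell2 \<Rightarrow> 'a ell2 \<Rightarrow> 'a mat" where
  "rank_one a b = (\<lambda>x y. cf a x * cnj (cf b y))"

lemma
  shows bounded_rank_one: "bounded_mat (rank_one a b)" and opr_rank_one: "opr (rank_one a b) u = cinner u b *\<^sub>c a"
    and norm_opr_rank_one: "norm (opr (rank_one a b)) \<le> norm a * norm b"
proof -
  have "\<exists>T. clin T \<and> norm T \<le> norm a * norm b \<and> (\<forall>u x. cf (blinfun_apply T u) x = cinner u b * cf a x)"
  proof (rule clin_operator_exists)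
    fix u :: "'a ell2" and G :: "'a set" assume G: "finite G"
    have "(\<Sum>x\<in>G. (cmod (cinner u b * cf a x))^2) = (cmod (cinner u b))^2 * (\<Sum>x\<in>G. (cmod (cf a x))^2)"
      by (simp add: norm_mult power_mult_distrib sum_distrib_left)
    also have "\<dots> \<le> (norm u * norm b)^2 * (norm a)^2"
      by (intro mult_mono power_mono cinner_CS ell2_sum_le G) (auto intro: sum_nonneg)
    finally show "(\<Sum>x\<in>G. (cmod (cinner u b * cf a x))^2) \<le> (norm a * norm b * norm u)^2"
      by (simp add: power_mult_distrib mult_ac)
  qed (auto simp: cinner_add_left distrib_right)
  then obtain T where T: "clin T" "norm T \<le> norm a * norm b" "\<And>u x. cf (blinfun_apply T u) x = cinner u b * cf a x" by blast
  have "mat_of T = rank_one a b" by (intro ext) (simp add: mat_of_def T rank_one_def)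
  then have *: "opr (rank_one a b) = T" "bounded_mat (rank_one a b)" using T(1) bounded_mat_mat_of opr_mat_of by metis+
  then show "bounded_mat (rank_one a b)" "norm (opr (rank_one a b)) \<le> norm a * norm b" using T by auto
  show "opr (rank_one a b) u = cinner u b *\<^sub>c a" unfolding * by (rule ell2_eqI) (simp add: T)
qed

lemma onb_finite_approx:
  assumes "onb b" "e > 0"
  shows "\<exists>P. finite P \<and> norm (u - (\<Sum>i\<in>P. cinner u (b i) *\<^sub>c b i)) \<le> e"
proof -
  interpret onb b by fact
  obtain P where "finite P" "dist (\<Sum>i\<in>P. cinner u (b i) *\<^sub>c b i) u \<le> e"
    using has_sum_finite_approximation[OF expansion[of u] assms(2)] by auto
  then show ?thesis by (auto simp: dist_norm norm_minus_commute)
qed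

lemma finite_support_finite_prop:
  fixes M :: "'a::metric_space mat"
  assumes "finite P" "\<And>x y. x \<notin> P \<or> y \<notin> P \<Longrightarrow> M x y = 0"
  shows "finite_prop M"
proof -
  have "\<exists>r. \<forall>z\<in>P \<times> P. dist (fst z) (snd z) \<le> r"
    using assms(1) finite_imp_bounded[of "(\<lambda>z. dist (fst z) (snd z)) ` (P \<times> P)"]
    by (auto simp: bounded_iff)
  then obtain r where "\<forall>x\<in>P. \<forall>y\<in>P. dist x y \<le> r" by auto
  then show ?thesis unfolding finite_prop_def by (intro exI[of _ r]) (metis assms(2) not_less)
qed

text \<open>Truncating both vectors leaves a matrix with finite support, and a finite set of points
  has bounded distances. This is what lets rank one projections compete for membership in A.\<close>

lemma rank_one_uroe: "rank_one a b \<in> (uroe :: 'a::metric_space mat set)"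
  unfolding uroe_def
proof (intro CollectI conjI allI impI bounded_rank_one)
  fix e :: real assume e: "e > 0"
  \<comment> \<open>The total error is at most d * (norm a + norm b + 1), hence e / 2. The cap 1
    gives \<open>norm a' \<le> norm a + 1\<close>.\<close>
  define d where "d = min 1 (e / (2 * (norm a + norm b + 1)))"
  have d: "d > 0" "d \<le> 1" using e by (auto simp: d_def intro!: divide_pos_pos add_nonneg_pos)
  obtain P where P: "finite P" "norm (a - (\<Sum>i\<in>P. cinner a (ket i) *\<^sub>c ket i)) \<le> d"
    using onb_finite_approx[OF ket.onb_axioms d(1)] by blast
  obtain R where R: "finite R" "norm (b - (\<Sum>i\<in>R. cinner b (ket i) *\<^sub>c ket i)) \<le> d"
    using onb_finite_approx[OF ket.onb_axioms d(1)] by blast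
  define a' b' where "a' = (\<Sum>i\<in>P. cinner a (ket i) *\<^sub>c ket i)" and "b' = (\<Sum>i\<in>R. cinner b (ket i) *\<^sub>c ket i)"
  have sup: "x \<notin> P \<Longrightarrow> cf a' x = 0" "x \<notin> R \<Longrightarrow> cf b' x = 0" for x by (auto simp: a'_def b'_def cf_ket intro!: sum.neutral)
  have "finite_prop (rank_one a' b')"
    by (rule finite_support_finite_prop[of "P \<union> R"]) (use P R sup in \<open>auto simp: rank_one_def\<close>)
  moreover have "norm (opr (rank_one a b) - opr (rank_one a' b')) < e"
  proof -
    have "opr (rank_one a b) - opr (rank_one a' b') = opr (rank_one (a - a') b) + opr (rank_one a' (b - b'))"
      by (rule blinfun_eqI) (simp add: blinfun.add_left blinfun.diff_left opr_rank_one cs_simps cinner_diff_right)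
    also have "norm \<dots> \<le> norm (a - a') * norm b + norm a' * norm (b - b')"
      by (intro norm_triangle_le add_mono norm_opr_rank_one)
    also have "\<dots> \<le> d * norm b + (norm a + 1) * d"
    proof (intro add_mono mult_mono)
      show "norm a' \<le> norm a + 1" using P(2) d norm_triangle_ineq3[of a' a] by (simp add: a'_def norm_minus_commute)
    qed (use P R d in \<open>auto simp: a'_def b'_def\<close>)
    also have "\<dots> = d * (norm a + norm b + 1)" by (simp add: algebra_simps)
    also have "\<dots> \<le> e / (2 * (norm a + norm b + 1)) * (norm a + norm b + 1)"
      by (intro mult_right_mono) (auto simp: d_def)
    also have "\<dots> = e / 2"
    proof -
      have "norm a + norm b + 1 \<noteq> 0" using norm_ge_zero[of a] norm_ge_zero[of b] by linarith
      then show ?thesis by (simp add: divide_simps)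
    qed
    finally show ?thesis using e by simp
  qed
  ultimately show "\<exists>N. bounded_mat N \<and> finite_prop N \<and> opnorm (mminus (rank_one a b) N) < e"
    using bounded_rank_one opnorm_mminus by metis
qed

text \<open>The Lipschitz constant is 1 / L: for large L such a function is nearly constant on balls
  of a fixed radius, which is why it almost commutes with operators of that propagation.\<close>

definition slow :: "real \<Rightarrow> ('a::metric_space \<Rightarrow> real) \<Rightarrow> bool" where
  "slow L f \<longleftrightarrow> (\<forall>x. 0 \<le> f x \<and> f x \<le> 1) \<and> (\<forall>x y. \<bar>f x - f y\<bar> \<le> dist x y / L)"

lemma slow_mono: "slow L f \<Longrightarrow> 0 < K \<Longrightarrow> K \<le> L \<Longrightarrow> slow K f"
  unfolding slow_def by (meson divide_left_mono order_trans zero_le_dist mult_pos_pos order_less_le_trans)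

definition mult_op :: "('a \<Rightarrow> real) \<Rightarrow> 'a ell2 \<Rightarrow>\<^sub>L 'a ell2" where
  "mult_op f = opr (diagm (\<lambda>x. of_real (f x)))"

lemma
  assumes "slow L f"
  shows cf_mult_op: "cf (mult_op f u) x = of_real (f x) * cf u x" and norm_mult_op: "norm (mult_op f) \<le> 1" and clin_mult_op: "clin (mult_op f)"
proof -
  have *: "cmod (of_real (f x)) \<le> 1" for x using assms by (auto simp: slow_def)
  show "cf (mult_op f u) x = of_real (f x) * cf u x" unfolding mult_op_def by (rule cf_diagm[OF *])
  show "norm (mult_op f) \<le> 1" unfolding mult_op_def by (rule norm_diagm[OF *])
  show "clin (mult_op f)" unfolding mult_op_def by (rule clin_opr[OF bounded_diagm[OF *]])
qed

text \<open>The commutator has entries (f x - f y) * M x y. These vanish beyond the propagation s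
  and otherwise are at most s / L times the norm of M; bounded geometry bounds their number per row
  and column, so the Schur test applies.\<close>

lemma commutator_finite_prop:
  fixes M :: "'a::metric_space mat"
  assumes "ulf TYPE('a)" and M: "bounded_mat M" and fp: "finite_prop M"
  shows "\<exists>K\<ge>0. \<forall>L f. 0 < L \<longrightarrow> slow L f \<longrightarrow> norm ((mult_op f o\<^sub>L opr M) - (opr M o\<^sub>L mult_op f)) \<le> K / L"
proof -
  obtain r where r: "\<And>x y. dist x y > r \<Longrightarrow> M x y = 0" using fp finite_prop_def by blast
  \<comment> \<open>The bound \<open>r\<close> may be negative, for instance for the zero
    matrix.\<close>
  define s where "s = max r 0"
  obtain N where N: "\<And>x::'a. finite {y. dist x y \<le> s} \<and> card {y. dist x y \<le> s} \<le> N"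
    using assms(1) unfolding ulf_def by blast
  define K where "K = s * norm (opr M) * N"
  have K: "0 \<le> K" by (simp add: K_def s_def)
  have ent: "cmod (M x y) \<le> norm (opr M)" for x y
  proof -
    have "M x y = cf (opr M (ket y)) x" using mat_of_opr[OF M] by (simp add: mat_of_def fun_eq_iff)
    then show ?thesis using cf_norm_le[of "opr M (ket y)" x] norm_blinfun[of "opr M" "ket y"] by simp
  qed
  have "norm ((mult_op f o\<^sub>L opr M) - (opr M o\<^sub>L mult_op f)) \<le> K / L" if L: "0 < L" "slow L f" for L f
  proof -
    define C where "C = (\<lambda>x y. of_real (f x - f y) * M x y)"
    have cl: "clin ((mult_op f o\<^sub>L opr M) - (opr M o\<^sub>L mult_op f))" by (intro clin_simps clin_mult_op[OF L(2)] clin_opr M)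
    have mk: "mult_op f (ket y) = of_real (f y) *\<^sub>c ket y" for y
      by (rule ell2_eqI) (simp add: cf_mult_op[OF L(2)] cf_ket)
    have o: "cf (opr M (ket y)) x = M x y" for x y using mat_of_opr[OF M] by (simp add: mat_of_def fun_eq_iff)
    have s: "opr M (c *\<^sub>c u) = c *\<^sub>c opr M u" for c u using clin_opr[OF M] by (simp add: clin_def)
    have "mat_of ((mult_op f o\<^sub>L opr M) - (opr M o\<^sub>L mult_op f)) x y = C x y" for x y
    proof -
      have "mat_of ((mult_op f o\<^sub>L opr M) - (opr M o\<^sub>L mult_op f)) x y = cf (mult_op f (opr M (ket y))) x - cf (opr M (mult_op f (ket y))) x"
        by (simp only: mat_of_def blinfun.diff_left blinfun_apply_blinfun_compose cf_simps)
      also have "\<dots> = of_real (f x) * M x y - of_real (f y) * M x y"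
        by (simp only: cf_mult_op[OF L(2)] mk s o cf_simps)
      finally show ?thesis by (simp add: C_def left_diff_distrib)
    qed
    then have e: "opr C = (mult_op f o\<^sub>L opr M) - (opr M o\<^sub>L mult_op f)" using opr_mat_of[OF cl] by (metis ext)
    have "norm (opr C) \<le> (s / L * norm (opr M)) * N"
    proof (rule schur_bound(2)[where R="\<lambda>x. {y. dist x y \<le> s}"])
      show "finite {y. dist x y \<le> s} \<and> card {y. dist x y \<le> s} \<le> N" for x :: 'a by (rule N)
      show "finite {x. y \<in> {y. dist x y \<le> s}} \<and> card {x. y \<in> {y. dist x y \<le> s}} \<le> N" for y :: 'a
        using N[of y] by (simp add: dist_commute)
      show "y \<notin> {y. dist x y \<le> s} \<Longrightarrow> C x y = 0" for x y using r[of x y] by (auto simp: C_def s_def)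
      fix x y
      show "cmod (C x y) \<le> s / L * norm (opr M)"
      proof (cases "dist x y > r")
        case True
        then show ?thesis using r L by (simp add: C_def s_def)
      next
        case False
        then have "\<bar>f x - f y\<bar> \<le> s / L" using L
          by (smt (verit) slow_def divide_right_mono s_def)
        then show ?thesis unfolding C_def norm_mult norm_of_real using ent by (intro mult_mono) auto
      qed
    next
      show "0 \<le> s / L * norm (opr M)" using L by (simp add: s_def)
    qed
    then show ?thesis by (simp add: e K_def)
  qed
  then show ?thesis using K by blast
qed

text \<open>M is replaced by a finite propagation matrix at distance e / 4. As
  \<open>mult_op f\<close> is a contraction, the difference costs e / 4 in each of the two products,
  leaving e / 2 for the commutator with N.\<close>

lemma commutator_uroe:
  fixes M :: "'a::metric_space mat"
  assumes "ulf TYPE('a)" and M: "M \<in> uroe" and e: "0 < e"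
  shows "\<exists>K>0. \<forall>L f. K \<le> L \<longrightarrow> slow L f \<longrightarrow> norm ((mult_op f o\<^sub>L opr M) - (opr M o\<^sub>L mult_op f)) \<le> e"
proof -
  obtain N where N: "bounded_mat N" "finite_prop N" "opnorm (mminus M N) < e/4"
  proof -
    have "\<exists>N. bounded_mat N \<and> finite_prop N \<and> opnorm (mminus M N) < e/4"
      using M e unfolding uroe_def by (auto dest!: spec[of _ "e/4"])
    then show thesis using that by blast
  qed
  have MN: "norm (opr M - opr N) \<le> e/4" using N M by (simp add: opnorm_mminus uroe_bounded)
  obtain K where K: "0 \<le> K" "\<And>L f. 0 < L \<Longrightarrow> slow L f \<Longrightarrow> norm ((mult_op f o\<^sub>L opr N) - (opr N o\<^sub>L mult_op f)) \<le> K / L"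
    using commutator_finite_prop[OF assms(1) N(1,2)] by blast
  have "norm ((mult_op f o\<^sub>L opr M) - (opr M o\<^sub>L mult_op f)) \<le> e" if L: "2 * K / e + 1 \<le> L" "slow L f" for L f
  proof -
    have L0: "0 < L" using L K e by (smt (verit) divide_nonneg_pos)
    have "(mult_op f o\<^sub>L opr M) - (opr M o\<^sub>L mult_op f) =
        ((mult_op f o\<^sub>L opr N) - (opr N o\<^sub>L mult_op f)) + ((mult_op f o\<^sub>L (opr M - opr N)) - ((opr M - opr N) o\<^sub>L mult_op f))"
      by (rule blinfun_eqI) (simp add: blinfun.bilinear_simps)
    also have "norm \<dots> \<le> K / L + (e/4 + e/4)"
    proof (rule norm_triangle_le[OF add_mono[OF K(2)[OF L0 L(2)]]])
      have "norm (mult_op f o\<^sub>L (opr M - opr N)) \<le> norm (mult_op f) * norm (opr M - opr N)" by (rule norm_blinfun_compose)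
      also have "\<dots> \<le> 1 * (e/4)" by (intro mult_mono norm_mult_op[OF L(2)] MN) auto
      finally have 1: "norm (mult_op f o\<^sub>L (opr M - opr N)) \<le> e/4" by simp
      have "norm ((opr M - opr N) o\<^sub>L mult_op f) \<le> norm (opr M - opr N) * norm (mult_op f)" by (rule norm_blinfun_compose)
      also have "\<dots> \<le> e/4 * 1" by (intro mult_mono norm_mult_op[OF L(2)] MN) (use e in auto)
      finally have 2: "norm ((opr M - opr N) o\<^sub>L mult_op f) \<le> e/4" by simp
      show "norm ((mult_op f o\<^sub>L (opr M - opr N)) - ((opr M - opr N) o\<^sub>L mult_op f)) \<le> e/4 + e/4"
        using 1 2 by (meson norm_triangle_le_diff add_mono)
    qed
    also have "K / L \<le> e / 2"
    proof -
      have "2 * K / e \<le> L" using L by simp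
      then show ?thesis using e L0 by (simp add: field_simps)
    qed
    finally show ?thesis by simp
  qed
  moreover have "0 < 2 * K / e + 1" using K e by (smt (verit) divide_nonneg_pos)
  ultimately show ?thesis by blast
qed

subsection \<open>Almost commutation and almost diagonality\<close>

lemma has_sum_single:
  assumes "\<And>j. j \<noteq> i \<Longrightarrow> f j = 0"
  shows "(f has_sum f i) UNIV"
  by (subst has_sum_cong_neutral[where S=UNIV and T="{i}" and g=f])
    (use assms in \<open>auto intro: has_sum_finiteI\<close>)

lemma cinner_clin_sums:
  assumes "clin T"
  shows "cinner (T (\<Sum>n\<in>A. a n *\<^sub>c x n)) (\<Sum>m\<in>B. w m *\<^sub>c y m) = (\<Sum>n\<in>A. \<Sum>m\<in>B. a n * cnj (w m) * cinner (T (x n)) (y m))"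
proof -
  have "T (\<Sum>n\<in>A. a n *\<^sub>c x n) = (\<Sum>n\<in>A. a n *\<^sub>c T (x n))"
    using assms by (simp add: blinfun.sum_right clin_def)
  then show ?thesis
    by (simp only: cinner_sum_left)
      (simp add: cinner_sum_right sum_distrib_left mult_ac)
qed

text \<open>Pairing \<open>T u\<close> with its own truncation turns the norm into a bilinear sum
  without diagonal, which \<open>offdiag_average\<close> controls by the blocks J \<times> (R - J).
  Two bases are allowed because the estimate is needed both inside \<open>xi\<close> and for a map
  from \<open>xi\<close> to point masses.\<close>

lemma offdiag_norm:
  fixes x :: "nat \<Rightarrow> 'a ell2" and y :: "nat \<Rightarrow> 'b ell2"
  assumes x: "onb x" and y: "onb y" and T: "clin T" and e: "0 \<le> e"
    and diag: "\<And>n. cinner (T (x n)) (y n) = 0"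
    and blk: "\<And>R J a w. finite R \<Longrightarrow> J \<subseteq> R \<Longrightarrow>
      cmod (\<Sum>n\<in>J. \<Sum>m\<in>R-J. a n * cnj (w m) * cinner (T (x n)) (y m)) \<le>
        e * norm (\<Sum>n\<in>R. a n *\<^sub>c x n) * norm (\<Sum>m\<in>R. w m *\<^sub>c y m)"
  shows "norm T \<le> 4 * e"
proof -
  interpret x: onb x by fact
  interpret y: onb y by fact
  have fin: "norm (T u) \<le> 4 * e * norm u" if P: "finite P" and u: "u = (\<Sum>n\<in>P. a n *\<^sub>c x n)" for P a u
  proof (rule y.norm_leI)
    fix G :: "nat set" assume G: "finite G"
    \<comment> \<open>One common index set for the coefficients of u and for the tested coordinates
      of \<open>T u\<close>.\<close>
    define R where "R = P \<union> G"
    have R: "finite R" using P G by (simp add: R_def)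
    define a' where "a' n = (if n \<in> P then a n else 0)" for n
    have u': "u = (\<Sum>n\<in>R. a' n *\<^sub>c x n)"
      unfolding u by (rule sum.mono_neutral_cong_left) (use R in \<open>auto simp: a'_def R_def\<close>)
    define w where "w m = cinner (T u) (y m)" for m
    define W where "W = (\<Sum>m\<in>R. w m *\<^sub>c y m)"
    have nW: "(norm W)^2 = (\<Sum>m\<in>R. (cmod (w m))^2)" unfolding W_def by (rule orthonormal_norm_sum[OF y.ortho R])
    have "complex_of_real ((norm W)^2) = cinner (T u) W"
    proof -
      have "cinner (T u) W = (\<Sum>m\<in>R. w m * cnj (w m))"
        unfolding W_def cinner_sum_right by (simp add: w_def[symmetric] mult.commute)
      then show ?thesis by (simp only: nW of_real_sum complex_norm_square)
    qed
    also have "\<dots> = (\<Sum>n\<in>R. \<Sum>m\<in>R. a' n * cnj (w m) * cinner (T (x n)) (y m))"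
      unfolding W_def by (subst u') (rule cinner_clin_sums[OF T])
    also have "\<dots> = (\<Sum>n\<in>R. \<Sum>m\<in>R-{n}. a' n * cnj (w m) * cinner (T (x n)) (y m))"
      using R by (intro sum.cong refl sum.mono_neutral_right) (auto simp: diag)
    finally have eq: "complex_of_real ((norm W)^2) = (\<Sum>n\<in>R. \<Sum>m\<in>R-{n}. a' n * cnj (w m) * cinner (T (x n)) (y m))" .
    have "cmod (\<Sum>n\<in>R. \<Sum>m\<in>R-{n}. a' n * cnj (w m) * cinner (T (x n)) (y m)) \<le> 4 * (e * norm u * norm W)"
      by (rule offdiag_average[OF R]) (use blk[OF R] in \<open>simp add: u' W_def\<close>)
    then have "(norm W)^2 \<le> 4 * (e * norm u * norm W)"
      unfolding eq[symmetric] by (simp only: norm_of_real abs_power2)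
    then have "norm W * norm W \<le> (4 * e * norm u) * norm W" by (simp add: power2_eq_square mult_ac)
    then have "norm W \<le> 4 * e * norm u" using e by (cases "norm W = 0") (auto simp: mult_le_cancel_right)
    then have "(norm W)^2 \<le> (4 * e * norm u)^2" by (intro power_mono) auto
    moreover have "(\<Sum>m\<in>G. (cmod (w m))^2) \<le> (\<Sum>m\<in>R. (cmod (w m))^2)" by (rule sum_mono2) (use R in \<open>auto simp: R_def\<close>)
    ultimately show "(\<Sum>m\<in>G. (cmod (cinner (T u) (y m)))^2) \<le> (4 * e * norm u)^2" unfolding nW w_def by linarith
  qed (use e in auto)
  show ?thesis
  proof (rule norm_blinfun_bound)
    fix u
    have lim: "((\<lambda>P. norm (T (\<Sum>i\<in>P. cinner u (x i) *\<^sub>c x i))) \<longlongrightarrow> norm (T u)) (finite_subsets_at_top UNIV)"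
      using x.expansion[of u] unfolding has_sum_def by (intro tendsto_intros)
    show "norm (T u) \<le> 4 * e * norm u"
    proof (rule tendsto_upperbound[OF lim])
      show "\<forall>\<^sub>F P in finite_subsets_at_top UNIV. norm (T (\<Sum>i\<in>P. cinner u (x i) *\<^sub>c x i)) \<le> 4 * e * norm u"
      proof (rule eventually_finite_subsets_at_top_weakI)
        fix P :: "nat set" assume P: "finite P"
        have "(norm (\<Sum>i\<in>P. cinner u (x i) *\<^sub>c x i))^2 \<le> (norm u)^2"
          using orthonormal_norm_sum[OF x.ortho P] bessel[OF x.ortho P] by simp
        then have "norm (\<Sum>i\<in>P. cinner u (x i) *\<^sub>c x i) \<le> norm u" by (simp add: power2_le_iff_abs_le)
        then show "norm (T (\<Sum>i\<in>P. cinner u (x i) *\<^sub>c x i)) \<le> 4 * e * norm u"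
          using fin[OF P refl, of "\<lambda>i. cinner u (x i)"] e by (smt (verit) mult_left_mono)
      qed
    qed simp
  qed (use e in simp)
qed

text \<open>This is what the analytic part retains of A: an orthonormal basis whose bounded diagonal
  operators all lie in \<open>uroe\<close>. Later \<open>dg\<close> becomes the inverse of the
  isomorphism with bounded sequences.\<close>

locale roe_basis = onb xi for xi :: "nat \<Rightarrow> 'a::metric_space ell2" +
  fixes dg :: "(nat \<Rightarrow> complex) \<Rightarrow> 'a mat"
  assumes ulf: "ulf TYPE('a)" and alg: "cstar_subalg (uroe :: 'a mat set)"
    and dg_uroe: "bounded (range c) \<Longrightarrow> dg c \<in> uroe"
    and dg_xi: "bounded (range c) \<Longrightarrow> opr (dg c) (xi n) = c n *\<^sub>c xi n"
begin

lemma cinner_dg: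
  assumes c: "bounded (range c)"
  shows "cinner (opr (dg c) u) (xi n) = c n * cinner u (xi n)"
proof -
  have cl: "clin (opr (dg c))" by (intro clin_opr uroe_bounded dg_uroe c)
  have "bounded_linear (\<lambda>w. cinner (opr (dg c) w) (xi n))"
    by (rule bounded_linear_compose[OF bounded_linear_cinner blinfun.bounded_linear_right])
  from has_sum_bounded_linear[OF this expansion[of u]] cl
  have "((\<lambda>i. cinner u (xi i) * (c i * cinner (xi i) (xi n))) has_sum cinner (opr (dg c) u) (xi n)) UNIV"
    by (simp add: o_def clin_def dg_xi[OF c] mult.assoc)
  moreover have "((\<lambda>i. cinner u (xi i) * (c i * cinner (xi i) (xi n))) has_sum cinner u (xi n) * (c n * cinner (xi n) (xi n))) UNIV"
    by (rule has_sum_single) (simp add: cinner_b)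
  ultimately show ?thesis using has_sum_unique by (fastforce simp: cinner_b)
qed

definition q :: "nat set \<Rightarrow> 'a mat" where "q J = dg (\<lambda>n. if n \<in> J then 1 else 0)"

lemma bounded_ind: "bounded (range (\<lambda>n. if n \<in> J then 1 else 0 :: complex))"
  by (rule finite_imp_bounded, rule finite_subset[of _ "{0,1}"]) auto

lemma q_uroe: "q J \<in> uroe"
  unfolding q_def by (intro dg_uroe bounded_ind)

lemma cinner_q: "cinner (opr (q J) u) (xi n) = (if n \<in> J then cinner u (xi n) else 0)"
  unfolding q_def by (simp add: cinner_dg[OF bounded_ind])

lemma q_eqI:
  assumes "\<And>n. n \<in> J \<Longrightarrow> cinner v (xi n) = cinner u (xi n)" "\<And>n. n \<notin> J \<Longrightarrow> cinner v (xi n) = 0"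
  shows "opr (q J) u = v"
  by (rule eqI) (use assms in \<open>auto simp: cinner_q\<close>)

lemma norm_le_coeff:
  assumes "\<And>n. cmod (cinner v (xi n)) \<le> K * cmod (cinner u (xi n))" "0 \<le> K"
  shows "norm v \<le> K * norm u"
proof (rule norm_leI)
  fix F :: "nat set" assume F: "finite F"
  have "(\<Sum>n\<in>F. (cmod (cinner v (xi n)))^2) \<le> (\<Sum>n\<in>F. (K * cmod (cinner u (xi n)))^2)"
    by (intro sum_mono power_mono assms) auto
  also have "\<dots> = K^2 * (\<Sum>n\<in>F. (cmod (cinner u (xi n)))^2)" by (simp add: power_mult_distrib sum_distrib_left)
  also have "\<dots> \<le> K^2 * (norm u)^2" by (intro mult_left_mono bessel[OF ortho F]) auto
  finally show "(\<Sum>n\<in>F. (cmod (cinner v (xi n)))^2) \<le> (K * norm u)^2" by (simp add: power_mult_distrib)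
qed (use assms in auto)

lemma norm_le_coeff1: "(\<And>n. cmod (cinner v (xi n)) \<le> cmod (cinner u (xi n))) \<Longrightarrow> norm v \<le> norm u"
  using norm_le_coeff[of v 1 u] by simp

lemma q_cinner_disjoint:
  assumes "J \<inter> I = {}" shows "cinner (opr (q J) u) (opr (q I) v) = 0"
proof -
  have "((\<lambda>i. cinner (opr (q J) u) (xi i) * cnj (cinner (opr (q I) v) (xi i))) has_sum 0) UNIV"
    by (rule has_sum_0) (use assms in \<open>auto simp: cinner_q\<close>)
  then show ?thesis using cparseval has_sum_unique by blast
qed

text \<open>The two vectors differ only in coefficients outside P, and there only by coefficients of
  the small residual of u. As P depends on u, this is strong continuity of \<open>q\<close> on the
  Cantor space.\<close>

lemma q_continuous:
  assumes "0 < e"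
  shows "\<exists>P. finite P \<and> (\<forall>J J'. J \<inter> P = J' \<inter> P \<longrightarrow> norm (opr (q J) u - opr (q J') u) \<le> e)"
proof -
  obtain P where P: "finite P" "norm (u - (\<Sum>i\<in>P. cinner u (xi i) *\<^sub>c xi i)) \<le> e"
    using onb_finite_approx[OF onb_axioms assms] by blast
  define w where "w = u - (\<Sum>i\<in>P. cinner u (xi i) *\<^sub>c xi i)"
  have v: "cinner w (xi n) = (if n \<in> P then 0 else cinner u (xi n))" for n
    unfolding w_def by (simp add: cinner_diff_left orthonormal_cinner_sum[OF ortho P(1)])
  have "norm (opr (q J) u - opr (q J') u) \<le> e" if "J \<inter> P = J' \<inter> P" for J J'
  proof -
    have "n \<in> P \<Longrightarrow> n \<in> J \<longleftrightarrow> n \<in> J'" for n using that by blast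
    then have "cmod (cinner (opr (q J) u - opr (q J') u) (xi n)) \<le> 1 * cmod (cinner w (xi n))" for n
      by (cases "n \<in> P") (auto simp: v cinner_diff_left cinner_q)
    from norm_le_coeff[OF this] P(2) show ?thesis by (simp add: w_def)
  qed
  then show ?thesis using P(1) by blast
qed

definition comm :: "('a \<Rightarrow> real) \<Rightarrow> nat set \<Rightarrow> 'a ell2 \<Rightarrow>\<^sub>L 'a ell2" where
  "comm f J = (mult_op f o\<^sub>L opr (q J)) - (opr (q J) o\<^sub>L mult_op f)"

lemma comm_app: "comm f J u = mult_op f (opr (q J) u) - opr (q J) (mult_op f u)"
  by (simp add: comm_def blinfun.diff_left)

text \<open>\<open>commutator_uroe\<close> gives a threshold for each J separately. The condition
  \<open>Z k\<close> is closed, since an excess of norm shows at a single u and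
  \<open>q_continuous\<close> preserves it nearby. One threshold then serves a whole cylinder, and
  every J is reduced to it by a change on the finite set P.\<close>

lemma commutator_uniform:
  assumes e: "0 < e"
  shows "\<exists>L>0. \<forall>J f. slow L f \<longrightarrow> norm (comm f J) \<le> e"
proof -
  define Z where "Z k J \<longleftrightarrow> (\<forall>f. slow (real (Suc k)) f \<longrightarrow> norm (comm f J) \<le> e/3)" for k J
  have U: "\<exists>k. \<forall>k'\<ge>k. Z k' J" for J
  proof -
    obtain K where K: "K > 0" "\<And>L f. K \<le> L \<Longrightarrow> slow L f \<Longrightarrow> norm (comm f J) \<le> e/3"
      using commutator_uroe[OF ulf q_uroe[of J], of "e/3"] e unfolding comm_def by auto
    obtain k where "K \<le> real k" using real_arch_simple by blast
    then have "Z k' J" if "k' \<ge> k" for k' unfolding Z_def using K(2) that by (smt (verit) of_nat_mono of_nat_Suc)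
    then show ?thesis by blast
  qed
  have "\<exists>k P J0. finite P \<and> (\<forall>J. J \<inter> P = J0 \<inter> P \<longrightarrow> Z k J)"
  proof (rule baire_cylinder)
    show "\<exists>k. Z k J" for J using U by blast
    fix k J assume "\<not> Z k J"
    then obtain f where f: "slow (real (Suc k)) f" "norm (comm f J) > e/3" by (auto simp: Z_def)
    have "\<exists>u. norm (comm f J u) > e/3 * norm u"
    proof (rule ccontr)
      assume "\<not> ?thesis"
      then have "norm (comm f J) \<le> e/3" using e by (intro norm_blinfun_bound) (auto simp: not_less)
      then show False using f by simp
    qed
    then obtain u where u: "norm (comm f J u) > e/3 * norm u" by blast
    \<comment> \<open>The excess at u is 3 * d, while replacing J costs at most d for each of the
      two occurrences of \<open>q\<close>.\<close>
    define d where "d = (norm (comm f J u) - e/3 * norm u) / 3"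
    have d: "d > 0" using u by (simp add: d_def)
    obtain P1 where P1: "finite P1" "\<And>J J'. J \<inter> P1 = J' \<inter> P1 \<Longrightarrow> norm (opr (q J) u - opr (q J') u) \<le> d"
      using q_continuous[OF d, of u] by blast
    obtain P2 where P2: "finite P2" "\<And>J J'. J \<inter> P2 = J' \<inter> P2 \<Longrightarrow> norm (opr (q J) (mult_op f u) - opr (q J') (mult_op f u)) \<le> d"
      using q_continuous[OF d, of "mult_op f u"] by blast
    have "\<not> Z k J'" if J': "J' \<inter> (P1 \<union> P2) = J \<inter> (P1 \<union> P2)" for J'
    proof
      assume Z: "Z k J'"
      have "norm (comm f J') \<le> e/3" using Z f(1) by (simp add: Z_def)
      then have le: "norm (comm f J' u) \<le> e/3 * norm u"
        using norm_blinfun[of "comm f J'" u] by (meson mult_right_mono norm_ge_zero order_trans)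
      have 1: "norm (opr (q J) u - opr (q J') u) \<le> d" using J' by (intro P1(2)) blast
      have 2: "norm (opr (q J') (mult_op f u) - opr (q J) (mult_op f u)) \<le> d" using J' by (intro P2(2)) blast
      have 3: "norm (mult_op f (opr (q J) u - opr (q J') u)) \<le> d"
        using norm_blinfun[of "mult_op f" "opr (q J) u - opr (q J') u"] norm_mult_op[OF f(1)] 1
        by (smt (verit) mult_left_le_one_le norm_ge_zero)
      have "comm f J u = comm f J' u + (mult_op f (opr (q J) u - opr (q J') u) + (opr (q J') (mult_op f u) - opr (q J) (mult_op f u)))"
        by (simp add: comm_app blinfun.diff_right)
      then have "norm (comm f J u) \<le> e/3 * norm u + (d + d)"
        using norm_triangle_le[OF add_mono[OF le norm_triangle_le[OF add_mono[OF 3 2]]]] by simp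
      then show False using d by (simp add: d_def field_simps)
    qed
    then show "\<exists>P. finite P \<and> (\<forall>J'. J' \<inter> P = J \<inter> P \<longrightarrow> \<not> Z k J')"
      using P1(1) P2(1) by (intro exI[of _ "P1 \<union> P2"]) auto
  qed
  then obtain k0 P J0 where P: "finite P" "\<And>J. J \<inter> P = J0 \<inter> P \<Longrightarrow> Z k0 J" by blast
  obtain g where g: "\<And>J k'. k' \<ge> g J \<Longrightarrow> Z k' J" using U by metis
  \<comment> \<open>The sets J \<inter> P range over the finite \<open>Pow P\<close>, so their
    individual thresholds have a maximum.\<close>
  define k where "k = Max (insert k0 (g ` Pow P))"
  have kg: "Z k J" if "J \<subseteq> P" for J
    using that P(1) by (intro g) (auto simp: k_def)
  have k0: "k0 \<le> k" using P(1) by (simp add: k_def)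
  have "norm (comm f J) \<le> e" if f: "slow (real (Suc k)) f" for f J
  proof -
    \<comment> \<open>I agrees with J off P and with J0 on P, so it lies in the cylinder. The
      correction involves two subsets of P; the three commutators contribute e / 3 each.\<close>
    define I where "I = (J - P) \<union> (J0 \<inter> P)"
    have "comm f J = comm f I + (comm f (J \<inter> P) - comm f (J0 \<inter> P))"
    proof -
      have "opr (q J) u = opr (q I) u + (opr (q (J \<inter> P)) u - opr (q (J0 \<inter> P)) u)" for u
        by (rule q_eqI) (auto simp: cinner_add_left cinner_diff_left cinner_q I_def)
      then show ?thesis by (intro Bounded_Linear_Function.blinfun_eqI)
          (simp add: blinfun.add_left blinfun.diff_left comm_app blinfun.add_right blinfun.diff_right)
    qed
    also have "norm \<dots> \<le> e/3 + (e/3 + e/3)"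
    proof (intro norm_triangle_le add_mono norm_triangle_le_diff)
      have "slow (real (Suc k0)) f" by (rule slow_mono[OF f]) (use k0 in auto)
      moreover have "Z k0 I" by (rule P(2)) (auto simp: I_def)
      ultimately show "norm (comm f I) \<le> e/3" by (simp add: Z_def)
      show "norm (comm f (J \<inter> P)) \<le> e/3" "norm (comm f (J0 \<inter> P)) \<le> e/3"
        using kg[of "J \<inter> P"] kg[of "J0 \<inter> P"] f by (auto simp: Z_def)
    qed
    finally show ?thesis by simp
  qed
  then show ?thesis by (intro exI[of _ "real (Suc k)"]) auto
qed

text \<open>For \<open>uJ\<close> in the range of \<open>q J\<close> and \<open>wJ\<close> in that
  of \<open>q (- J)\<close>, \<open>cinner (T uJ) wJ\<close> does not change when T is replaced by
  its commutator with \<open>q J\<close>. So every off-diagonal block is bounded by e, and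
  \<open>offdiag_norm\<close> costs the factor 4.\<close>

lemma almost_diagonal:
  assumes T: "clin T" and e: "0 \<le> e"
    and c: "\<And>J. norm ((T o\<^sub>L opr (q J)) - (opr (q J) o\<^sub>L T)) \<le> e"
  shows "norm (T - opr (dg (\<lambda>n. cinner (T (xi n)) (xi n)))) \<le> 4 * e"
proof -
  define d where "d = (\<lambda>n. cinner (T (xi n)) (xi n))"
  have "cmod (d n) \<le> norm T" for n
    using cinner_CS[of "T (xi n)" "xi n"] norm_blinfun[of T "xi n"] by (simp add: d_def)
  then have bd: "bounded (range d)" by (auto simp: bounded_iff)
  define Z where "Z = T - opr (dg d)"
  have clZ: "clin Z" unfolding Z_def by (intro clin_simps T clin_opr uroe_bounded dg_uroe bd)
  have Zmn: "cinner (Z (xi n)) (xi m) = (if m = n then 0 else cinner (T (xi n)) (xi m))" for n m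
    by (simp add: Z_def blinfun.diff_left cinner_diff_left dg_xi[OF bd] cinner_b) (simp add: d_def)
  have "norm Z \<le> 4 * e"
  proof (rule offdiag_norm[OF onb_axioms onb_axioms clZ e])
    show "cinner (Z (xi n)) (xi n) = 0" for n by (simp add: Zmn)
    fix R J :: "nat set" and a w :: "nat \<Rightarrow> complex" assume R: "finite R" and J: "J \<subseteq> R"
    have fJ: "finite J" using J R finite_subset by blast
    define u where "u = (\<Sum>n\<in>R. a n *\<^sub>c xi n)"
    define W where "W = (\<Sum>m\<in>R. w m *\<^sub>c xi m)"
    define uJ where "uJ = (\<Sum>n\<in>J. a n *\<^sub>c xi n)"
    define wJ where "wJ = (\<Sum>m\<in>R-J. w m *\<^sub>c xi m)"
    have cu: "cinner u (xi n) = (if n \<in> R then a n else 0)" for n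
      unfolding u_def by (rule orthonormal_cinner_sum[OF ortho R])
    have cuJ: "cinner uJ (xi n) = (if n \<in> J then a n else 0)" for n
      unfolding uJ_def by (rule orthonormal_cinner_sum[OF ortho fJ])
    have cwJ: "cinner wJ (xi n) = (if n \<in> R - J then w n else 0)" for n
      unfolding wJ_def by (rule orthonormal_cinner_sum[OF ortho]) (use R in simp)
    have cW: "cinner W (xi n) = (if n \<in> R then w n else 0)" for n
      unfolding W_def by (rule orthonormal_cinner_sum[OF ortho R])
    have nu: "norm uJ \<le> norm u" by (rule norm_le_coeff1) (use J in \<open>auto simp: cu cuJ\<close>)
    have nw: "norm wJ \<le> norm W" by (rule norm_le_coeff1) (use J in \<open>auto simp: cW cwJ\<close>)
    have qu: "opr (q J) uJ = uJ" by (rule q_eqI) (auto simp: cuJ)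
    have qw: "opr (q (- J)) wJ = wJ" by (rule q_eqI) (auto simp: cwJ)
    have "(\<Sum>n\<in>J. \<Sum>m\<in>R-J. a n * cnj (w m) * cinner (Z (xi n)) (xi m)) = (\<Sum>n\<in>J. \<Sum>m\<in>R-J. a n * cnj (w m) * cinner (T (xi n)) (xi m))"
      by (intro sum.cong refl) (auto simp: Zmn)
    also have "\<dots> = cinner (T uJ) wJ"
      unfolding uJ_def wJ_def by (rule cinner_clin_sums[OF T, symmetric])
    also have "\<dots> = cinner (((T o\<^sub>L opr (q J)) - (opr (q J) o\<^sub>L T)) uJ) wJ"
      using q_cinner_disjoint[of J "- J" "T uJ" wJ] by (simp add: blinfun.diff_left qu qw cinner_diff_left)
    also have "cmod \<dots> \<le> norm (((T o\<^sub>L opr (q J)) - (opr (q J) o\<^sub>L T)) uJ) * norm wJ" by (rule cinner_CS)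
    also have "\<dots> \<le> (e * norm u) * norm W"
    proof (intro mult_mono nw)
      have "norm (((T o\<^sub>L opr (q J)) - (opr (q J) o\<^sub>L T)) uJ) \<le> norm ((T o\<^sub>L opr (q J)) - (opr (q J) o\<^sub>L T)) * norm uJ"
        by (rule norm_blinfun)
      also have "\<dots> \<le> e * norm u" by (intro mult_mono c nu e) auto
      finally show "norm (((T o\<^sub>L opr (q J)) - (opr (q J) o\<^sub>L T)) uJ) \<le> e * norm u" .
    qed (use e in auto)
    finally show "cmod (\<Sum>n\<in>J. \<Sum>m\<in>R-J. a n * cnj (w m) * cinner (Z (xi n)) (xi m)) \<le>
        e * norm (\<Sum>n\<in>R. a n *\<^sub>c xi n) * norm (\<Sum>m\<in>R. w m *\<^sub>c xi m)" by (simp add: u_def W_def)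
  qed
  then show ?thesis by (simp add: Z_def d_def)
qed

end

subsection \<open>A bijection close to the peaks\<close>

text \<open>A cut-off that is 1 on S and 0 from distance L on. For empty S the default
  \<open>infdist x {} = 0\<close> makes it constantly 1, whence the nonemptiness assumptions
  below.\<close>

definition bump :: "real \<Rightarrow> 'a::metric_space set \<Rightarrow> 'a \<Rightarrow> real" where
  "bump L S x = max 0 (1 - infdist x S / L)"

lemma slow_bump:
  assumes "0 < L" shows "slow L (bump L S)"
proof -
  have "\<bar>bump L S x - bump L S y\<bar> \<le> dist x y / L" for x y
  proof -
    have "\<bar>bump L S x - bump L S y\<bar> \<le> \<bar>infdist x S / L - infdist y S / L\<bar>" unfolding bump_def by linarith
    also have "\<dots> = \<bar>infdist x S - infdist y S\<bar> / L" using assms by (simp add: diff_divide_distrib[symmetric] abs_divide)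
    also have "\<dots> \<le> dist x y / L" using assms infdist_triangle_abs by (intro divide_right_mono) auto
    finally show ?thesis .
  qed
  then show ?thesis using assms by (auto simp: slow_def bump_def infdist_nonneg divide_nonneg_pos)
qed

lemma bump_eq_1: "x \<in> S \<Longrightarrow> bump L S x = 1"
  by (simp add: bump_def)

lemma bump_nonzero:
  assumes "0 < L" "S \<noteq> {}" "bump L S x \<noteq> 0" shows "\<exists>s\<in>S. dist x s < L"
proof -
  have "infdist x S / L < 1" using assms(3) unfolding bump_def by linarith
  then have "infdist x S < L" using assms(1) by (simp add: field_simps)
  then have "(INF s\<in>S. dist x s) < L" using assms(2) by (simp add: infdist_def)
  then show ?thesis using assms(2) by (subst (asm) cINF_less_iff) auto
qed

lemma bump_sum_le:
  assumes "0 < L" "S \<noteq> {}" "\<And>s. s \<in> S \<Longrightarrow> L \<le> dist s y"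
  shows "bump L S x + bump L {y} x \<le> 1"
proof -
  have "L - dist x y \<le> infdist x S"
    unfolding infdist_notempty[OF assms(2)]
  proof (rule cINF_greatest[OF assms(2)])
    fix s assume "s \<in> S"
    then show "L - dist x y \<le> dist x s" using assms(3)[of s] dist_triangle[of s y x] by (simp add: dist_commute)
  qed
  then have "L \<le> infdist x S + dist x y" by simp
  then have "L / L \<le> (infdist x S + dist x y) / L" using assms(1) by (intro divide_right_mono) auto
  then have "1 \<le> infdist x S / L + dist x y / L" using assms(1) by (simp add: add_divide_distrib)
  moreover have "0 \<le> infdist x S / L" "0 \<le> dist x y / L" using assms(1) by (auto simp: infdist_nonneg)
  ultimately show ?thesis unfolding bump_def by (simp add: max_def)
qed

context roe_basis
begin

text \<open>The diagonal entry of f in the basis \<open>xi\<close>, read as an expectation of f for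
  the probability weights given by the squared moduli of \<open>xi n\<close>.\<close>

definition mean :: "('a \<Rightarrow> real) \<Rightarrow> nat \<Rightarrow> real" where
  "mean f n = infsum (\<lambda>x. f x * (cmod (cf (xi n) x))^2) UNIV"

lemma mean_has_sum:
  assumes "slow L f"
  shows "((\<lambda>x. f x * (cmod (cf (xi n) x))^2) has_sum mean f n) UNIV"
proof -
  have "(\<lambda>x. f x * (cmod (cf (xi n) x))^2) summable_on UNIV"
  proof (rule summable_on_comparison_test)
    show "(\<lambda>x. (cmod (cf (xi n) x))^2) summable_on UNIV" using ell2_norm_has_sum has_sum_imp_summable by blast
  qed (use assms in \<open>auto simp: slow_def mult_left_le_one_le\<close>)
  then show ?thesis by (simp add: mean_def)
qed

lemma cinner_mult_op:
  assumes "slow L f" shows "cinner (mult_op f (xi n)) (xi n) = of_real (mean f n)"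
proof (rule cinner_eqI)
  have "(\<lambda>x. cf (mult_op f (xi n)) x * cnj (cf (xi n) x)) = (\<lambda>x. of_real (f x * (cmod (cf (xi n) x))^2))"
    by (rule ext) (simp add: cf_mult_op[OF assms] mult.assoc complex_norm_square[symmetric] del: of_real_power)
  then show "((\<lambda>x. cf (mult_op f (xi n)) x * cnj (cf (xi n) x)) has_sum of_real (mean f n)) UNIV"
    by (simp only: has_sum_of_real[OF mean_has_sum[OF assms]])
qed

lemma mean_nonneg: "slow L f \<Longrightarrow> 0 \<le> mean f n"
  using mean_has_sum by (rule has_sum_nonneg) (auto simp: slow_def)

lemma mean_ge:
  assumes "slow L f" shows "f x * (cmod (cf (xi n) x))^2 \<le> mean f n"
proof -
  have "(\<Sum>x\<in>{x}. f x * (cmod (cf (xi n) x))^2) \<le> mean f n"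
    by (rule finite_sum_le_has_sum[OF mean_has_sum[OF assms]]) (use assms in \<open>auto simp: slow_def\<close>)
  then show ?thesis by simp
qed

lemma mean_add_le:
  assumes "slow L f" "slow L g" "\<And>x. f x + g x \<le> 1"
  shows "mean f n + mean g n \<le> 1"
proof -
  have "((\<lambda>x. f x * (cmod (cf (xi n) x))^2 + g x * (cmod (cf (xi n) x))^2) has_sum mean f n + mean g n) UNIV"
    by (intro has_sum_add mean_has_sum[OF assms(1)] mean_has_sum[OF assms(2)])
  then have "mean f n + mean g n \<le> (norm (xi n))^2"
  proof (rule has_sum_mono[OF _ ell2_norm_has_sum])
    fix x
    have "(f x + g x) * (cmod (cf (xi n) x))^2 \<le> 1 * (cmod (cf (xi n) x))^2" by (intro mult_right_mono assms) auto
    then show "f x * (cmod (cf (xi n) x))^2 + g x * (cmod (cf (xi n) x))^2 \<le> (cmod (cf (xi n) x))^2"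
      by (simp add: distrib_right)
  qed
  then show ?thesis by simp
qed

lemma mean_le_1:
  assumes "slow L f" shows "mean f n \<le> 1"
proof -
  have "mean f n \<le> (norm (xi n))^2"
    by (rule has_sum_mono[OF mean_has_sum[OF assms] ell2_norm_has_sum])
      (use assms in \<open>auto simp: slow_def mult_left_le_one_le\<close>)
  then show ?thesis by simp
qed

definition mean_op :: "('a \<Rightarrow> real) \<Rightarrow> 'a ell2 \<Rightarrow>\<^sub>L 'a ell2" where
  "mean_op f = opr (dg (\<lambda>n. of_real (mean f n)))"

lemma bounded_mean: "slow L f \<Longrightarrow> bounded (range (\<lambda>n. complex_of_real (mean f n)))"
  using mean_nonneg mean_le_1 by (auto simp: bounded_iff intro!: exI[of _ 1])

lemma cinner_mean_op: "slow L f \<Longrightarrow> cinner (mean_op f u) (xi n) = of_real (mean f n) * cinner u (xi n)"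
  unfolding mean_op_def by (rule cinner_dg[OF bounded_mean])

text \<open>The uniformity in J from \<open>commutator_uniform\<close> is exactly what
  \<open>almost_diagonal\<close> consumes; e / 4 compensates its factor 4.\<close>

lemma slow_diag:
  assumes "0 < e" shows "\<exists>L>0. \<forall>f. slow L f \<longrightarrow> norm (mult_op f - mean_op f) \<le> e"
proof -
  obtain L where L: "L > 0" "\<And>J f. slow L f \<Longrightarrow> norm (comm f J) \<le> e/4"
    using commutator_uniform[of "e/4"] assms by auto
  have "norm (mult_op f - mean_op f) \<le> e" if f: "slow L f" for f
    using almost_diagonal[OF clin_mult_op[OF f], of "e/4"] L(2)[OF f] assms
    by (simp add: cinner_mult_op[OF f] mean_op_def comm_def)
  then show ?thesis using L(1) by blast
qed

end

locale roe_peaks = roe_basis +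
  fixes h :: "nat \<Rightarrow> 'a" and d :: real
  assumes d_pos: "0 < d" and peak: "\<And>n. d \<le> cmod (cf (xi n) (h n))"
begin

lemma d_le_1: "d \<le> 1"
  using peak[of 0] cf_norm_le[of "xi 0" "h 0"] by simp

text \<open>The vector (f - mean) \<open>xi n\<close> has norm at most e, while at
  \<open>h n\<close>, where f = 1, its value has modulus at least |1 - mean| * d. Hence almost all
  mass of \<open>xi n\<close> lies within L of its peak, however small d is, once e is small against
  d.\<close>

lemma mean_bump_peak:
  assumes "0 < L" "norm (mult_op (bump L {h n}) - mean_op (bump L {h n})) \<le> e"
  shows "1 - e / d \<le> mean (bump L {h n}) n"
proof -
  let ?f = "bump L {h n}"
  have f: "slow L ?f" using assms(1) by (rule slow_bump)
  have "mean_op ?f (xi n) = of_real (mean ?f n) *\<^sub>c xi n" unfolding mean_op_def by (rule dg_xi[OF bounded_mean[OF f]])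
  then have "cf ((mult_op ?f - mean_op ?f) (xi n)) (h n) = of_real (1 - mean ?f n) * cf (xi n) (h n)"
    by (simp add: blinfun.diff_left cf_mult_op[OF f] bump_eq_1 left_diff_distrib)
  then have "\<bar>1 - mean ?f n\<bar> * cmod (cf (xi n) (h n)) \<le> norm ((mult_op ?f - mean_op ?f) (xi n))"
    using cf_norm_le[of "(mult_op ?f - mean_op ?f) (xi n)" "h n"] by (simp only: norm_mult norm_of_real)
  also have "\<dots> \<le> e" using norm_blinfun[of "mult_op ?f - mean_op ?f" "xi n"] assms(2) by simp
  finally have "\<bar>1 - mean ?f n\<bar> * d \<le> e" using peak[of n] by (smt (verit) mult_left_mono abs_ge_zero)
  then have "\<bar>1 - mean ?f n\<bar> \<le> e / d" using d_pos by (simp add: field_simps)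
  then show ?thesis by linarith
qed

text \<open>The map h need not be injective, but every n with \<open>h n = x\<close> uses up d^2 of
  the unit norm of \<open>ket x\<close> in Bessel's inequality.\<close>

lemma fibre_card: "finite {n. h n = x} \<and> card {n. h n = x} \<le> nat \<lfloor>1 / d^2\<rfloor>"
proof (rule finite_if_finite_subsets_card_bdd)
  fix G assume G: "G \<subseteq> {n. h n = x}" "finite G"
  have "real (card G) * d^2 = (\<Sum>n\<in>G. d^2)" by simp
  also have "\<dots> \<le> (\<Sum>n\<in>G. (cmod (cinner (ket x) (xi n)))^2)"
    using G peak d_pos by (intro sum_mono power_mono) auto
  also have "\<dots> \<le> (norm (ket x))^2" by (rule bessel[OF ortho G(2)])
  finally have "real (card G) \<le> 1 / d^2" using d_pos by (simp add: field_simps)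
  then show "card G \<le> nat \<lfloor>1 / d^2\<rfloor>" by (simp add: le_nat_floor)
qed

lemma near_card: "\<exists>K. \<forall>x. finite {n. dist x (h n) \<le> L} \<and> card {n. dist x (h n) \<le> L} \<le> K"
proof -
  obtain N where N: "\<And>x::'a. finite {y. dist x y \<le> L} \<and> card {y. dist x y \<le> L} \<le> N"
    using ulf unfolding ulf_def by blast
  have "finite {n. dist x (h n) \<le> L} \<and> card {n. dist x (h n) \<le> L} \<le> N * nat \<lfloor>1 / d^2\<rfloor>" for x
  proof -
    have e: "{n. dist x (h n) \<le> L} = (\<Union>y\<in>{y. dist x y \<le> L}. {n. h n = y})" by auto
    have "card (\<Union>y\<in>{y. dist x y \<le> L}. {n. h n = y}) \<le> (\<Sum>y\<in>{y. dist x y \<le> L}. card {n. h n = y})"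
      by (rule card_UN_le) (use N in blast)
    also have "\<dots> \<le> of_nat (card {y. dist x y \<le> L}) * nat \<lfloor>1 / d^2\<rfloor>"
      by (rule sum_bounded_above) (use fibre_card in blast)
    also have "\<dots> \<le> N * nat \<lfloor>1 / d^2\<rfloor>" using N[of x] by (intro mult_right_mono) auto
    finally show ?thesis unfolding e using N[of x] fibre_card by blast
  qed
  then show ?thesis by blast
qed

lemma finite_near: "finite {x. dist x (h n) \<le> L}" "finite {n. dist x (h n) \<le> L}"
proof -
  have "finite {x. dist (h n) x \<le> L}" using ulf unfolding ulf_def by blast
  then show "finite {x. dist x (h n) \<le> L}" by (simp only: dist_commute)
  show "finite {n. dist x (h n) \<le> L}" using near_card[of L] by blast
qed

lemma slow_diag_app:
  assumes "norm (mult_op f - mean_op f) \<le> e" shows "norm (mult_op f u - mean_op f u) \<le> e * norm u"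
proof -
  have "norm ((mult_op f - mean_op f) u) \<le> norm (mult_op f - mean_op f) * norm u" by (rule norm_blinfun)
  also have "\<dots> \<le> e * norm u" by (intro mult_right_mono assms) auto
  finally show ?thesis by (simp add: blinfun.diff_left)
qed

context
  fixes L e :: real
  assumes L: "L > 0" "\<And>f. slow L f \<Longrightarrow> norm (mult_op f - mean_op f) \<le> e"
begin

lemma hall_forward:
  assumes F: "finite F" and e: "e < d^2"
  shows "card F \<le> card (\<Union>n\<in>F. {x. dist x (h n) \<le> L})"
proof (rule ccontr)
  let ?Y = "\<Union>n\<in>F. {x. dist x (h n) \<le> L}"
  assume "\<not> ?thesis"
  then have lt: "card ?Y < card F" by simp
  then have ne: "F \<noteq> {}" by auto
  obtain c where c: "\<exists>n\<in>F. c n \<noteq> 0" "\<forall>y\<in>?Y. (\<Sum>n\<in>F. c n * cf (xi n) y) = 0"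
    using homogeneous_system[OF _ F lt, of "\<lambda>n y. cf (xi n) y"] F finite_near by blast
  define u where "u = (\<Sum>n\<in>F. c n *\<^sub>c xi n)"
  have cu: "cinner u (xi n) = (if n \<in> F then c n else 0)" for n
    unfolding u_def by (rule orthonormal_cinner_sum[OF ortho F])
  have u0: "u \<noteq> 0" using c(1) cu by (metis cinner_0(1))
  define f where "f = bump L (h ` F)"
  have f: "slow L f" unfolding f_def by (rule slow_bump[OF L(1)])
  have "mult_op f u = 0"
  proof (rule ell2_eqI)
    fix x
    show "cf (mult_op f u) x = cf 0 x"
    proof (cases "x \<in> ?Y")
      case True
        then have "cf u x = 0" using c(2) by (simp only: u_def cf_sum cf_simps)
        then show ?thesis by (simp add: cf_mult_op[OF f])
    next
      case False
      then have "f x = 0" using bump_nonzero[OF L(1), of "h ` F" x] ne by (fastforce simp: f_def)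
      then show ?thesis by (simp add: cf_mult_op[OF f])
    qed
  qed
  then have Du: "norm (mean_op f u) \<le> e * norm u"
    using slow_diag_app[OF L(2)[OF f], of u] by simp
  have "norm u \<le> 1 / d^2 * norm (mean_op f u)"
  proof (rule norm_le_coeff)
    fix n
    show "cmod (cinner u (xi n)) \<le> 1 / d^2 * cmod (cinner (mean_op f u) (xi n))"
    proof (cases "n \<in> F")
      case True
      have "d^2 \<le> (cmod (cf (xi n) (h n)))^2" using peak d_pos by (intro power_mono) auto
      also have "\<dots> \<le> mean f n" using mean_ge[OF f, of "h n" n] True by (simp add: f_def bump_eq_1)
      finally have *: "d^2 \<le> mean f n" .
      have "cmod (cinner u (xi n)) * d^2 \<le> cmod (cinner u (xi n)) * mean f n" by (intro mult_left_mono *) auto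
      then have "cmod (cinner u (xi n)) \<le> mean f n * cmod (cinner u (xi n)) / d^2"
        using d_pos by (simp add: field_simps)
      then show ?thesis using mean_nonneg[OF f, of n] by (simp add: cinner_mean_op[OF f] norm_mult)
    qed (simp add: cu)
  qed (use d_pos in auto)
  also have "\<dots> \<le> 1 / d^2 * (e * norm u)" by (intro mult_left_mono Du) auto
  finally have "d^2 * norm u \<le> e * norm u" using d_pos by (simp add: field_simps)
  then show False using e u0 by simp
qed

text \<open>Let F be the indices where the cut-off around G has mean at least 1/2; by concentration
  their peaks are near G. If F were smaller than G, some nonzero u supported on G would be
  orthogonal to these \<open>xi n\<close>. The cut-off fixes u while its diagonal model at least
  halves it, too much for an error of 1/4.\<close>

lemma hall_backward:
  assumes G: "finite G" and e: "e / d < 1/2" "e \<le> 1/4"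
  shows "card G \<le> card (\<Union>x\<in>G. {n. dist x (h n) \<le> L})"
proof (cases "G = {}")
  case False
  define f where "f = bump L G"
  have f: "slow L f" unfolding f_def by (rule slow_bump[OF L(1)])
  define F where "F = {n. 1/2 \<le> mean f n}"
  have sub: "F \<subseteq> (\<Union>x\<in>G. {n. dist x (h n) \<le> L})"
  proof (rule subsetI, rule ccontr)
    fix n assume n: "n \<in> F" "n \<notin> (\<Union>x\<in>G. {n. dist x (h n) \<le> L})"
    have b: "slow L (bump L {h n})" by (rule slow_bump[OF L(1)])
    have "mean f n + mean (bump L {h n}) n \<le> 1"
      by (rule mean_add_le[OF f b]) (unfold f_def, rule bump_sum_le[OF L(1) False], use n in force)
    moreover have "1 - e / d \<le> mean (bump L {h n}) n" by (rule mean_bump_peak[OF L(1) L(2)[OF b]])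
    ultimately show False using n(1) e(1) by (simp add: F_def)
  qed
  have finU: "finite (\<Union>x\<in>G. {n. dist x (h n) \<le> L})" using G finite_near by blast
  have finF: "finite F" using sub finU by (rule finite_subset)
  have "card G \<le> card F"
  proof (rule ccontr)
    assume "\<not> ?thesis"
    then have lt: "card F < card G" by simp
    obtain c where c: "\<exists>x\<in>G. c x \<noteq> 0" "\<forall>n\<in>F. (\<Sum>x\<in>G. c x * cinner (ket x) (xi n)) = 0"
      using homogeneous_system[OF finF G lt, of "\<lambda>x n. cinner (ket x) (xi n)"] by blast
    define u where "u = (\<Sum>x\<in>G. c x *\<^sub>c ket x)"
    have cu: "cf u x = (if x \<in> G then c x else 0)" for x
      using orthonormal_cinner_sum[OF orthonormal_ket G, of c x] by (simp add: u_def)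
    have u0: "norm u > 0" using c(1) cu by (metis cf_simps(1) zero_less_norm_iff)
    have z: "cinner u (xi n) = 0" if "n \<in> F" for n
      using c(2) that by (simp add: u_def cinner_sum_left)
    have "mult_op f u = u"
      by (rule ell2_eqI) (simp add: cf_mult_op[OF f] cu, simp add: f_def bump_eq_1)
    then have "norm (u - mean_op f u) \<le> e * norm u"
      using slow_diag_app[OF L(2)[OF f], of u] by simp
    also have "\<dots> \<le> 1/4 * norm u" by (intro mult_right_mono e(2)) auto
    finally have 1: "norm (u - mean_op f u) \<le> 1/4 * norm u" .
    have 2: "norm (mean_op f u) \<le> 1/2 * norm u"
    proof (rule norm_le_coeff)
      fix n
      show "cmod (cinner (mean_op f u) (xi n)) \<le> 1/2 * cmod (cinner u (xi n))"
      proof (cases "n \<in> F")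
        case True then show ?thesis by (simp add: cinner_mean_op[OF f] z)
      next
        case False
        then have "mean f n \<le> 1/2" by (simp add: F_def)
        then have "mean f n * cmod (cinner u (xi n)) \<le> 1/2 * cmod (cinner u (xi n))" by (intro mult_right_mono) auto
        then show ?thesis using mean_nonneg[OF f, of n] by (simp add: cinner_mean_op[OF f] norm_mult)
      qed
    qed simp
    have "norm u \<le> norm (u - mean_op f u) + norm (mean_op f u)" using norm_triangle_ineq[of "u - mean_op f u" "mean_op f u"] by simp
    then show False using 1 2 u0 by simp
  qed
  also have "\<dots> \<le> card (\<Union>x\<in>G. {n. dist x (h n) \<le> L})" by (rule card_mono[OF finU sub])
  finally show ?thesis .
qed simp

end

lemma bijection_near: "\<exists>g L. bij g \<and> (\<forall>n. dist (g n) (h n) \<le> L)"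
proof -
  \<comment> \<open>As d \<le> 1, this satisfies the demands of both Hall conditions: e < d^2, e / d
    = d / 4 < 1/2 and e \<le> 1/4.\<close>
  define e where "e = d^2 / 4"
  have e: "0 < e" "e < d^2" "e / d < 1/2" "e \<le> 1/4" using d_pos d_le_1
    by (auto simp: e_def power2_eq_square field_simps mult_le_one)
  obtain L where L: "L > 0" "\<And>f. slow L f \<Longrightarrow> norm (mult_op f - mean_op f) \<le> e" using slow_diag[OF e(1)] by blast
  obtain \<alpha> where \<alpha>: "inj \<alpha>" "\<And>n. dist (\<alpha> n) (h n) \<le> L"
    using hall_infinite[OF finite_near(1) hall_forward[OF L _ e(2)]] by auto
  obtain \<beta> where \<beta>: "inj \<beta>" "\<And>x. dist x (h (\<beta> x)) \<le> L"
    using hall_infinite[OF finite_near(2) hall_backward[OF L _ e(3,4)]] by auto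
  show ?thesis using bij_of_two_injections[OF \<alpha>(1) \<beta>(1), of "\<lambda>n x. dist x (h n) \<le> L"] \<alpha> \<beta> by blast
qed

end

subsection \<open>The unitary lies in the uniform Roe algebra\<close>

lemma onb_reindex:
  assumes "onb b" "bij g" shows "onb (\<lambda>n. b (g n))"
proof -
  interpret onb b by fact
  show ?thesis
  proof
    show "orthonormal (\<lambda>n. b (g n))"
      using assms(2) by (auto simp: orthonormal_def cinner_b bij_def inj_def)
    fix u
    show "((\<lambda>i. (cmod (cinner u (b (g i))))^2) has_sum (norm u)^2) UNIV"
      using has_sum_reindex_bij_betw[of g UNIV UNIV "\<lambda>i. (cmod (cinner u (b i)))^2"] parseval[of u] assms(2) by simp
  qed
qed

context roe_peaks
begin

lemma uroe_sum:
  assumes "finite I" "\<And>i. i \<in> I \<Longrightarrow> \<exists>M\<in>uroe. opr M = (T i :: 'a ell2 \<Rightarrow>\<^sub>L 'a ell2)"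
  shows "\<exists>M\<in>uroe. opr M = (\<Sum>i\<in>I. T i)"
  using assms
proof (induction I rule: finite_induct)
  case empty
  then show ?case using cstar_subalgD(2)[OF alg] by (intro bexI[of _ mzero]) simp_all
next
  case (insert i I)
  then obtain M N where "M \<in> uroe" "opr M = (\<Sum>i\<in>I. T i)" "N \<in> uroe" "opr N = T i" by (metis insertCI)
  then show ?case using insert(1,2) cstar_subalgD(3)[OF alg, of N M]
    by (intro bexI[of _ "madd N M"]) (auto simp: opr_madd uroe_bounded)
qed

text \<open>The cut-off f around \<open>h\<close>
  I'\<open>has mean at most e / d at every m in I, because\<close>xi
  m\<open>is concentrated near\<close>h m\<open>, far from\<close>h \<open>I'\<close>. So f u is
  within e * norm u of a vector of norm at most e / d * norm u, and f = 1 on the points summed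
  over.\<close>

lemma separated_block:
  assumes L: "L > 0" "\<And>f. slow L f \<Longrightarrow> norm (mult_op f - mean_op f) \<le> e" and e: "0 \<le> e"
    and I: "finite I'" "\<And>n m. n \<in> I' \<Longrightarrow> m \<in> I \<Longrightarrow> L \<le> dist (h n) (h m)"
    and u: "\<And>n. n \<notin> I \<Longrightarrow> cinner u (xi n) = 0"
  shows "(\<Sum>x\<in>h ` I'. (cmod (cf u x))^2) \<le> ((e + e / d) * norm u)^2"
proof (cases "I' = {}")
  case False
  define f where "f = bump L (h ` I')"
  have f: "slow L f" unfolding f_def by (rule slow_bump[OF L(1)])
  have 1: "norm (mult_op f u - mean_op f u) \<le> e * norm u" by (rule slow_diag_app[OF L(2)[OF f]])
  have 2: "norm (mean_op f u) \<le> e / d * norm u"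
  proof (rule norm_le_coeff)
    fix m
    show "cmod (cinner (mean_op f u) (xi m)) \<le> e / d * cmod (cinner u (xi m))"
    proof (cases "m \<in> I")
      case True
      have b: "slow L (bump L {h m})" by (rule slow_bump[OF L(1)])
      have "mean f m + mean (bump L {h m}) m \<le> 1"
        by (rule mean_add_le[OF f b]) (unfold f_def, rule bump_sum_le[OF L(1)], use False I(2) True in auto)
      moreover have "1 - e / d \<le> mean (bump L {h m}) m" by (rule mean_bump_peak[OF L(1) L(2)[OF b]])
      ultimately have "mean f m \<le> e / d" by linarith
      then have "mean f m * cmod (cinner u (xi m)) \<le> e / d * cmod (cinner u (xi m))" by (intro mult_right_mono) auto
      then show ?thesis using mean_nonneg[OF f, of m] by (simp add: cinner_mean_op[OF f] norm_mult)
    qed (simp add: cinner_mean_op[OF f] u)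
  qed (use e d_pos in auto)
  have "norm (mult_op f u) \<le> norm (mult_op f u - mean_op f u) + norm (mean_op f u)"
    using norm_triangle_ineq[of "mult_op f u - mean_op f u" "mean_op f u"] by simp
  then have 3: "norm (mult_op f u) \<le> (e + e / d) * norm u" using 1 2 by (simp add: distrib_right)
  have "(\<Sum>x\<in>h ` I'. (cmod (cf u x))^2) = (\<Sum>x\<in>h ` I'. (cmod (cf (mult_op f u) x))^2)"
    by (intro sum.cong refl) (simp add: cf_mult_op[OF f], simp add: f_def bump_eq_1)
  also have "\<dots> \<le> (norm (mult_op f u))^2" using I by (intro ell2_sum_le) auto
  also have "\<dots> \<le> ((e + e / d) * norm u)^2" by (intro power_mono 3) auto
  finally show ?thesis .
qed simp

context
  fixes g :: "nat \<Rightarrow> 'a" and C :: real and V :: "'a ell2 \<Rightarrow>\<^sub>L 'a ell2"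
  assumes g: "bij g" and near: "\<And>n. dist (g n) (h n) \<le> C"
    and clV: "clin V" and V: "\<And>u n. cf (V u) (g n) = cinner u (xi n)"
begin

text \<open>Composed with the spectral projection of a single colour class, this matrix reproduces the
  part of \<^term>\<open>V\<close> on that class up to the off-diagonal entries \<^term>\<open>cf (xi m) (h n)\<close>.\<close>

definition rescale :: "(nat \<Rightarrow> nat) \<Rightarrow> nat \<Rightarrow> 'a mat" where
  "rescale c i = (\<lambda>x y. if c (inv g x) = i \<and> y = h (inv g x) then 1 / cf (xi (inv g x)) (h (inv g x)) else 0)"

lemma peak_nz: "cf (xi n) (h n) \<noteq> 0"
  using peak[of n] d_pos by auto

text \<open>Entries sit at positions (g n, h n), so the propagation is at most C. They are bounded
  by 1 / d; each row has one candidate position, and \<open>fibre_card\<close> bounds the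
  columns.\<close>

lemma rescale_uroe: "rescale c i \<in> uroe"
  and cf_rescale: "cf (opr (rescale c i) u) (g n) = (if c n = i then cf u (h n) / cf (xi n) (h n) else 0)"
proof -
  have ig: "inv g (g n) = n" for n using g by (simp add: bij_def)
  have gi: "g (inv g x) = x" for x using g by (simp add: bij_def surj_f_inv_f)
  define N where "N = max 1 (nat \<lfloor>1 / d^2\<rfloor>)"
  have col: "finite {x. y \<in> {h (inv g x)}} \<and> card {x. y \<in> {h (inv g x)}} \<le> N" for y
  proof -
    have "{x. y \<in> {h (inv g x)}} = g ` {n. h n = y}" using gi ig by (auto simp: image_iff) metis
    moreover have "card (g ` {n. h n = y}) \<le> card {n. h n = y}" by (rule card_image_le) (use fibre_card in blast)
    ultimately show ?thesis using fibre_card[of y] by (auto simp: N_def)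
  qed
  have row: "finite {h (inv g x)} \<and> card {h (inv g x)} \<le> N" for x by (simp add: N_def)
  have le: "cmod (rescale c i x y) \<le> 1 / d" for x y
  proof -
    have "1 / cmod (cf (xi (inv g x)) (h (inv g x))) \<le> 1 / d" using peak[of "inv g x"] d_pos by (intro frac_le) auto
    then show ?thesis using d_pos by (simp add: rescale_def norm_divide)
  qed
  have supp: "y \<notin> {h (inv g x)} \<Longrightarrow> rescale c i x y = 0" for x y by (auto simp: rescale_def)
  have d: "0 \<le> 1 / d" using d_pos by simp
  have S1: "bounded_mat (rescale c i)"
    by (rule schur_bound(1)[where R="\<lambda>x. {h (inv g x)}", OF row col supp le d])
  have S3: "cf (opr (rescale c i) u) x = (\<Sum>y\<in>{h (inv g x)}. rescale c i x y * cf u y)" for u x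
    by (rule schur_bound(3)[where R="\<lambda>x. {h (inv g x)}", OF row col supp le d])
  have "finite_prop (rescale c i)" unfolding finite_prop_def
  proof (intro exI allI impI)
    fix x y :: 'a assume "dist x y > C"
    then show "rescale c i x y = 0" using near[of "inv g x"] by (auto simp: rescale_def gi)
  qed
  then show "rescale c i \<in> uroe" by (rule finite_prop_uroe[OF S1])
  show "cf (opr (rescale c i) u) (g n) = (if c n = i then cf u (h n) / cf (xi n) (h n) else 0)"
    unfolding S3 by (simp add: ig rescale_def)
qed

text \<open>The difference T of V and the sum over colour classes has zero diagonal from
  \<open>xi\<close> to the relabelled point masses. Within a class its entries are peak-normalised
  values of \<open>xi m\<close> at \<open>h n\<close>, which \<open>separated_block\<close> makes
  small as a block; between classes it vanishes.\<close>

lemma approx_uroe: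
  assumes e: "0 < e" shows "\<exists>M\<in>uroe. norm (V - opr M) \<le> e"
proof -
  \<comment> \<open>Since e2 \<le> 2 * e1 / d, the final bound 4 * e2 / d is at most 8 * e1 / d^2 =
    e. The constant is fixed before L and the number of colours are known.\<close>
  define e1 where "e1 = e * d^2 / 8"
  have e1: "0 < e1" using e d_pos by (simp add: e1_def)
  define e2 where "e2 = e1 + e1 / d"
  have e2: "0 \<le> e2" "4 * (e2 / d) \<le> e"
  proof -
    show "0 \<le> e2" using e1 d_pos by (simp add: e2_def)
    have "e1 \<le> e1 / d" using e1 d_le_1 d_pos by (simp add: field_simps)
    then have "e2 \<le> 2 * (e1 / d)" by (simp add: e2_def)
    then have "4 * (e2 / d) \<le> 4 * (2 * (e1 / d) / d)" using d_pos by (intro mult_left_mono divide_right_mono) auto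
    also have "\<dots> = e" using d_pos by (simp add: e1_def power2_eq_square)
    finally show "4 * (e2 / d) \<le> e" .
  qed
  obtain L where L: "L > 0" "\<And>f. slow L f \<Longrightarrow> norm (mult_op f - mean_op f) \<le> e1" using slow_diag[OF e1] by blast
  obtain K where K: "\<And>x. finite {n. dist x (h n) \<le> L} \<and> card {n. dist x (h n) \<le> L} \<le> K" using near_card[of L] by blast
  have "card {m. m < n \<and> dist (h n) (h m) \<le> L} \<le> K" for n
  proof -
    have "card {m. m < n \<and> dist (h n) (h m) \<le> L} \<le> card {m. dist (h n) (h m) \<le> L}"
      by (rule card_mono) (use K in auto)
    then show ?thesis using K[of "h n"] by simp
  qed
  then obtain c where c: "\<And>n. c n \<le> K" "\<And>n m. m < n \<Longrightarrow> dist (h n) (h m) \<le> L \<Longrightarrow> c m \<noteq> (c n :: nat)"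
    using greedy_colouring[of "\<lambda>m n. dist (h n) (h m) \<le> L" K] by blast
  have sep: "L \<le> dist (h m) (h n)" if "m \<noteq> n" "c m = c n" for m n
    using c(2)[of m n] c(2)[of n m] that by (metis dist_commute linorder_le_cases linorder_neqE_nat)
  define z where "z = (\<Sum>i\<le>K. opr (rescale c i) o\<^sub>L opr (q {n. c n = i}))"
  have "\<exists>M\<in>uroe. opr M = z" unfolding z_def
  proof (rule uroe_sum)
    fix i
    show "\<exists>M\<in>uroe. opr M = opr (rescale c i) o\<^sub>L opr (q {n. c n = i})"
      using cstar_subalgD(5)[OF alg rescale_uroe q_uroe] by (metis opr_mmult uroe_bounded rescale_uroe q_uroe)
  qed simp
  then obtain M where M: "M \<in> uroe" "opr M = z" by blast
  define T where "T = V - z"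
  have clT: "clin T" unfolding T_def M(2)[symmetric] by (intro clin_simps clV clin_opr uroe_bounded M)
  have Tmn: "cinner (T (xi m)) (ket (g n)) =
      (if m = n then 1 else 0) - (if c m = c n then cf (xi m) (h n) / cf (xi n) (h n) else 0)" for m n
  proof -
    have qx: "opr (q J) (xi m) = (if m \<in> J then xi m else 0)" for J
      unfolding q_def by (simp add: dg_xi[OF bounded_ind])
    have "cf (z (xi m)) (g n) = (\<Sum>i\<le>K. if c n = i then cf (opr (q {n. c n = i}) (xi m)) (h n) / cf (xi n) (h n) else 0)"
      unfolding z_def by (simp add: blinfun.sum_left cf_rescale)
    also have "\<dots> = cf (opr (q {m. c m = c n}) (xi m)) (h n) / cf (xi n) (h n)" using c(1)[of n] by simp
    also have "\<dots> = (if c m = c n then cf (xi m) (h n) / cf (xi n) (h n) else 0)" by (simp add: qx)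
    finally show ?thesis by (simp add: T_def blinfun.diff_left V cinner_b)
  qed
  have "norm T \<le> 4 * (e2 / d)"
  proof (rule offdiag_norm[OF onb_axioms onb_reindex[OF ket.onb_axioms g] clT])
    show "0 \<le> e2 / d" using e2 d_pos by simp
    show "cinner (T (xi n)) (ket (g n)) = 0" for n unfolding Tmn using peak_nz[of n] by simp
    fix R J :: "nat set" and a w :: "nat \<Rightarrow> complex" assume R: "finite R" and J: "J \<subseteq> R"
    have fJ: "finite J" using J R finite_subset by blast
    let ?U = "\<Sum>n\<in>R. a n *\<^sub>c xi n" and ?W = "\<Sum>m\<in>R. w m *\<^sub>c ket (g m)"
    have nU: "(norm ?U)^2 = (\<Sum>n\<in>R. (cmod (a n))^2)" by (rule orthonormal_norm_sum[OF ortho R])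
    have nW: "(norm ?W)^2 = (\<Sum>n\<in>R. (cmod (w n))^2)"
      by (rule orthonormal_norm_sum[OF onb.ortho[OF onb_reindex[OF ket.onb_axioms g]] R])
    define uJ where "uJ i = (\<Sum>m\<in>{m\<in>J. c m = i}. a m *\<^sub>c xi m)" for i
    have nuJ: "(norm (uJ i))^2 = (\<Sum>m\<in>{m\<in>J. c m = i}. (cmod (a m))^2)" for i
      unfolding uJ_def by (rule orthonormal_norm_sum[OF ortho]) (use fJ in auto)
    define y where "y n = (\<Sum>m\<in>J. a m * cinner (T (xi m)) (ket (g n)))" for n
    have y: "cmod (y n) \<le> cmod (cf (uJ (c n)) (h n)) / d" if "n \<in> R - J" for n
    proof -
      have "y n = (\<Sum>m\<in>J. if c m = c n then - (a m * cf (xi m) (h n) / cf (xi n) (h n)) else 0)"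
        unfolding y_def Tmn using that by (intro sum.cong refl) auto
      also have "\<dots> = - (cf (uJ (c n)) (h n) / cf (xi n) (h n))"
        unfolding uJ_def using fJ by (simp add: sum.inter_filter[symmetric] sum_negf sum_divide_distrib)
      finally have "cmod (y n) = cmod (cf (uJ (c n)) (h n)) / cmod (cf (xi n) (h n))" by (simp add: norm_divide)
      also have "\<dots> \<le> cmod (cf (uJ (c n)) (h n)) / d" using peak[of n] d_pos by (intro divide_left_mono) (auto intro: mult_pos_pos less_le_trans)
      finally show ?thesis .
    qed
    \<comment> \<open>Distinct indices of one colour have peaks at distance at least L > 0. This
      makes h injective on the class and separates the indices in R - J from those in J.\<close>
    have grp: "(\<Sum>n\<in>{n\<in>R-J. c n = i}. (cmod (cf (uJ i) (h n)))^2) \<le> e2^2 * (\<Sum>m\<in>{m\<in>J. c m = i}. (cmod (a m))^2)" for i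
    proof -
      have "inj_on h {n\<in>R-J. c n = i}"
      proof (rule inj_onI, rule ccontr)
        fix m n assume "m \<in> {n\<in>R-J. c n = i}" "n \<in> {n\<in>R-J. c n = i}" "h m = h n" "m \<noteq> n"
        then show False using sep[of m n] L(1) by simp
      qed
      then have "(\<Sum>n\<in>{n\<in>R-J. c n = i}. (cmod (cf (uJ i) (h n)))^2) = (\<Sum>x\<in>h ` {n\<in>R-J. c n = i}. (cmod (cf (uJ i) x))^2)"
        by (simp add: sum.reindex)
      also have "\<dots> \<le> (e2 * norm (uJ i))^2" unfolding e2_def
      proof (rule separated_block[OF L less_imp_le[OF e1]])
        show "finite {n\<in>R-J. c n = i}" using R by simp
        show "L \<le> dist (h n) (h m)" if "n \<in> {n\<in>R-J. c n = i}" "m \<in> {m\<in>J. c m = i}" for n m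
          using sep[of n m] that by auto
        show "cinner (uJ i) (xi n) = 0" if "n \<notin> {m\<in>J. c m = i}" for n
          unfolding uJ_def using that fJ by (subst orthonormal_cinner_sum[OF ortho]) auto
      qed
      finally show ?thesis by (simp add: power_mult_distrib nuJ)
    qed
    have "(\<Sum>n\<in>R-J. (cmod (y n))^2) \<le> (\<Sum>n\<in>R-J. (cmod (cf (uJ (c n)) (h n)) / d)^2)"
      by (intro sum_mono power_mono y) auto
    also have "\<dots> = (\<Sum>n\<in>R-J. (cmod (cf (uJ (c n)) (h n)))^2) / d^2"
      by (simp add: power_divide sum_divide_distrib)
    \<comment> \<open>Colour classes have disjoint inputs and outputs, so squared errors add up to
      e2^2 times the total mass. The number of colours, which grows with L, does not enter the
      bound.\<close>
    also have "(\<Sum>n\<in>R-J. (cmod (cf (uJ (c n)) (h n)))^2) = (\<Sum>i\<le>K. \<Sum>n\<in>{n\<in>R-J. c n = i}. (cmod (cf (uJ (c n)) (h n)))^2)"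
      by (rule sum.group[symmetric]) (use R c(1) in auto)
    also have "\<dots> = (\<Sum>i\<le>K. \<Sum>n\<in>{n\<in>R-J. c n = i}. (cmod (cf (uJ i) (h n)))^2)" by (intro sum.cong refl) auto
    also have "\<dots> \<le> (\<Sum>i\<le>K. e2^2 * (\<Sum>m\<in>{m\<in>J. c m = i}. (cmod (a m))^2))" by (intro sum_mono grp)
    also have "\<dots> = e2^2 * (\<Sum>m\<in>J. (cmod (a m))^2)"
      unfolding sum_distrib_left[symmetric] by (subst sum.group) (use fJ c(1) in auto)
    also have "\<dots> \<le> e2^2 * (norm ?U)^2" unfolding nU using R J by (intro mult_left_mono sum_mono2) auto
    finally have Y: "(\<Sum>n\<in>R-J. (cmod (y n))^2) \<le> (e2 / d * norm ?U)^2"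
      using d_pos by (simp add: power_mult_distrib power_divide divide_right_mono)
    have "(\<Sum>m\<in>J. \<Sum>n\<in>R-J. a m * cnj (w n) * cinner (T (xi m)) (ket (g n))) = (\<Sum>n\<in>R-J. cnj (w n) * y n)"
      unfolding y_def by (subst sum.swap) (simp add: sum_distrib_left mult_ac)
    also have "cmod \<dots> \<le> (\<Sum>n\<in>R-J. cmod (w n) * cmod (y n))" by (rule sum_norm_le) (simp add: norm_mult)
    also have "\<dots> \<le> e2 / d * norm ?U * norm ?W"
    proof (rule power2_le_imp_le)
      have "(\<Sum>n\<in>R-J. cmod (w n) * cmod (y n))^2 \<le> (\<Sum>n\<in>R-J. (cmod (w n))^2) * (\<Sum>n\<in>R-J. (cmod (y n))^2)"
        by (rule Cauchy_Schwarz_ineq_sum)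
      also have "\<dots> \<le> (norm ?W)^2 * (e2 / d * norm ?U)^2"
        unfolding nW using R by (intro mult_mono Y sum_mono2 sum_nonneg) auto
      finally show "(\<Sum>n\<in>R-J. cmod (w n) * cmod (y n))^2 \<le> (e2 / d * norm ?U * norm ?W)^2"
        by (simp only: power_mult_distrib mult_ac)
    qed (use e2 d_pos in auto)
    finally show "cmod (\<Sum>n\<in>J. \<Sum>m\<in>R-J. a n * cnj (w m) * cinner (T (xi n)) (ket (g m))) \<le> e2 / d * norm ?U * norm ?W" .
  qed
  then show ?thesis using M e2(2) by (intro bexI[of _ M]) (auto simp: T_def)
qed

lemma V_uroe: "mat_of V \<in> uroe"
proof (rule cstar_subalg_closed[OF alg bounded_mat_mat_of[OF clV]])
  fix e :: real assume "0 < e"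
  then show "\<exists>N\<in>uroe. norm (opr (mat_of V) - opr N) \<le> e" using approx_uroe clV by simp
qed

end

lemma unitary_exists:
  "\<exists>g V. bij g \<and> clin V \<and> (\<forall>u n. cf (blinfun_apply V u) (g n) = cinner u (xi n)) \<and> mat_of V \<in> uroe"
proof -
  obtain g C where g: "bij g" "\<And>n. dist (g n) (h n) \<le> C" using bijection_near by blast
  have "\<exists>V. clin V \<and> norm V \<le> 1 \<and> (\<forall>u x. cf (blinfun_apply V u) x = cinner u (xi (inv g x)))"
  proof (rule clin_operator_exists)
    fix u :: "'a ell2" and G :: "'a set" assume G: "finite G"
    have "inj_on (inv g) G" using g(1) by (metis bij_imp_bij_inv bij_is_inj inj_on_subset subset_UNIV)
    then have "(\<Sum>x\<in>G. (cmod (cinner u (xi (inv g x))))^2) = (\<Sum>n\<in>inv g ` G. (cmod (cinner u (xi n)))^2)"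
      by (simp add: sum.reindex)
    also have "\<dots> \<le> (norm u)^2" using G by (intro bessel[OF ortho]) auto
    finally show "(\<Sum>x\<in>G. (cmod (cinner u (xi (inv g x))))^2) \<le> (1 * norm u)^2" by simp
  qed (auto simp: cinner_add_left)
  then obtain V where V: "clin V" "\<And>u x. cf (blinfun_apply V u) x = cinner u (xi (inv g x))" by blast
  have "cf (V u) (g n) = cinner u (xi n)" for u n using V(2) g(1) by (simp add: bij_def)
  then show ?thesis using V_uroe[OF g V(1)] g V(1) by blast
qed

end

subsection \<open>Existence of peaks\<close>

text \<open>For random signs the \<^term>\<open>k\<close> largest coordinates carry little mass: values below \<^term>\<open>t\<close>
  contribute at most \<^term>\<open>real k * t\<close>, and the larger ones are controlled by the fourth moment.\<close>

lemma sparse_signs_bound: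
  fixes a :: "'m \<Rightarrow> 'a \<Rightarrow> complex"
  assumes Q: "finite Q" and P: "finite P" and t: "0 < t"
    and sparse: "\<And>D. D \<subseteq> Q \<Longrightarrow> \<exists>S\<subseteq>P. card S \<le> k \<and> (\<Sum>m\<in>P-S. (cmod (\<Sum>x\<in>Q. rsign D x * a m x))^2) \<le> r"
    and small: "\<And>m. m \<in> P \<Longrightarrow> (\<Sum>x\<in>Q. (cmod (a m x))^2) \<le> s"
    and tot: "(\<Sum>m\<in>P. \<Sum>x\<in>Q. (cmod (a m x))^2) \<le> 1" and s: "0 \<le> s"
  shows "(\<Sum>m\<in>P. \<Sum>x\<in>Q. (cmod (a m x))^2) \<le> r + real k * t + 6 * s / t"
proof -
  let ?V = "\<lambda>D m. cmod (\<Sum>x\<in>Q. rsign D x * a m x)" and ?\<sigma> = "\<lambda>m. \<Sum>x\<in>Q. (cmod (a m x))^2"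
  have "(\<Sum>m\<in>P. (?V D m)^2) \<le> r + real k * t + (\<Sum>m\<in>P. (?V D m)^4) / t" if D: "D \<subseteq> Q" for D
  proof -
    obtain S where S: "S \<subseteq> P" "card S \<le> k" "(\<Sum>m\<in>P-S. (?V D m)^2) \<le> r" using sparse[OF D] by blast
    \<comment> \<open>With y = \<open>(?V D m)^2\<close>, either y \<le> t or y \<le> y^2 /
      t.\<close>
    have p: "(?V D m)^2 \<le> t + (?V D m)^4 / t" for m
    proof (cases "(?V D m)^2 \<le> t")
      case True then show ?thesis using t by (simp add: add_increasing2)
    next
      case False
      then have "t * (?V D m)^2 \<le> (?V D m)^2 * (?V D m)^2" by (intro mult_right_mono) auto
      then have "(?V D m)^2 \<le> (?V D m)^4 / t" using t by (simp add: field_simps power2_eq_square power4_eq_xxxx)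
      then show ?thesis using t by linarith
    qed
    have "(\<Sum>m\<in>S. (?V D m)^2) \<le> (\<Sum>m\<in>S. t + (?V D m)^4 / t)" by (rule sum_mono[OF p])
    also have "\<dots> = real (card S) * t + (\<Sum>m\<in>S. (?V D m)^4) / t" by (simp add: sum.distrib sum_divide_distrib)
    also have "\<dots> \<le> real k * t + (\<Sum>m\<in>P. (?V D m)^4) / t"
      using S t P by (intro add_mono mult_right_mono divide_right_mono sum_mono2) auto
    finally have "(\<Sum>m\<in>S. (?V D m)^2) \<le> real k * t + (\<Sum>m\<in>P. (?V D m)^4) / t" .
    moreover have "(\<Sum>m\<in>P. (?V D m)^2) = (\<Sum>m\<in>P-S. (?V D m)^2) + (\<Sum>m\<in>S. (?V D m)^2)"
      by (rule sum.subset_diff[OF S(1) P])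
    ultimately show ?thesis using S(3) by linarith
  qed
  then have "(\<Sum>D\<in>Pow Q. \<Sum>m\<in>P. (?V D m)^2) \<le> (\<Sum>D\<in>Pow Q. r + real k * t + (\<Sum>m\<in>P. (?V D m)^4) / t)"
    by (intro sum_mono) auto
  also have "\<dots> = 2 ^ card Q * (r + real k * t) + (\<Sum>m\<in>P. \<Sum>D\<in>Pow Q. (?V D m)^4) / t"
    using Q by (simp add: sum.distrib sum_divide_distrib[symmetric] card_Pow sum.swap[of _ P])
  also have "(\<Sum>D\<in>Pow Q. \<Sum>m\<in>P. (?V D m)^2) = (\<Sum>m\<in>P. \<Sum>D\<in>Pow Q. (?V D m)^2)" by (rule sum.swap)
  also have "\<dots> = 2 ^ card Q * (\<Sum>m\<in>P. ?\<sigma> m)" by (simp add: rademacher_complex(1)[OF Q] sum_distrib_left)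
  finally have 1: "2 ^ card Q * (\<Sum>m\<in>P. ?\<sigma> m) \<le> 2 ^ card Q * (r + real k * t) + (\<Sum>m\<in>P. \<Sum>D\<in>Pow Q. (?V D m)^4) / t" .
  \<comment> \<open>The fourth moment is controlled by the square of the variance, one factor of
    which is at most s; the remaining variances sum to at most 1.\<close>
  have "(\<Sum>m\<in>P. \<Sum>D\<in>Pow Q. (?V D m)^4) \<le> (\<Sum>m\<in>P. 6 * 2 ^ card Q * (s * ?\<sigma> m))"
  proof (rule sum_mono)
    fix m assume m: "m \<in> P"
    have "(\<Sum>D\<in>Pow Q. (?V D m)^4) \<le> 6 * 2 ^ card Q * (?\<sigma> m)^2" by (rule rademacher_complex(2)[OF Q])
    also have "\<dots> \<le> 6 * 2 ^ card Q * (s * ?\<sigma> m)"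
      using small[OF m] by (intro mult_left_mono) (auto simp: power2_eq_square intro!: mult_right_mono sum_nonneg)
    finally show "(\<Sum>D\<in>Pow Q. (?V D m)^4) \<le> 6 * 2 ^ card Q * (s * ?\<sigma> m)" .
  qed
  also have "\<dots> = 6 * 2 ^ card Q * s * (\<Sum>m\<in>P. ?\<sigma> m)" by (simp add: sum_distrib_left mult_ac)
  also have "\<dots> \<le> 6 * 2 ^ card Q * s * 1" using tot s by (intro mult_left_mono) auto
  finally have "(\<Sum>m\<in>P. \<Sum>D\<in>Pow Q. (?V D m)^4) / t \<le> 6 * 2 ^ card Q * s / t" using t by (simp add: divide_right_mono)
  with 1 have "2 ^ card Q * (\<Sum>m\<in>P. ?\<sigma> m) \<le> 2 ^ card Q * (r + real k * t + 6 * s / t)" by (simp add: algebra_simps)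
  then show ?thesis by simp
qed

lemma ell2_norm_mono:
  assumes "\<And>x. cmod (cf v x) \<le> K * cmod (cf u x)" "0 \<le> K"
  shows "norm v \<le> K * norm u"
proof (rule ell2_norm_leI)
  fix F :: "'a set" assume F: "finite F"
  have "(\<Sum>x\<in>F. (cmod (cf v x))^2) \<le> (\<Sum>x\<in>F. (K * cmod (cf u x))^2)" by (intro sum_mono power_mono assms) auto
  also have "\<dots> = K^2 * (\<Sum>x\<in>F. (cmod (cf u x))^2)" by (simp add: power_mult_distrib sum_distrib_left)
  also have "\<dots> \<le> K^2 * (norm u)^2" by (intro mult_left_mono ell2_sum_le F) auto
  finally show "(\<Sum>x\<in>F. (cmod (cf v x))^2) \<le> (K * norm u)^2" by (simp add: power_mult_distrib)
qed (use assms in auto)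

section \<open>Random signs and the proof that peaks exist\<close>

definition sign_op :: "'a set \<Rightarrow> 'a ell2 \<Rightarrow>\<^sub>L 'a ell2" where
  "sign_op D = opr (diagm (\<lambda>x. of_real (rsign D x)))"

lemma cmod_rsign: "cmod (of_real (rsign D x)) \<le> 1"
  by (simp add: rsign_def)

lemma cf_sign_op: "cf (sign_op D u) x = of_real (rsign D x) * cf u x"
  unfolding sign_op_def by (rule cf_diagm[OF cmod_rsign])

lemma norm_sign_op_le: "norm (sign_op D u) \<le> norm u"
  using ell2_norm_mono[of "sign_op D u" 1 u] by (simp add: cf_sign_op norm_mult rsign_def)

definition restr :: "'a set \<Rightarrow> 'a ell2 \<Rightarrow> 'a ell2" where
  "restr Q u = (\<Sum>x\<in>Q. cf u x *\<^sub>c ket x)"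

lemma cf_restr: "finite Q \<Longrightarrow> cf (restr Q u) x = (if x \<in> Q then cf u x else 0)"
  using orthonormal_cinner_sum[OF orthonormal_ket, of Q "cf u" x] by (simp add: restr_def)

lemma restr_approx: "0 < e \<Longrightarrow> \<exists>Q. finite Q \<and> norm (u - restr Q u) \<le> e"
  using onb_finite_approx[OF ket.onb_axioms, of e u] by (simp add: restr_def)

text \<open>Off Q the signs differ by at most 2 and u has norm at most e / 3 there, which leaves a
  strict inequality. As with \<open>q\<close>, the finite set depends on the vector.\<close>

lemma sign_op_continuous:
  assumes "0 < e"
  shows "\<exists>Q. finite Q \<and> (\<forall>D'. D' \<inter> Q = D \<inter> Q \<longrightarrow> norm (sign_op D' u - sign_op D u) < e)"
proof -
  obtain Q where Q: "finite Q" "norm (u - restr Q u) \<le> e / 3" using restr_approx[of "e/3" u] assms by auto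
  have "norm (sign_op D' u - sign_op D u) < e" if "D' \<inter> Q = D \<inter> Q" for D'
  proof -
    have "norm (sign_op D' u - sign_op D u) \<le> 2 * norm (u - restr Q u)"
    proof (rule ell2_norm_mono)
      fix x
      have "x \<in> Q \<Longrightarrow> x \<in> D' \<longleftrightarrow> x \<in> D" using that by blast
      then show "cmod (cf (sign_op D' u - sign_op D u) x) \<le> 2 * cmod (cf (u - restr Q u) x)"
        by (cases "x \<in> Q") (auto simp: cf_sign_op cf_restr[OF Q(1)] rsign_def)
    qed simp
    then show ?thesis using Q(2) assms by linarith
  qed
  then show ?thesis using Q(1) by blast
qed

context roe_basis
begin

text \<open>Up to mass 1/16, every column of the sign operator in the basis \<open>xi\<close> lives
  on k entries. Testing on finite P with S inside P makes this a closed condition on D: a violation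
  involves one vector and finitely many strict inequalities.\<close>

definition sparse_under_signs :: "nat \<Rightarrow> 'a set \<Rightarrow> bool" where
  "sparse_under_signs k D \<longleftrightarrow> (\<forall>n P. finite P \<longrightarrow>
    (\<exists>S\<subseteq>P. card S \<le> k \<and> (\<Sum>m\<in>P-S. (cmod (cinner (sign_op D (xi n)) (xi m)))^2) \<le> 1/16))"

text \<open>The hypothesis gives some k for each sign pattern separately; Baire category makes it
  uniform on a cylinder. A violation at (n, P) survives small changes of the vector
  \<open>sign_op D (xi n)\<close>, hence all changes of D off a finite set.\<close>

lemma uniform_sparse:
  assumes sparse: "\<And>M e. M \<in> uroe \<Longrightarrow> 0 < e \<Longrightarrow> \<exists>k. \<forall>n. \<exists>S. finite S \<and> card S \<le> k \<and>
      (\<forall>P. finite P \<longrightarrow> (\<Sum>m\<in>P-S. (cmod (cinner (opr M (xi n)) (xi m)))^2) \<le> e^2)"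
  shows "\<exists>k Q0 D0. finite Q0 \<and> (\<forall>D. D \<inter> Q0 = D0 \<inter> Q0 \<longrightarrow> sparse_under_signs k D)"
proof (rule baire_cylinder)
    fix D :: "'a set"
    have "diagm (\<lambda>x. of_real (rsign D x)) \<in> uroe" by (rule diagm_uroe[OF cmod_rsign])
    from sparse[OF this, of "1/4"] obtain k where k: "\<And>n. \<exists>S. finite S \<and> card S \<le> k \<and>
      (\<forall>P. finite P \<longrightarrow> (\<Sum>m\<in>P-S. (cmod (cinner (sign_op D (xi n)) (xi m)))^2) \<le> (1/4)^2)" unfolding sign_op_def by auto
    have "\<exists>S\<subseteq>P. card S \<le> k \<and> (\<Sum>m\<in>P-S. (cmod (cinner (sign_op D (xi n)) (xi m)))^2) \<le> 1/16" if P: "finite P" for n P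
    proof -
      obtain S where S: "finite S" "card S \<le> k" "\<And>P. finite P \<Longrightarrow> (\<Sum>m\<in>P-S. (cmod (cinner (sign_op D (xi n)) (xi m)))^2) \<le> (1/4)^2"
        using k[of n] by blast
      have "card (P \<inter> S) \<le> k" using S card_mono[of S "P \<inter> S"] by auto
      moreover have "P - P \<inter> S = P - S" by blast
      ultimately show ?thesis using S(3)[OF P] by (intro exI[of _ "P \<inter> S"]) (simp add: power2_eq_square)
    qed
    then show "\<exists>k. sparse_under_signs k D" unfolding sparse_under_signs_def by blast
  next
    fix k D assume "\<not> sparse_under_signs k D"
    then obtain n P where P: "finite P" and bad: "\<And>S. S \<subseteq> P \<Longrightarrow> card S \<le> k \<Longrightarrow>
        1/16 < (\<Sum>m\<in>P-S. (cmod (cinner (sign_op D (xi n)) (xi m)))^2)"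
      unfolding sparse_under_signs_def by (meson not_le)
    let ?v = "sign_op D (xi n)"
    have "\<forall>\<^sub>F v in nhds ?v. \<forall>S\<in>{S. S \<subseteq> P \<and> card S \<le> k}. 1/16 < (\<Sum>m\<in>P-S. (cmod (cinner v (xi m)))^2)"
    proof (rule eventually_ball_finite)
      show "finite {S. S \<subseteq> P \<and> card S \<le> k}" using P by (simp add: finite_subset[OF _ finite_Pow_iff[THEN iffD2]])
      show "\<forall>S\<in>{S. S \<subseteq> P \<and> card S \<le> k}. \<forall>\<^sub>F v in nhds ?v. 1/16 < (\<Sum>m\<in>P-S. (cmod (cinner v (xi m)))^2)"
      proof
        fix S assume "S \<in> {S. S \<subseteq> P \<and> card S \<le> k}"
        have "((\<lambda>v. \<Sum>m\<in>P-S. (cmod (cinner v (xi m)))^2) \<longlongrightarrow> (\<Sum>m\<in>P-S. (cmod (cinner ?v (xi m)))^2)) (nhds ?v)"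
          by (intro tendsto_intros bounded_linear.tendsto[OF bounded_linear_cinner] tendsto_ident_at filterlim_ident)
        then show "\<forall>\<^sub>F v in nhds ?v. 1/16 < (\<Sum>m\<in>P-S. (cmod (cinner v (xi m)))^2)"
          by (rule order_tendstoD(1)) (use bad \<open>S \<in> _\<close> in auto)
      qed
    qed
    then obtain \<gamma> where \<gamma>: "\<gamma> > 0" "\<And>v. dist v ?v < \<gamma> \<Longrightarrow> \<forall>S\<in>{S. S \<subseteq> P \<and> card S \<le> k}. 1/16 < (\<Sum>m\<in>P-S. (cmod (cinner v (xi m)))^2)"
      unfolding eventually_nhds_metric by blast
    obtain Q where Q: "finite Q" "\<And>D'. D' \<inter> Q = D \<inter> Q \<Longrightarrow> norm (sign_op D' (xi n) - ?v) < \<gamma>"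
      using sign_op_continuous[OF \<gamma>(1), of D "xi n"] by blast
    have "\<not> sparse_under_signs k D'" if "D' \<inter> Q = D \<inter> Q" for D'
    proof
      assume "sparse_under_signs k D'"
      then obtain S where S: "S \<subseteq> P" "card S \<le> k" "(\<Sum>m\<in>P-S. (cmod (cinner (sign_op D' (xi n)) (xi m)))^2) \<le> 1/16"
        using P unfolding sparse_under_signs_def by blast
      have "1/16 < (\<Sum>m\<in>P-S. (cmod (cinner (sign_op D' (xi n)) (xi m)))^2)"
        using \<gamma>(2)[of "sign_op D' (xi n)"] Q(2)[OF that] S(1,2) by (simp add: dist_norm)
      then show False using S(3) by simp
    qed
    then show "\<exists>P. finite P \<and> (\<forall>J'. J' \<inter> P = D \<inter> P \<longrightarrow> \<not> sparse_under_signs k J')" using Q(1) by blast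
qed

text \<open>If all coordinates of \<open>xi n\<close> are small, each random sum
  \<open>cinner (sign_op D psi) (xi m)\<close> has small variance, while these variances add up to
  nearly the squared norm of psi. Typical signs then spread the vector over many indices m, against
  sparsity. Numerically, a total of at most 1/2 meets a total above 0.7.\<close>

lemma peaks_exist:
  assumes Q0: "finite Q0" and spQ: "\<And>D. D \<inter> Q0 = D0 \<inter> Q0 \<Longrightarrow> sparse_under_signs k D"
  shows "\<exists>d>0. \<forall>n. \<exists>x. d \<le> cmod (cf (xi n) x)"
proof (rule ccontr)
  assume "\<not> ?thesis"
  then have small: "\<exists>n. \<forall>x. cmod (cf (xi n) x) < d" if "0 < d" for d using that by (meson not_le)
  \<comment> \<open>The first bound serves 6 * dd / t = 48 * (k + 1) * dd \<le> 1/8 for the later t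
    = 1 / (8 * (k + 1)); the second keeps the mass of \<open>xi n\<close> on Q0 below
    (1/16)^2.\<close>
  define dd where "dd = min (1 / (384 * (real k + 1))) (1 / (256 * (real (card Q0) + 1)))"
  have dd: "0 < dd" "48 * (real k + 1) * dd \<le> 1/8" "real (card Q0) * dd \<le> 1/256"
  proof -
    have k: "real k + 1 > 0" "real (card Q0) + 1 > 0" by simp_all
    have c: "48 * A * (1 / (384 * A)) = 1/8" "A * (1 / (256 * A)) = 1/256" if "A > 0" for A :: real
      using that by (simp_all add: field_simps)
    show "0 < dd" using k by (simp add: dd_def)
    have "48 * (real k + 1) * dd \<le> 48 * (real k + 1) * (1 / (384 * (real k + 1)))"
      by (intro mult_left_mono) (auto simp: dd_def)
    then show "48 * (real k + 1) * dd \<le> 1/8" unfolding c(1)[OF k(1)] .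
    have "real (card Q0) * dd \<le> (real (card Q0) + 1) * (1 / (256 * (real (card Q0) + 1)))"
      using \<open>0 < dd\<close> by (intro mult_mono) (auto simp: dd_def)
    then show "real (card Q0) * dd \<le> 1/256" unfolding c(2)[OF k(2)] .
  qed
  obtain n where n: "\<And>x. cmod (cf (xi n) x) < sqrt dd" using small[of "sqrt dd"] dd(1) by auto
  have n2: "(cmod (cf (xi n) x))^2 \<le> dd" for x
    using power_mono[OF less_imp_le[OF n[of x]], of 2] dd(1) by simp
  obtain Q1 where Q1: "finite Q1" "norm (xi n - restr Q1 (xi n)) \<le> 1/16" using restr_approx[of "1/16" "xi n"] by auto
  \<comment> \<open>On Q0 the signs are frozen to D0, so only coordinates outside Q0 can be
    randomised. Dropping Q0 and truncating to Q1 cost 1/16 each.\<close>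
  define Q where "Q = Q1 - Q0"
  have Q: "finite Q" using Q1 by (simp add: Q_def)
  define psi where "psi = restr Q (xi n)"
  have cpsi: "cf psi x = (if x \<in> Q then cf (xi n) x else 0)" for x unfolding psi_def by (rule cf_restr[OF Q])
  have npsi: "norm (xi n - psi) \<le> 1/8"
  proof -
    have "norm (restr (Q1 \<inter> Q0) (xi n)) \<le> 1/16"
    proof (rule ell2_norm_leI)
      fix F :: "'a set" assume "finite F"
      have fin: "finite (Q1 \<inter> Q0)" using Q0 by simp
      have "(\<Sum>x\<in>F. (cmod (cf (restr (Q1 \<inter> Q0) (xi n)) x))^2) = (\<Sum>x\<in>F \<inter> Q0. (cmod (cf (restr (Q1 \<inter> Q0) (xi n)) x))^2)"
        by (rule sum.mono_neutral_right) (use \<open>finite F\<close> in \<open>auto simp: cf_restr[OF fin]\<close>)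
      also have "\<dots> \<le> (\<Sum>x\<in>F \<inter> Q0. dd)" by (rule sum_mono) (use n2 dd(1) in \<open>auto simp: cf_restr[OF fin]\<close>)
      also have "\<dots> = real (card (F \<inter> Q0)) * dd" by simp
      also have "\<dots> \<le> real (card Q0) * dd" using Q0 dd(1) by (intro mult_right_mono) (auto intro: card_mono)
      finally show "(\<Sum>x\<in>F. (cmod (cf (restr (Q1 \<inter> Q0) (xi n)) x))^2) \<le> (1/16)^2" using dd(3) by (simp add: power2_eq_square)
    qed simp
    moreover have "xi n - psi = (xi n - restr Q1 (xi n)) + restr (Q1 \<inter> Q0) (xi n)"
      using Q0 by (intro ell2_eqI) (auto simp: cpsi cf_restr[OF Q1(1)] cf_restr[of "Q1 \<inter> Q0"] Q_def)
    ultimately show ?thesis using norm_triangle_ineq[of "xi n - restr Q1 (xi n)" "restr (Q1 \<inter> Q0) (xi n)"] Q1(2)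
      by (simp only:)
  qed
  \<comment> \<open>Parseval for each \<open>ket x\<close>: finitely many m capture all but (1/4)^2
    = 1/16 of its unit mass, and Q is finite.\<close>
  have "\<exists>P. finite P \<and> (\<forall>x\<in>Q. 15/16 \<le> (\<Sum>m\<in>P. (cmod (cf (xi m) x))^2))"
  proof -
    have "\<exists>P. finite P \<and> 15/16 \<le> (\<Sum>m\<in>P. (cmod (cf (xi m) x))^2)" for x
    proof -
      obtain P where P: "finite P" "norm (ket x - (\<Sum>i\<in>P. cinner (ket x) (xi i) *\<^sub>c xi i)) \<le> 1/4"
        using onb_finite_approx[OF onb_axioms, of "1/4" "ket x"] by auto
      have "(norm (ket x - (\<Sum>i\<in>P. cinner (ket x) (xi i) *\<^sub>c xi i)))^2 \<le> (1/4)^2" by (intro power_mono P) auto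
      then show ?thesis using orthonormal_residual[OF ortho P(1), of "ket x"] P(1)
        by (intro exI[of _ P]) (simp add: power2_eq_square)
    qed
    then obtain p where p: "\<And>x. finite (p x)" "\<And>x. 15/16 \<le> (\<Sum>m\<in>p x. (cmod (cf (xi m) x))^2)" by metis
    have fU: "finite (\<Union>x\<in>Q. p x)" using Q p(1) by blast
    have "15/16 \<le> (\<Sum>m\<in>(\<Union>x\<in>Q. p x). (cmod (cf (xi m) x))^2)" if "x \<in> Q" for x
      using p(2)[of x] sum_mono2[OF fU, of "p x" "\<lambda>m. (cmod (cf (xi m) x))^2"] that by fastforce
    then show ?thesis using fU by blast
  qed
  then obtain P where P: "finite P" "\<And>x. x \<in> Q \<Longrightarrow> 15/16 \<le> (\<Sum>m\<in>P. (cmod (cf (xi m) x))^2)" by blast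
  define a where "a m x = cf (xi n) x * cnj (cf (xi m) x)" for m x
  have a2: "(cmod (a m x))^2 = (cmod (cf (xi n) x))^2 * (cmod (cf (xi m) x))^2" for m x
    by (simp add: a_def norm_mult power_mult_distrib)
  have sp: "(\<Sum>x\<in>Q. (cmod (cf (xi n) x))^2) = (norm psi)^2"
    unfolding psi_def restr_def by (rule orthonormal_norm_sum[OF orthonormal_ket Q, symmetric])
  have bx: "(\<Sum>m\<in>P. (cmod (cf (xi m) x))^2) \<le> 1" for x using bessel[OF ortho P(1), of "ket x"] by simp
  have swap: "(\<Sum>m\<in>P. \<Sum>x\<in>Q. (cmod (a m x))^2) = (\<Sum>x\<in>Q. (cmod (cf (xi n) x))^2 * (\<Sum>m\<in>P. (cmod (cf (xi m) x))^2))"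
    by (subst sum.swap) (simp add: a2 sum_distrib_left)
  define t where "t = 1 / (8 * (real k + 1))"
  have t: "0 < t" "real k * t \<le> 1/8" by (auto simp: t_def field_simps)
  have "(\<Sum>m\<in>P. \<Sum>x\<in>Q. (cmod (a m x))^2) \<le> 1/4 + real k * t + 6 * dd / t"
  proof (rule sparse_signs_bound[OF Q P(1) t(1)])
    fix D assume D: "D \<subseteq> Q"
    \<comment> \<open>Extends a sign pattern on Q by the prescribed one on Q0, which puts it into
      the cylinder; the values elsewhere do not affect \<open>psi\<close>.\<close>
    define D' where "D' = D \<union> (D0 \<inter> Q0)"
    have "sparse_under_signs k D'" by (rule spQ) (use D in \<open>auto simp: D'_def Q_def\<close>)
    then obtain S where S: "S \<subseteq> P" "card S \<le> k" "(\<Sum>m\<in>P-S. (cmod (cinner (sign_op D' (xi n)) (xi m)))^2) \<le> 1/16"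
      using P(1) unfolding sparse_under_signs_def by blast
    have V: "(\<Sum>x\<in>Q. of_real (rsign D x) * a m x) = cinner (sign_op D' psi) (xi m)" for m
    proof -
      have "sign_op D' psi = (\<Sum>x\<in>Q. (of_real (rsign D x) * cf (xi n) x) *\<^sub>c ket x)"
      proof (rule ell2_eqI)
        fix x
        have "cf (\<Sum>x\<in>Q. (of_real (rsign D x) * cf (xi n) x) *\<^sub>c ket x) x = (if x \<in> Q then of_real (rsign D x) * cf (xi n) x else 0)"
          using orthonormal_cinner_sum[OF orthonormal_ket Q, of "\<lambda>x. of_real (rsign D x) * cf (xi n) x" x] by simp
        then show "cf (sign_op D' psi) x = cf (\<Sum>x\<in>Q. (of_real (rsign D x) * cf (xi n) x) *\<^sub>c ket x) x"
          by (auto simp: cf_sign_op cpsi rsign_def D'_def Q_def)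
      qed
      then show ?thesis by (simp add: cinner_sum_left a_def mult_ac)
    qed
    have "(\<Sum>m\<in>P-S. (cmod (\<Sum>x\<in>Q. of_real (rsign D x) * a m x))^2) \<le>
        (\<Sum>m\<in>P-S. 2 * (cmod (cinner (sign_op D' (xi n)) (xi m)))^2 + 2 * (cmod (cinner (sign_op D' (xi n - psi)) (xi m)))^2)"
    proof (rule sum_mono)
      fix m
      let ?p = "cinner (sign_op D' (xi n)) (xi m)" and ?q = "cinner (sign_op D' (xi n - psi)) (xi m)"
      have "(\<Sum>x\<in>Q. of_real (rsign D x) * a m x) = ?p - ?q" unfolding V by (simp add: blinfun.diff_right cinner_diff_left)
      then have "(cmod (\<Sum>x\<in>Q. of_real (rsign D x) * a m x))^2 \<le> (cmod ?p + cmod ?q)^2"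
        by (simp add: norm_triangle_ineq4)
      also have "\<dots> \<le> 2 * (cmod ?p)^2 + 2 * (cmod ?q)^2"
        using zero_le_power2[of "cmod ?p - cmod ?q"] by (simp add: power2_sum power2_diff)
      finally show "(cmod (\<Sum>x\<in>Q. of_real (rsign D x) * a m x))^2 \<le> 2 * (cmod ?p)^2 + 2 * (cmod ?q)^2" .
    qed
    also have "\<dots> = 2 * (\<Sum>m\<in>P-S. (cmod (cinner (sign_op D' (xi n)) (xi m)))^2) + 2 * (\<Sum>m\<in>P-S. (cmod (cinner (sign_op D' (xi n - psi)) (xi m)))^2)"
      by (simp add: sum.distrib sum_distrib_left)
    \<comment> \<open>Sparsity is known for \<open>xi n\<close>, not for its truncation
      \<open>psi\<close>; the second term is the price of the difference, of norm at most 1/8. The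
      total 5/32 is below 1/4.\<close>
    also have "\<dots> \<le> 2 * (1/16) + 2 * (1/8)^2"
    proof (intro add_mono mult_left_mono S(3))
      have "(\<Sum>m\<in>P-S. (cmod (cinner (sign_op D' (xi n - psi)) (xi m)))^2) \<le> (norm (sign_op D' (xi n - psi)))^2"
        by (rule bessel[OF ortho]) (use P in simp)
      also have "\<dots> \<le> (1/8)^2" by (intro power_mono order_trans[OF norm_sign_op_le npsi]) auto
      finally show "(\<Sum>m\<in>P-S. (cmod (cinner (sign_op D' (xi n - psi)) (xi m)))^2) \<le> (1/8)^2" .
    qed auto
    finally have "(\<Sum>m\<in>P-S. (cmod (\<Sum>x\<in>Q. of_real (rsign D x) * a m x))^2) \<le> 1/4" by (simp add: power2_eq_square)
    then show "\<exists>S\<subseteq>P. card S \<le> k \<and> (\<Sum>m\<in>P-S. (cmod (\<Sum>x\<in>Q. of_real (rsign D x) * a m x))^2) \<le> 1/4" using S by blast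
  next
    fix m
    have "(\<Sum>x\<in>Q. (cmod (a m x))^2) \<le> (\<Sum>x\<in>Q. dd * (cmod (cf (xi m) x))^2)"
      unfolding a2 by (intro sum_mono mult_right_mono n2) auto
    also have "\<dots> = dd * (\<Sum>x\<in>Q. (cmod (cf (xi m) x))^2)" by (simp add: sum_distrib_left)
    also have "\<dots> \<le> dd * 1" using ell2_sum_le[OF Q, of "xi m"] dd(1) by (intro mult_left_mono) auto
    finally show "(\<Sum>x\<in>Q. (cmod (a m x))^2) \<le> dd" by simp
  next
    have "(\<Sum>m\<in>P. \<Sum>x\<in>Q. (cmod (a m x))^2) \<le> (\<Sum>x\<in>Q. (cmod (cf (xi n) x))^2 * 1)"
      unfolding swap by (intro sum_mono mult_left_mono bx) auto
    also have "\<dots> \<le> 1" using ell2_sum_le[OF Q, of "xi n"] by simp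
    finally show "(\<Sum>m\<in>P. \<Sum>x\<in>Q. (cmod (a m x))^2) \<le> 1" .
  qed (use dd in simp)
  also have "6 * dd / t \<le> 1/8"
  proof -
    have "6 * dd / t = 48 * (real k + 1) * dd" by (simp add: t_def)
    then show ?thesis using dd(2) by simp
  qed
  finally have up: "(\<Sum>m\<in>P. \<Sum>x\<in>Q. (cmod (a m x))^2) \<le> 1/2" using t(2) by simp
  \<comment> \<open>The lower bound 15/16 * (7/8)^2 = 735/1024 on the total variance exceeds the
    upper bound 1/4 + 1/8 + 1/8.\<close>
  have "7/8 \<le> norm psi" using npsi norm_triangle_ineq2[of "xi n" psi] by simp
  then have "(7/8)^2 \<le> (norm psi)^2" by (intro power_mono) auto
  then have "15/16 * (49/64) \<le> 15/16 * (norm psi)^2" by (simp add: power2_eq_square)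
  also have "\<dots> = (\<Sum>x\<in>Q. (cmod (cf (xi n) x))^2 * (15/16))" unfolding sp[symmetric] by (simp add: sum_distrib_right mult.commute sum_divide_distrib[symmetric] sum_distrib_left[symmetric])
  also have "\<dots> \<le> (\<Sum>x\<in>Q. (cmod (cf (xi n) x))^2 * (\<Sum>m\<in>P. (cmod (cf (xi m) x))^2))"
    by (intro sum_mono mult_left_mono P(2)) auto
  finally show False using up unfolding swap by simp
qed

end

subsection \<open>Commutants and closures\<close>

definition commutes :: "('a ell2 \<Rightarrow>\<^sub>L 'a ell2) \<Rightarrow> ('a ell2 \<Rightarrow>\<^sub>L 'a ell2) \<Rightarrow> bool" where
  "commutes S T \<longleftrightarrow> (\<forall>u. S (T u) = T (S u))"

lemma commutes_iff: "commutes S T \<longleftrightarrow> (S o\<^sub>L T) = (T o\<^sub>L S)"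
proof
  assume "(S o\<^sub>L T) = (T o\<^sub>L S)"
  then show "commutes S T" unfolding commutes_def by (metis blinfun_apply_blinfun_compose)
qed (auto simp: commutes_def intro: blinfun_eqI)

lemma mmult_commute_iff:
  assumes "bounded_mat M" "bounded_mat N"
  shows "mmult M N = mmult N M \<longleftrightarrow> commutes (opr M) (opr N)"
proof -
  have "mmult M N = mmult N M \<longleftrightarrow> opr (mmult M N) = opr (mmult N M)"
    using opr_eqI bounded_mmult assms by metis
  also have "\<dots> \<longleftrightarrow> commutes (opr M) (opr N)"
    by (simp add: opr_mmult assms commutes_iff)
  finally show ?thesis .
qed

lemma commutes_adj:
  assumes "clin S" "clin T" "commutes S T" shows "commutes (adj S) (adj T)"
  unfolding commutes_def
proof (intro allI ket.eqI)
  fix u x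
  have "cinner (adj S (adj T u)) v = cinner (adj T (adj S u)) v" for v
    using assms(3) by (simp add: cinner_adj[OF assms(1)] cinner_adj[OF assms(2)] commutes_def)
  then show "cinner (adj S (adj T u)) (ket x) = cinner (adj T (adj S u)) (ket x)" by blast
qed

lemma norm_adj_le:
  assumes "clin T" shows "norm (adj T) \<le> norm T"
proof (rule norm_blinfun_bound)
  fix g
  have "complex_of_real ((norm (adj T g))^2) = cinner g (T (adj T g))"
    using cinner_adj[OF assms, of g "adj T g"] by (simp only: cinner_norm)
  then have "(norm (adj T g))^2 = cmod (cinner g (T (adj T g)))" by (metis abs_power2 norm_of_real)
  also have "\<dots> \<le> norm g * (norm T * norm (adj T g))"
    by (rule order_trans[OF cinner_CS mult_left_mono[OF norm_blinfun]]) simp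
  finally have "norm (adj T g) * norm (adj T g) \<le> (norm T * norm g) * norm (adj T g)"
    by (simp add: power2_eq_square mult_ac)
  then show "norm (adj T g) \<le> norm T * norm g"
    by (cases "norm (adj T g) = 0") (auto simp: mult_le_cancel_right)
qed simp

lemma adj_diff:
  assumes "clin S" "clin T" shows "adj S - adj T = adj (S - T)"
proof (intro blinfun_eqI ket.eqI)
  fix u x
  have "cinner ((adj S - adj T) u) v = cinner (adj (S - T) u) v" for v
    by (simp add: cinner_adj assms clin_simps blinfun.diff_left cinner_diff_left cinner_diff_right)
  then show "cinner ((adj S - adj T) u) (ket x) = cinner (adj (S - T) u) (ket x)" by blast
qed

text \<open>The norm closure of a *-algebra of bounded matrices is a C*-subalgebra. It lets a
  property of normalisers that survives algebraic operations spread approximately to everything they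
  generate.\<close>

lemma cstar_subalg_closure:
  fixes \<S> :: "'a mat set"
  assumes bd: "\<And>M. M \<in> \<S> \<Longrightarrow> bounded_mat M" and zero: "mzero \<in> \<S>"
    and add: "\<And>M N. M \<in> \<S> \<Longrightarrow> N \<in> \<S> \<Longrightarrow> madd M N \<in> \<S>" and scale: "\<And>c M. M \<in> \<S> \<Longrightarrow> msmult c M \<in> \<S>"
    and mult: "\<And>M N. M \<in> \<S> \<Longrightarrow> N \<in> \<S> \<Longrightarrow> mmult M N \<in> \<S>" and star: "\<And>M. M \<in> \<S> \<Longrightarrow> madj M \<in> \<S>"
  shows "cstar_subalg {M. bounded_mat M \<and> (\<forall>e>0. \<exists>N\<in>\<S>. norm (opr M - opr N) \<le> e)}" (is "cstar_subalg ?G")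
proof -
  have G: "M \<in> ?G \<Longrightarrow> bounded_mat M" "M \<in> ?G \<Longrightarrow> e > 0 \<Longrightarrow> \<exists>N\<in>\<S>. norm (opr M - opr N) \<le> e" for M e by auto
  show ?thesis unfolding cstar_subalg_def
  proof (intro conjI ballI allI impI)
    show "mzero \<in> ?G" using zero by (auto intro!: bexI[of _ mzero])
  next
    fix M N assume M: "M \<in> ?G" and N: "N \<in> ?G"
    show "madd M N \<in> ?G"
    proof (intro CollectI conjI allI impI bounded_madd G(1)[OF M] G(1)[OF N])
      fix e :: real assume e: "e > 0"
      obtain M' where M': "M' \<in> \<S>" "norm (opr M - opr M') \<le> e/2" using G(2)[OF M, of "e/2"] e by auto
      obtain N' where N': "N' \<in> \<S>" "norm (opr N - opr N') \<le> e/2" using G(2)[OF N, of "e/2"] e by auto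
      have "opr (madd M N) - opr (madd M' N') = (opr M - opr M') + (opr N - opr N')"
        using G(1)[OF M] G(1)[OF N] bd M' N' by (simp add: opr_madd)
      then have "norm (opr (madd M N) - opr (madd M' N')) \<le> e"
        using norm_triangle_mono[OF M'(2) N'(2)] by simp
      then show "\<exists>N'\<in>\<S>. norm (opr (madd M N) - opr N') \<le> e" using add[OF M'(1) N'(1)] by blast
    qed
    show "mmult M N \<in> ?G"
    proof (intro CollectI conjI allI impI bounded_mmult G(1)[OF M] G(1)[OF N])
      fix e :: real assume e: "e > 0"
      obtain M' where M': "M' \<in> \<S>" "norm (opr M - opr M') \<le> e / (2 * (norm (opr N) + 1))"
        using G(2)[OF M, of "e / (2 * (norm (opr N) + 1))"] e by (auto simp: add_nonneg_pos)
      \<comment> \<open>The tolerance for N' involves the norm of M', so M' is chosen first; adding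
        1 avoids division by zero.\<close>
      obtain N' where N': "N' \<in> \<S>" "norm (opr N - opr N') \<le> e / (2 * (norm (opr M') + 1))"
        using G(2)[OF N, of "e / (2 * (norm (opr M') + 1))"] e by (auto simp: add_nonneg_pos)
      have half: "e / (2 * (c + 1)) * c \<le> e / 2" if "c \<ge> 0" for c :: real
        using that e by (simp add: field_simps)
      have "opr (mmult M N) - opr (mmult M' N') = ((opr M - opr M') o\<^sub>L opr N) + (opr M' o\<^sub>L (opr N - opr N'))"
        using G(1)[OF M] G(1)[OF N] bd M' N'
        by (intro Bounded_Linear_Function.blinfun_eqI) (simp add: opr_mmult blinfun.bilinear_simps)
      also have "norm \<dots> \<le> e/2 + e/2"
      proof (rule norm_triangle_mono)
        have "norm ((opr M - opr M') o\<^sub>L opr N) \<le> norm (opr M - opr M') * norm (opr N)" by (rule norm_blinfun_compose)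
        also have "\<dots> \<le> e / (2 * (norm (opr N) + 1)) * norm (opr N)" by (intro mult_right_mono M'(2)) simp
        also have "\<dots> \<le> e/2" by (rule half) simp
        finally show "norm ((opr M - opr M') o\<^sub>L opr N) \<le> e/2" .
        have "norm (opr M' o\<^sub>L (opr N - opr N')) \<le> norm (opr M') * norm (opr N - opr N')" by (rule norm_blinfun_compose)
        also have "\<dots> \<le> norm (opr M') * (e / (2 * (norm (opr M') + 1)))" by (intro mult_left_mono N'(2)) simp
        also have "\<dots> \<le> e/2" using half[of "norm (opr M')"] by (simp only: mult.commute norm_ge_zero)
        finally show "norm (opr M' o\<^sub>L (opr N - opr N')) \<le> e/2" .
      qed
      finally show "\<exists>N'\<in>\<S>. norm (opr (mmult M N) - opr N') \<le> e" using mult[OF M'(1) N'(1)] by auto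
    qed
  next
    fix M assume M: "M \<in> ?G"
    show "bounded_mat M" using M by simp
    show "madj M \<in> ?G"
    proof (intro CollectI conjI allI impI bounded_madj G(1)[OF M])
      fix e :: real assume e: "e > 0"
      obtain M' where M': "M' \<in> \<S>" "norm (opr M - opr M') \<le> e" using G(2)[OF M e] by auto
      have c: "clin (opr M)" "clin (opr M')" using G(1)[OF M] bd[OF M'(1)] by (auto intro: clin_opr)
      have "norm (opr (madj M) - opr (madj M')) \<le> e"
        using G(1)[OF M] bd[OF M'(1)] order_trans[OF norm_adj_le[OF clin_simps(3)[OF c]] M'(2)] by (simp add: opr_madj adj_diff c)
      then show "\<exists>N\<in>\<S>. norm (opr (madj M) - opr N) \<le> e" using star[OF M'(1)] by blast
    qed
    fix c
    show "msmult c M \<in> ?G"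
    proof (intro CollectI conjI allI impI bounded_msmult G(1)[OF M])
      fix e :: real assume e: "e > 0"
      have "0 < e / (cmod c + 1)" using e by (simp add: add_nonneg_pos)
      then obtain M' where M': "M' \<in> \<S>" "norm (opr M - opr M') \<le> e / (cmod c + 1)" using G(2)[OF M] by blast
      have "norm (opr (msmult c M) - opr (msmult c M')) \<le> e"
      proof (rule norm_blinfun_bound)
        fix u
        have "(opr (msmult c M) - opr (msmult c M')) u = c *\<^sub>c ((opr M - opr M') u)"
          using G(1)[OF M] bd[OF M'(1)] by (simp add: opr_msmult blinfun.diff_left scale_op.rep_eq cs_simps)
        then have "norm ((opr (msmult c M) - opr (msmult c M')) u) = cmod c * norm ((opr M - opr M') u)" by simp
        also have "\<dots> \<le> cmod c * (norm (opr M - opr M') * norm u)" by (intro mult_left_mono norm_blinfun) simp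
        also have "\<dots> \<le> (cmod c + 1) * (e / (cmod c + 1) * norm u)" using M'(2) by (intro mult_mono mult_right_mono) auto
        also have "\<dots> = e * norm u" by (simp add: add_nonneg_eq_0_iff)
        finally show "norm ((opr (msmult c M) - opr (msmult c M')) u) \<le> e * norm u" .
      qed (use e in simp)
      then show "\<exists>N\<in>\<S>. norm (opr (msmult c M) - opr N) \<le> e" using scale[OF M'(1)] by blast
    qed
  next
    fix u M assume u: "(\<forall>n. u n \<in> ?G) \<and> bounded_mat M \<and> (\<lambda>n. opnorm (mminus (u n) M)) \<longlonglongrightarrow> 0"
    show "M \<in> ?G"
    proof (intro CollectI conjI allI impI)
      show bM: "bounded_mat M" using u by simp
      fix e :: real assume e: "e > 0"
      obtain n where n: "norm (opnorm (mminus (u n) M)) < e/2"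
        using LIMSEQ_D[of "\<lambda>n. opnorm (mminus (u n) M)" 0 "e/2"] u e by auto
      have bu: "bounded_mat (u n)" using u by simp
      have 1: "norm (opr M - opr (u n)) \<le> e/2" using n by (simp add: opnorm_mminus bu bM norm_minus_commute)
      obtain N where N: "N \<in> \<S>" "norm (opr (u n) - opr N) \<le> e/2" using G(2)[of "u n" "e/2"] u e by auto
      have "opr M - opr N = (opr M - opr (u n)) + (opr (u n) - opr N)" by simp
      then have "norm (opr M - opr N) \<le> e" using norm_triangle_mono[OF 1 N(2)] by simp
      then show "\<exists>N\<in>\<S>. norm (opr M - opr N) \<le> e" using N(1) by blast
    qed
  qed
qed

text \<open>D is closed under adjoints, so commuting with D passes from M to its adjoint;
  commutation survives norm limits when tested on single vectors.\<close>

lemma commutant_cstar_subalg: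
  fixes D :: "('a ell2 \<Rightarrow>\<^sub>L 'a ell2) set"
  assumes B: "cstar_subalg B" and D: "\<And>T. T \<in> D \<Longrightarrow> clin T" "\<And>T. T \<in> D \<Longrightarrow> adj T \<in> D"
  shows "cstar_subalg {M \<in> B. \<forall>T\<in>D. commutes (opr M) T}"
  unfolding cstar_subalg_def
proof (intro conjI ballI allI impI)
  show "mzero \<in> {M \<in> B. \<forall>T\<in>D. commutes (opr M) T}" using cstar_subalgD(2)[OF B] by (simp add: commutes_def)
next
  fix M N assume "M \<in> {M \<in> B. \<forall>T\<in>D. commutes (opr M) T}" "N \<in> {M \<in> B. \<forall>T\<in>D. commutes (opr M) T}"
  then show "madd M N \<in> {M \<in> B. \<forall>T\<in>D. commutes (opr M) T}" "mmult M N \<in> {M \<in> B. \<forall>T\<in>D. commutes (opr M) T}"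
    using cstar_subalgD[OF B] by (auto simp: commutes_def opr_madd opr_mmult blinfun.add_left blinfun.add_right)
next
  fix M assume M: "M \<in> {M \<in> B. \<forall>T\<in>D. commutes (opr M) T}"
  then show bM: "bounded_mat M" using cstar_subalgD(1)[OF B] by simp
  show "msmult c M \<in> {M \<in> B. \<forall>T\<in>D. commutes (opr M) T}" for c
    using M cstar_subalgD(4)[OF B] bM D(1) by (auto simp: commutes_def opr_msmult scale_op.rep_eq clin_def)
  have "commutes (adj (opr M)) T" if T: "T \<in> D" for T
  proof -
    have "commutes (adj (opr M)) (adj (adj T))" using M D T bM by (intro commutes_adj clin_opr) auto
    moreover have "adj (adj T) = T"
    proof (intro blinfun_eqI ket.eqI)
      fix u x
      have "cinner (adj (adj T) u) v = cinner (T u) v" for v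
      proof -
        have "cinner (adj (adj T) u) v = cinner u (adj T v)" by (rule cinner_adj) (use D T in auto)
        also have "\<dots> = cnj (cinner (adj T v) u)" by (rule cinner_commute)
        also have "\<dots> = cnj (cinner v (T u))" by (simp add: cinner_adj D T)
        also have "\<dots> = cinner (T u) v" by (rule cinner_commute[symmetric])
        finally show ?thesis .
      qed
      then show "cinner (adj (adj T) u) (ket x) = cinner (T u) (ket x)" by blast
    qed
    ultimately show ?thesis by simp
  qed
  then show "madj M \<in> {M \<in> B. \<forall>T\<in>D. commutes (opr M) T}" using M cstar_subalgD(6)[OF B] bM by (simp add: opr_madj)
next
  fix u M assume u: "(\<forall>n. u n \<in> {M \<in> B. \<forall>T\<in>D. commutes (opr M) T}) \<and> bounded_mat M \<and> (\<lambda>n. opnorm (mminus (u n) M)) \<longlonglongrightarrow> 0"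
  have bu: "bounded_mat (u n)" for n using u cstar_subalgD(1)[OF B] by blast
  have "M \<in> B" using u B unfolding cstar_subalg_def by blast
  moreover have "commutes (opr M) T" if T: "T \<in> D" for T
    unfolding commutes_def
  proof
    fix w
    have "bounded_mat M" "(\<lambda>n. opnorm (mminus (u n) M)) \<longlonglongrightarrow> 0" using u by auto
    then have "(\<lambda>n. norm (opr (u n) - opr M)) \<longlonglongrightarrow> 0" by (simp add: opnorm_mminus bu)
    then have l: "(\<lambda>n. opr (u n)) \<longlonglongrightarrow> opr M" by (rule LIM_zero_cancel[OF tendsto_norm_zero_cancel])
    have "(\<lambda>n. opr (u n) (T w)) \<longlonglongrightarrow> opr M (T w)" by (intro tendsto_intros l)
    moreover have "(\<lambda>n. T (opr (u n) w)) \<longlonglongrightarrow> T (opr M w)" by (intro tendsto_intros l)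
    moreover have "opr (u n) (T w) = T (opr (u n) w)" for n using u T by (auto simp: commutes_def)
    ultimately show "opr M (T w) = T (opr M w)" using LIMSEQ_unique by (simp only:)
  qed
  ultimately show "M \<in> {M \<in> B. \<forall>T\<in>D. commutes (opr M) T}" by blast
qed

subsection \<open>Atoms of a Roe Cartan subalgebra\<close>

locale roe_cartan_data =
  fixes A :: "'a::metric_space mat set" and \<phi> :: "'a mat \<Rightarrow> nat \<Rightarrow> complex" and E :: "'a mat \<Rightarrow> 'a mat"
  assumes ulf: "ulf TYPE('a)" and sub: "A \<subseteq> uroe" and algA: "cstar_subalg A" and ab: "abelian A"
    and max: "\<And>C. cstar_subalg C \<Longrightarrow> abelian C \<Longrightarrow> A \<subseteq> C \<Longrightarrow> C \<subseteq> uroe \<Longrightarrow> C = A"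
    and gen: "uroe = cstar_gen (normaliser A uroe)" and ex: "faithful_cond_exp E uroe A"
    and bij: "bij_betw \<phi> A linf_nat"
    and \<phi>_scale: "\<And>c a. a \<in> A \<Longrightarrow> \<phi> (msmult c a) = (\<lambda>n. c * \<phi> a n)"
    and \<phi>_mult: "\<And>a b. a \<in> A \<Longrightarrow> b \<in> A \<Longrightarrow> \<phi> (mmult a b) = (\<lambda>n. \<phi> a n * \<phi> b n)"
    and \<phi>_star: "\<And>a. a \<in> A \<Longrightarrow> \<phi> (madj a) = (\<lambda>n. cnj (\<phi> a n))"
begin

lemma A_bounded: "a \<in> A \<Longrightarrow> bounded_mat a"
  using sub uroe_bounded by blast

lemma alg: "cstar_subalg (uroe :: 'a mat set)"
proof -
  have "normaliser A uroe \<subseteq> {M. bounded_mat M}" by (auto simp: normaliser_def uroe_bounded)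
  from cstar_subalg_cstar_gen[OF this] show ?thesis using gen by simp
qed

definition \<psi> :: "(nat \<Rightarrow> complex) \<Rightarrow> 'a mat" where "\<psi> = inv_into A \<phi>"

lemma \<psi>:
  assumes "bounded (range c)" shows "\<psi> c \<in> A" "\<phi> (\<psi> c) = c"
proof -
  have "c \<in> \<phi> ` A" using assms bij by (simp add: bij_betw_def linf_nat_def)
  then show "\<psi> c \<in> A" "\<phi> (\<psi> c) = c" unfolding \<psi>_def by (simp_all add: inv_into_into f_inv_into_f)
qed

lemma \<phi>_inj: "a \<in> A \<Longrightarrow> b \<in> A \<Longrightarrow> \<phi> a = \<phi> b \<Longrightarrow> a = b"
  using bij by (auto simp: bij_betw_def inj_on_def)

lemma \<phi>_zero: "\<phi> mzero = (\<lambda>n. 0)"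
proof -
  have "msmult 0 mzero = (mzero :: 'a mat)" by (simp add: msmult_def mzero_def)
  then show ?thesis using \<phi>_scale[OF cstar_subalgD(2)[OF algA], of 0] by simp
qed

text \<open>The preimages of the point masses: the minimal projections of A.\<close>

definition p :: "nat \<Rightarrow> 'a mat" where "p n = \<psi> (\<lambda>m. if m = n then 1 else 0)"

lemma p: "p n \<in> A" "\<phi> (p n) = (\<lambda>m. if m = n then 1 else 0)"
proof -
  have "bounded (range (\<lambda>m. if m = n then 1 else 0 :: complex))"
    by (rule finite_imp_bounded, rule finite_subset[of _ "{0,1}"]) auto
  then show "p n \<in> A" "\<phi> (p n) = (\<lambda>m. if m = n then 1 else 0)" unfolding p_def by (rule \<psi>)+
qed

text \<open>The elements a p_n and \<phi>(a)(n) p_n of A have the same image under \<phi>. So A acts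
  by scalars on the range of each atom.\<close>

lemma A_p: "a \<in> A \<Longrightarrow> opr a (opr (p n) u) = \<phi> a n *\<^sub>c opr (p n) u"
proof -
  assume a: "a \<in> A"
  have "mmult a (p n) = msmult (\<phi> a n) (p n)"
    by (rule \<phi>_inj) (auto simp: a p \<phi>_mult \<phi>_scale cstar_subalgD[OF algA])
  then have "opr a o\<^sub>L opr (p n) = scale_op (\<phi> a n) o\<^sub>L opr (p n)"
    using A_bounded[OF a] A_bounded[OF p(1)[of n]] opr_mmult opr_msmult by metis
  then have "(opr a o\<^sub>L opr (p n)) u = (scale_op (\<phi> a n) o\<^sub>L opr (p n)) u" by simp
  then show ?thesis by (simp add: scale_op.rep_eq)
qed

lemma p_idem: "opr (p n) (opr (p n) u) = opr (p n) u"
  using A_p[OF p(1)[of n], of n u] by (simp add: p)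

lemma p_adj: "cinner (opr (p n) u) v = cinner u (opr (p n) v)"
proof -
  have "madj (p n) = p n" by (rule \<phi>_inj) (auto simp: p \<phi>_star cstar_subalgD[OF algA])
  then show ?thesis using cinner_opr[OF A_bounded[OF p(1)[of n]], of u v] by simp
qed

text \<open>The relative bicommutant of \<^term>\<open>insert t A\<close> is an abelian subalgebra containing \<^term>\<open>A\<close>.\<close>

lemma masa_mem:
  assumes t: "t \<in> uroe" "madj t = t" and c: "\<And>a. a \<in> A \<Longrightarrow> commutes (opr a) (opr t)"
  shows "t \<in> A"
proof -
  let ?I = "insert t A"
  define D where "D = {T. clin T \<and> (\<forall>a\<in>?I. commutes (opr a) T)}"
  define C where "C = {M \<in> uroe. \<forall>T\<in>D. commutes (opr M) T}"
  have bI: "bounded_mat a" if "a \<in> ?I" for a using that t A_bounded uroe_bounded by auto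
  have adjD: "adj T \<in> D" if T: "T \<in> D" for T
  proof -
    have "commutes (opr a) (adj T)" if a: "a \<in> ?I" for a
    proof -
      have "madj a \<in> ?I" using a t cstar_subalgD(6)[OF algA] by auto
      then have "commutes (adj (opr (madj a))) (adj T)" using T bI by (intro commutes_adj clin_opr) (auto simp: D_def)
      then show ?thesis using bI[OF a] by (simp add: bounded_madj flip: opr_madj)
    qed
    then show ?thesis using T by (simp add: D_def clin_adj)
  qed
  have ID: "opr a \<in> D" if "a \<in> ?I" for a
  proof -
    have "commutes (opr b) (opr a)" if "b \<in> ?I" for b
    proof -
      have AA: "commutes (opr b) (opr a)" if "a \<in> A" "b \<in> A" for a b
        using ab that mmult_commute_iff[OF A_bounded A_bounded, of b a] by (simp add: abelian_def)
      have sym: "commutes S T \<Longrightarrow> commutes T S" for S T :: "'a ell2 \<Rightarrow>\<^sub>L 'a ell2" by (simp add: commutes_def)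
      have rf: "commutes T T" for T :: "'a ell2 \<Rightarrow>\<^sub>L 'a ell2" by (simp add: commutes_def)
      show ?thesis using that \<open>a \<in> ?I\<close> AA c sym rf by blast
    qed
    then show ?thesis using bI[OF \<open>a \<in> ?I\<close>] by (simp add: D_def clin_opr)
  qed
  have "cstar_subalg C" unfolding C_def
    by (rule commutant_cstar_subalg[OF alg]) (use adjD in \<open>auto simp: D_def\<close>)
  \<comment> \<open>The elements of \<open>?I\<close> commute pairwise, so they lie in D. A member N
    of C therefore commutes with all of \<open>?I\<close>, which puts \<open>opr N\<close> into D,
    and every M in C commutes with D.\<close>
  moreover have "abelian C" unfolding abelian_def
  proof (intro ballI)
    fix M N assume MN: "M \<in> C" "N \<in> C"
    have b: "bounded_mat M" "bounded_mat N" using MN by (auto simp: C_def uroe_bounded)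
    have "commutes (opr a) (opr N)" if "a \<in> ?I" for a using MN(2) ID[OF that] by (auto simp: C_def commutes_def)
    then have "opr N \<in> D" using b by (simp add: D_def clin_opr)
    then show "mmult M N = mmult N M" using MN(1) mmult_commute_iff[OF b] by (simp add: C_def)
  qed
  moreover have IC: "?I \<subseteq> C" using t(1) sub by (auto simp: C_def D_def)
  ultimately have "C = A" using max[of C] by (auto simp: C_def)
  then show ?thesis using IC by blast
qed

text \<open>Take a nonzero \<eta> in the range of \<open>p n\<close>. The rank one operator t on
  \<eta> lies in \<open>uroe\<close> and commutes with A, which acts on \<eta> by scalars; by
  maximality t is in A. Then t is itself a scalar on the range of \<open>p n\<close>, nonzero
  because t \<eta> \<noteq> 0, so that range is spanned by \<eta>.\<close>

lemma p_rank_one: "\<exists>x. norm x = 1 \<and> (\<forall>u. opr (p n) u = cinner u x *\<^sub>c x)"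
proof -
  have "p n \<noteq> mzero" using p(2)[of n] \<phi>_zero by (metis zero_neq_one)
  have "\<exists>y. opr (p n) (ket y) \<noteq> 0"
  proof (rule ccontr)
    assume "\<not> ?thesis"
    then have "opr (p n) = 0" by (intro ket.blinfun_eqI) (auto simp: clin_simps clin_opr A_bounded p)
    then show False using \<open>p n \<noteq> mzero\<close> opr_eqI[of "p n" mzero] A_bounded[OF p(1)] by simp
  qed
  then obtain y where y: "opr (p n) (ket y) \<noteq> 0" by blast
  define \<eta> where "\<eta> = opr (p n) (ket y)"
  have p\<eta>: "opr (p n) \<eta> = \<eta>" unfolding \<eta>_def by (rule p_idem)
  have a\<eta>: "opr a \<eta> = \<phi> a n *\<^sub>c \<eta>" if "a \<in> A" for a using A_p[OF that, of n \<eta>] by (simp add: p\<eta>)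
  define t where "t = rank_one \<eta> \<eta>"
  have "t \<in> A"
  proof (rule masa_mem)
    show "t \<in> uroe" unfolding t_def by (rule rank_one_uroe)
    show "madj t = t" by (auto simp: t_def madj_def rank_one_def mult.commute)
    fix a assume a: "a \<in> A"
    show "commutes (opr a) (opr t)" unfolding commutes_def
    proof
      fix u
      have "cinner (opr a u) \<eta> = cinner u (opr (madj a) \<eta>)" by (rule cinner_opr[OF A_bounded[OF a]])
      also have "\<dots> = \<phi> a n * cinner u \<eta>"
        using a\<eta>[OF cstar_subalgD(6)[OF algA a]] by (simp add: \<phi>_star[OF a])
      finally show "opr a (opr t u) = opr t (opr a u)"
        using clin_opr[OF A_bounded[OF a]] by (simp add: t_def opr_rank_one clin_def a\<eta>[OF a] mult.commute)
    qed
  qed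
  then have tp: "opr t (opr (p n) u) = \<phi> t n *\<^sub>c opr (p n) u" for u by (rule A_p)
  have "cinner \<eta> \<eta> *\<^sub>c \<eta> = \<phi> t n *\<^sub>c \<eta>" using tp[of \<eta>] by (simp add: p\<eta> t_def opr_rank_one)
  then have "(cinner \<eta> \<eta> - \<phi> t n) *\<^sub>c \<eta> = 0" by (simp add: cs_simps)
  then have "norm ((cinner \<eta> \<eta> - \<phi> t n) *\<^sub>c \<eta>) = 0" by simp
  then have s: "\<phi> t n = of_real ((norm \<eta>)^2)" using y by (simp add: \<eta>_def cinner_norm)
  have nz: "norm \<eta> \<noteq> 0" using y by (simp add: \<eta>_def)
  have pu: "cinner u \<eta> *\<^sub>c \<eta> = of_real ((norm \<eta>)^2) *\<^sub>c opr (p n) u" for u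
    using tp[of u] unfolding s by (simp add: t_def opr_rank_one p_adj p\<eta>)
  define x where "x = of_real (1 / norm \<eta>) *\<^sub>c \<eta>"
  have "opr (p n) u = cinner u x *\<^sub>c x" for u
  proof -
    have "opr (p n) u = of_real (1 / (norm \<eta>)^2) *\<^sub>c (of_real ((norm \<eta>)^2) *\<^sub>c opr (p n) u)" using nz by simp
    also have "\<dots> = cinner u x *\<^sub>c x" unfolding pu[symmetric] x_def by (simp add: power2_eq_square mult_ac)
    finally show ?thesis .
  qed
  moreover have "norm x = 1" using nz by (simp add: x_def norm_divide)
  ultimately show ?thesis by blast
qed

definition xi :: "nat \<Rightarrow> 'a ell2" where
  "xi n = (SOME x. norm x = 1 \<and> (\<forall>u. opr (p n) u = cinner u x *\<^sub>c x))"

lemma norm_xi: "norm (xi n) = 1" and p_xi: "opr (p n) u = cinner u (xi n) *\<^sub>c xi n"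
  using someI_ex[OF p_rank_one[of n]] unfolding xi_def by blast+

lemma A_xi: "a \<in> A \<Longrightarrow> opr a (xi n) = \<phi> a n *\<^sub>c xi n"
  using A_p[of a n "xi n"] by (simp add: p_xi cinner_norm norm_xi)

lemma orthonormal_xi: "orthonormal xi"
  unfolding orthonormal_def
proof (intro allI)
  fix i j
  show "cinner (xi i) (xi j) = (if i = j then 1 else 0)"
  proof (cases "i = j")
    case False
    have "cinner (xi i) (xi j) *\<^sub>c xi j = \<phi> (p j) i *\<^sub>c xi i" using A_xi[OF p(1), of j i] by (simp add: p_xi)
    also have "\<dots> = 0" using False by (simp add: p)
    finally have "norm (cinner (xi i) (xi j) *\<^sub>c xi j) = 0" by simp
    then show ?thesis using False by (simp add: norm_xi)
  qed (simp add: cinner_norm norm_xi)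
qed

text \<open>The conditional expectation kills the rank one projection onto a vector orthogonal to all
  \<^term>\<open>xi n\<close>, so faithfulness makes the vector vanish.\<close>

lemma total_xi:
  assumes u: "\<And>n. cinner u (xi n) = 0" shows "u = 0"
proof -
  define b where "b = rank_one u u"
  have b: "b \<in> uroe" "bounded_mat b" "madj b = b"
    unfolding b_def by (rule rank_one_uroe, rule bounded_rank_one) (auto simp: madj_def rank_one_def mult.commute)
  have EA: "E b \<in> A" using ex b unfolding faithful_cond_exp_def by blast
  have Emul: "E (mmult (mmult a b) a') = mmult (mmult a (E b)) a'" if "a \<in> A" "a' \<in> A" for a a'
    using ex b that unfolding faithful_cond_exp_def by blast
  have Esc: "E (msmult z b) = msmult z (E b)" for z
    using ex b unfolding faithful_cond_exp_def by blast
  have Ef: "E (mmult (madj b) b) = mzero \<Longrightarrow> b = mzero"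
    using ex b unfolding faithful_cond_exp_def by blast
  have ms0: "msmult 0 M = mzero" for M :: "'a mat" by (simp add: msmult_def mzero_def)
  have msz: "msmult z mzero = (mzero :: 'a mat)" for z by (simp add: msmult_def mzero_def)
  have E0: "E mzero = mzero" using Esc[of 0] by (simp add: ms0)
  \<comment> \<open>As u is orthogonal to \<open>xi n\<close>, compressing b by \<open>p n\<close>
    gives zero. The bimodule property carries this to \<open>E b\<close>, whose compression has
    value \<open>\<phi> (E b) n\<close> at n.\<close>
  have "\<phi> (E b) n = 0" for n
  proof -
    have pb: "bounded_mat (p n)" by (rule A_bounded[OF p(1)])
    have "mmult (mmult (p n) b) (p n) = mzero"
    proof (rule opr_eqI)
      show "opr (mmult (mmult (p n) b) (p n)) = opr mzero"
      proof (rule blinfun_eqI)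
        fix w
        have "cinner (xi n) u = 0" using u[of n] cinner_commute[of "xi n" u] by simp
        then have "opr b (c *\<^sub>c xi n) = 0" for c by (simp add: b_def opr_rank_one)
        then show "opr (mmult (mmult (p n) b) (p n)) w = opr mzero w"
          by (simp add: opr_mmult bounded_mmult pb b p_xi)
      qed
    qed (auto intro!: bounded_mmult pb b)
    then have "mmult (mmult (p n) (E b)) (p n) = mzero" using Emul[OF p(1) p(1), of n n] E0 by simp
    then have "\<phi> (mmult (mmult (p n) (E b)) (p n)) n = 0" by (simp add: \<phi>_zero)
    then show ?thesis using EA by (simp add: \<phi>_mult p cstar_subalgD[OF algA])
  qed
  then have Eb: "E b = mzero" using \<phi>_inj[OF EA cstar_subalgD(2)[OF algA]] \<phi>_zero by auto
  \<comment> \<open>b is a scalar multiple of its own square, so \<open>E b = mzero\<close> already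
    gives what faithfulness asks for.\<close>
  have "mmult (madj b) b = msmult (of_real ((norm u)^2)) b"
  proof (rule opr_eqI)
    show "opr (mmult (madj b) b) = opr (msmult (of_real ((norm u)^2)) b)"
      by (rule blinfun_eqI) (simp add: b(3) opr_mmult opr_msmult b(2) scale_op.rep_eq, simp add: b_def opr_rank_one cinner_norm mult.commute)
  qed (auto intro!: bounded_mmult bounded_msmult b simp: b(3))
  then have "E (mmult (madj b) b) = mzero" by (simp add: Esc Eb msz)
  then have "b = mzero" by (rule Ef)
  then have "opr b u = 0" by simp
  then have "norm (cinner u u *\<^sub>c u) = 0" by (simp add: b_def opr_rank_one)
  then show ?thesis by (simp add: cinner_norm)
qed

sublocale onb xi
  by (rule onb_nat[OF orthonormal_xi total_xi])

sublocale roe_basis xi \<psi>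
  by unfold_locales (use ulf alg \<psi> sub in \<open>auto simp: A_xi\<close>)

section \<open>Column sparsity in the basis \<open>xi\<close>\<close>

definition supp :: "'a mat \<Rightarrow> nat \<Rightarrow> nat set" where
  "supp M n = {m. cinner (opr M (xi n)) (xi m) \<noteq> 0}"

definition col_sparse :: "nat \<Rightarrow> 'a mat \<Rightarrow> bool" where
  "col_sparse k M \<longleftrightarrow> (\<forall>n. finite (supp M n) \<and> card (supp M n) \<le> k)"

lemma col_sparseI:
  assumes "\<And>n. supp M n \<subseteq> S n" "\<And>n. finite (S n)" "\<And>n. card (S n) \<le> k"
  shows "col_sparse k M"
  unfolding col_sparse_def
proof (intro allI conjI)
  fix n
  show "finite (supp M n)" by (rule finite_subset[OF assms(1,2)])
  show "card (supp M n) \<le> k" by (rule order_trans[OF card_mono[OF assms(2,1)] assms(3)])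
qed

lemma col_sparse_madd:
  assumes "col_sparse k M" "col_sparse l N" "bounded_mat M" "bounded_mat N"
  shows "col_sparse (k + l) (madd M N)"
proof -
  have "supp (madd M N) n \<subseteq> supp M n \<union> supp N n" for n
    by (auto simp: supp_def opr_madd assms blinfun.add_left cinner_add_left)
  moreover have "finite (supp M n \<union> supp N n)" for n using assms(1,2) by (simp add: col_sparse_def)
  moreover have "card (supp M n \<union> supp N n) \<le> k + l" for n
  proof -
    have "card (supp M n) \<le> k" "card (supp N n) \<le> l" using assms(1,2) by (auto simp: col_sparse_def)
    then show ?thesis using card_Un_le[of "supp M n" "supp N n"] by linarith
  qed
  ultimately show ?thesis by (rule col_sparseI)
qed

text \<open>Column n of the product is a combination of at most l columns of M, namely those indexed
  by the support of column n of N.\<close>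

lemma col_sparse_mmult:
  assumes "col_sparse k M" "col_sparse l N" "bounded_mat M" "bounded_mat N"
  shows "col_sparse (l * k) (mmult M N)"
proof -
  have sub: "supp (mmult M N) n \<subseteq> (\<Union>m\<in>supp N n. supp M m)" for n
  proof
    fix j assume j: "j \<in> supp (mmult M N) n"
    have fin: "finite (supp N n)" using assms(2) by (simp add: col_sparse_def)
    define c where "c m = cinner (opr N (xi n)) (xi m)" for m
    have 1: "opr N (xi n) = (\<Sum>m\<in>supp N n. c m *\<^sub>c xi m)"
      by (rule eqI) (simp only: orthonormal_cinner_sum[OF ortho fin], simp add: supp_def c_def)
    have "opr M (opr N (xi n)) = (\<Sum>m\<in>supp N n. c m *\<^sub>c opr M (xi m))"
      unfolding 1 using clin_opr[OF assms(3)] by (simp add: blinfun.sum_right clin_def)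
    then have "cinner (opr (mmult M N) (xi n)) (xi j) = (\<Sum>m\<in>supp N n. c m * cinner (opr M (xi m)) (xi j))"
      by (simp add: opr_mmult assms cinner_sum_left)
    note 2 = this
    have "\<exists>m\<in>supp N n. cinner (opr M (xi m)) (xi j) \<noteq> 0"
    proof (rule ccontr)
      assume "\<not> ?thesis"
      then have "cinner (opr (mmult M N) (xi n)) (xi j) = 0" unfolding 2 by (intro sum.neutral) simp
      then show False using j by (simp add: supp_def)
    qed
    then show "j \<in> (\<Union>m\<in>supp N n. supp M m)" by (auto simp: supp_def)
  qed
  have fin: "finite (\<Union>m\<in>supp N n. supp M m)" for n using assms(1,2) by (auto simp: col_sparse_def)
  have "card (\<Union>m\<in>supp N n. supp M m) \<le> l * k" for n
  proof -
    have "card (\<Union>m\<in>supp N n. supp M m) \<le> (\<Sum>m\<in>supp N n. card (supp M m))"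
      by (rule card_UN_le) (use assms(2) in \<open>simp add: col_sparse_def\<close>)
    also have "\<dots> \<le> of_nat (card (supp N n)) * k" by (rule sum_bounded_above) (use assms(1) in \<open>simp add: col_sparse_def\<close>)
    also have "\<dots> \<le> l * k" using assms(2) by (simp add: col_sparse_def)
    finally show "card (\<Union>m\<in>supp N n. supp M m) \<le> l * k" .
  qed
  then show ?thesis by (rule col_sparseI[OF sub fin])
qed

text \<open>The element b p_n b* is rank one with range spanned by b \<open>xi n\<close>. Being in A
  it is diagonal in \<open>xi\<close>, so two different nonzero coefficients of b
  \<open>xi n\<close> would produce a nonzero off-diagonal entry.\<close>

lemma col_sparse_normaliser:
  assumes b: "bounded_mat b" and N: "\<And>n. mmult (mmult b (p n)) (madj b) \<in> A"
  shows "col_sparse 1 b"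
  unfolding col_sparse_def
proof
  fix n
  define a where "a = mmult (mmult b (p n)) (madj b)"
  have a: "a \<in> A" unfolding a_def by (rule N)
  have clb: "opr b (c *\<^sub>c u) = c *\<^sub>c opr b u" for c u using clin_opr[OF b] by (simp add: clin_def)
  have "m = l" if m: "m \<in> supp b n" and l: "l \<in> supp b n" for m l
  proof (rule ccontr)
    assume "m \<noteq> l"
    have "opr a (xi m) = cinner (opr (madj b) (xi m)) (xi n) *\<^sub>c opr b (xi n)"
      unfolding a_def by (simp add: opr_mmult bounded_mmult bounded_madj b A_bounded p p_xi clb)
    then have "\<phi> a m *\<^sub>c xi m = cinner (opr (madj b) (xi m)) (xi n) *\<^sub>c opr b (xi n)" by (simp add: A_xi[OF a])
    then have "cinner (\<phi> a m *\<^sub>c xi m) (xi l) = cinner (cinner (opr (madj b) (xi m)) (xi n) *\<^sub>c opr b (xi n)) (xi l)" by simp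
    then have "cinner (opr (madj b) (xi m)) (xi n) * cinner (opr b (xi n)) (xi l) = 0"
      using \<open>m \<noteq> l\<close> by (simp add: cinner_b)
    moreover have "cinner (opr (madj b) (xi m)) (xi n) = cnj (cinner (opr b (xi n)) (xi m))"
      by (subst cinner_commute) (simp only: cinner_opr[OF b])
    ultimately show False using m l by (simp add: supp_def)
  qed
  note eq = this
  show "finite (supp b n) \<and> card (supp b n) \<le> 1"
  proof (cases "supp b n = {}")
    case False
    then obtain m where "m \<in> supp b n" by blast
    then have "supp b n = {m}" using eq by blast
    then show ?thesis by simp
  qed simp
qed

text \<open>Matrices with sparse columns form an algebra containing the normalisers, and its norm
  closure contains \<open>uroe\<close> because the normalisers generate it. An operator error of e
  then bounds the squared mass of each column off the sparse support by e^2, via Bessel.\<close>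

lemma uroe_sparse:
  assumes M: "M \<in> uroe" and e: "0 < e"
  shows "\<exists>k. \<forall>n. \<exists>S. finite S \<and> card S \<le> k \<and> (\<forall>P. finite P \<longrightarrow> (\<Sum>m\<in>P-S. (cmod (cinner (opr M (xi n)) (xi m)))^2) \<le> e^2)"
proof -
  \<comment> \<open>Sparsity of the adjoint, that is of the rows, is included to make
    \<open>\<S>\<close> closed under adjoints.\<close>
  define \<S> where "\<S> = {N. bounded_mat N \<and> (\<exists>k. col_sparse k N) \<and> (\<exists>k. col_sparse k (madj N))}"
  let ?G = "{M. bounded_mat M \<and> (\<forall>e>0. \<exists>N\<in>\<S>. norm (opr M - opr N) \<le> e)}"
  have "cstar_subalg ?G"
  proof (rule cstar_subalg_closure)
    have "madj mzero = (mzero :: 'a mat)" by (simp add: madj_def mzero_def)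
    then show "mzero \<in> \<S>" by (auto simp: \<S>_def col_sparse_def supp_def)
  next
    fix N N' assume N: "N \<in> \<S>" "N' \<in> \<S>"
    then have b: "bounded_mat N" "bounded_mat N'" by (auto simp: \<S>_def)
    obtain k l k' l' where k: "col_sparse k N" "col_sparse l N'" "col_sparse k' (madj N)" "col_sparse l' (madj N')"
      using N by (auto simp: \<S>_def)
    have "madj (madd N N') = madd (madj N) (madj N')" by (simp add: madj_def madd_def)
    then show "madd N N' \<in> \<S>"
      using col_sparse_madd[OF k(1,2) b] col_sparse_madd[OF k(3,4) bounded_madj[OF b(1)] bounded_madj[OF b(2)]]
      unfolding \<S>_def by (auto simp: bounded_madd b)
    have "madj (mmult N N') = mmult (madj N') (madj N)" by (simp add: madj_def mmult_def mult.commute flip: infsum_cnj)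
    then show "mmult N N' \<in> \<S>"
      using col_sparse_mmult[OF k(1,2) b] col_sparse_mmult[OF k(4,3) bounded_madj[OF b(2)] bounded_madj[OF b(1)]]
      unfolding \<S>_def by (auto simp: bounded_mmult b)
  next
    fix N assume N: "N \<in> \<S>"
    then have b: "bounded_mat N" by (auto simp: \<S>_def)
    then show "bounded_mat N" .
    show "madj N \<in> \<S>" using N by (simp add: \<S>_def bounded_madj)
    have sc: "supp (msmult c K) n \<subseteq> supp K n" if "bounded_mat K" for c K n
      using that by (auto simp: supp_def opr_msmult scale_op.rep_eq)
    have scs: "col_sparse k (msmult c K)" if "bounded_mat K" "col_sparse k K" for c k K
      by (rule col_sparseI[OF sc[OF that(1)]]) (use that(2) in \<open>auto simp: col_sparse_def\<close>)
    have "madj (msmult c N) = msmult (cnj c) (madj N)" for c by (simp add: madj_def msmult_def)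
    moreover obtain k l where "col_sparse k N" "col_sparse l (madj N)" using N by (auto simp: \<S>_def)
    ultimately show "msmult c N \<in> \<S>" for c
      using scs[OF b, of k c] scs[OF bounded_madj[OF b], of l "cnj c"] unfolding \<S>_def by (auto simp: bounded_msmult b)
  qed
  moreover have "normaliser A uroe \<subseteq> ?G"
  proof
    fix b assume b: "b \<in> normaliser A uroe"
    then have bb: "bounded_mat b" by (simp add: normaliser_def uroe_bounded)
    have "col_sparse 1 b" by (rule col_sparse_normaliser[OF bb]) (use b p in \<open>auto simp: normaliser_def\<close>)
    moreover have "col_sparse 1 (madj b)" by (rule col_sparse_normaliser[OF bounded_madj[OF bb]]) (use b p in \<open>auto simp: normaliser_def\<close>)
    ultimately have "b \<in> \<S>" using bb by (auto simp: \<S>_def)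
    then show "b \<in> ?G" using bb by (auto intro!: bexI[of _ b])
  qed
  ultimately have "M \<in> ?G" using cstar_gen_mem[of M "normaliser A uroe" ?G] M gen by blast
  then obtain N k where N: "bounded_mat N" "norm (opr M - opr N) \<le> e" "col_sparse k N" using e by (auto simp: \<S>_def)
  have "(\<Sum>m\<in>P-supp N n. (cmod (cinner (opr M (xi n)) (xi m)))^2) \<le> e^2" if P: "finite P" for n P
  proof -
    have "(\<Sum>m\<in>P-supp N n. (cmod (cinner (opr M (xi n)) (xi m)))^2) = (\<Sum>m\<in>P-supp N n. (cmod (cinner ((opr M - opr N) (xi n)) (xi m)))^2)"
      by (intro sum.cong refl) (auto simp: supp_def blinfun.diff_left cinner_diff_left)
    also have "\<dots> \<le> (norm ((opr M - opr N) (xi n)))^2" by (rule bessel[OF ortho]) (use P in simp)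
    also have "\<dots> \<le> e^2" using norm_blinfun[of "opr M - opr N" "xi n"] N(2) by (intro power_mono) auto
    finally show ?thesis .
  qed
  then show ?thesis using N(3) unfolding col_sparse_def by (intro exI[of _ k] allI) blast
qed

text \<open>As V sends \<open>xi n\<close> to \<open>ket (g n)\<close>, conjugation turns a in A
  into the diagonal matrix with entry \<open>\<phi> a n\<close> at \<open>g n\<close>. Every bounded
  diagonal is reached, because \<phi> maps onto all bounded sequences and g is onto the
  space.\<close>

lemma conjugating_unitary:
  "\<exists>v\<in>uroe. unitary_mat v \<and> (\<lambda>a. mmult (mmult v a) (madj v)) ` A = linf_diag"
proof -
  have "\<exists>k Q0 D0. finite Q0 \<and> (\<forall>D. D \<inter> Q0 = D0 \<inter> Q0 \<longrightarrow> sparse_under_signs k D)"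
    by (rule uniform_sparse) (rule uroe_sparse)
  then obtain k Q0 D0 where Q0: "finite Q0 \<and> (\<forall>D. D \<inter> Q0 = D0 \<inter> Q0 \<longrightarrow> sparse_under_signs k D)" by (elim exE)
  have "\<exists>d>0. \<forall>n. \<exists>x. d \<le> cmod (cf (xi n) x)" by (rule peaks_exist[of Q0 D0 k]) (use Q0 in simp_all)
  then obtain d where d: "d > 0" "\<forall>n. \<exists>x. d \<le> cmod (cf (xi n) x)" by blast
  obtain h where h: "\<forall>n. d \<le> cmod (cf (xi n) (h n))" using choice[OF d(2)] by blast
  interpret roe_peaks xi \<psi> h d by unfold_locales (use d h in auto)
  obtain g V where g: "bij g" and clV: "clin V" and V: "\<And>u n. cf (blinfun_apply V u) (g n) = cinner u (xi n)"
    and Vu: "mat_of V \<in> uroe" using unitary_exists by (elim exE conjE) (rule that, auto)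
  have surj: "\<exists>n. x = g n" for x using g by (metis bij_pointE)
  have inj: "g m = g n \<longleftrightarrow> m = n" for m n using g by (meson bij_def inj_eq)
  define v where "v = mat_of V"
  have vb: "bounded_mat v" and ov: "opr v = V" using clV by (auto simp: v_def bounded_mat_mat_of)
  have Vx: "V (xi n) = ket (g n)" for n
  proof (rule ell2_eqI)
    fix x
    obtain m where "x = g m" using surj by blast
    then show "cf (V (xi n)) x = cf (ket (g n)) x" by (simp add: V cinner_b cf_ket inj eq_commute)
  qed
  have Vk: "adj V (ket (g n)) = xi n" for n
  proof (rule ket.eqI)
    fix x
    have "cinner (adj V (ket (g n))) (ket x) = cnj (cf (V (ket x)) (g n))" by (simp only: cinner_adj[OF clV] cinner_ket_left)
    also have "\<dots> = cinner (xi n) (ket x)" unfolding V by (rule cinner_commute[symmetric])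
    finally show "cinner (adj V (ket (g n))) (ket x) = cinner (xi n) (ket x)" .
  qed
  have kets: "S = T" if "clin S" "clin T" "\<And>n. S (ket (g n)) = T (ket (g n))" for S T :: "'a ell2 \<Rightarrow>\<^sub>L 'a ell2"
    by (rule ket.blinfun_eqI[OF that(1,2)]) (metis surj that(3))
  have 1: "V o\<^sub>L adj V = id_blinfun"
    by (rule kets) (auto intro: clin_simps clV clin_adj simp: Vk Vx)
  have 2: "adj V o\<^sub>L V = id_blinfun"
    by (rule blinfun_eqI) (auto intro: clin_simps clV clin_adj simp: Vk Vx)
  have vu: "unitary_mat v"
    unfolding unitary_mat_def by (simp add: mmult_mat_of vb bounded_madj opr_madj ov 1 2 mid_mat_of)
  have conj_b: "bounded_mat (mmult (mmult v a) (madj v))" if "a \<in> A" for a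
    by (intro bounded_mmult bounded_madj vb A_bounded that)
  have conj_k: "opr (mmult (mmult v a) (madj v)) (ket (g n)) = \<phi> a n *\<^sub>c ket (g n)" if a: "a \<in> A" for a n
    using clV by (simp add: opr_mmult bounded_mmult bounded_madj vb A_bounded a opr_madj ov Vk A_xi clin_def Vx)
  have entry: "M x y = cf (opr M (ket y)) x" if "bounded_mat M" for M :: "'a mat" and x y
    using mat_of_opr[OF that] by (metis mat_of_def)
  have "(\<lambda>a. mmult (mmult v a) (madj v)) ` A = linf_diag"
  proof (intro equalityI subsetI)
    fix M assume "M \<in> (\<lambda>a. mmult (mmult v a) (madj v)) ` A"
    then obtain a where a: "a \<in> A" "M = mmult (mmult v a) (madj v)" by blast
    have "M x y = 0" if "x \<noteq> y" for x y
    proof -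
      obtain n where "y = g n" using surj by blast
      then show ?thesis using that conj_k[OF a(1), of n] entry[OF conj_b[OF a(1)], of x y] by (simp add: a(2) cf_ket)
    qed
    then show "M \<in> linf_diag" using conj_b[OF a(1)] a(2) by (simp add: linf_diag_def)
  next
    fix M :: "'a mat" assume "M \<in> linf_diag"
    then have bM: "bounded_mat M" and dM: "\<And>x y. x \<noteq> y \<Longrightarrow> M x y = 0" by (auto simp: linf_diag_def)
    define c where "c n = M (g n) (g n)" for n
    have "cmod (c n) \<le> norm (opr M)" for n
      using cf_norm_le[of "opr M (ket (g n))" "g n"] norm_blinfun[of "opr M" "ket (g n)"] entry[OF bM, of "g n" "g n"] by (simp add: c_def)
    then have bc: "bounded (range c)" by (auto simp: bounded_iff)
    have "opr M (ket (g n)) = c n *\<^sub>c ket (g n)" for n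
      by (rule ell2_eqI) (use dM in \<open>auto simp: entry[OF bM, symmetric] c_def cf_ket\<close>)
    then have "opr M = opr (mmult (mmult v (\<psi> c)) (madj v))"
      by (intro kets clin_opr bM conj_b \<psi> bc) (simp add: conj_k \<psi> bc)
    then have "M = mmult (mmult v (\<psi> c)) (madj v)" by (intro opr_eqI bM conj_b \<psi> bc)
    then show "M \<in> (\<lambda>a. mmult (mmult v a) (madj v)) ` A" using \<psi>(1)[OF bc] by blast
  qed
  then show ?thesis using vu Vu unfolding v_def by blast
qed

end

theorem theorem4p5:
  fixes A :: "('a::metric_space) mat set"
  assumes "ulf TYPE('a)"
    and "roe_cartan A"
  shows "\<exists>v\<in>uroe. unitary_mat v \<and>
           (\<lambda>a. mmult (mmult v a) (madj v)) ` A = linf_diag"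
proof -
  have c: "cartan_masa A uroe" and s: "star_iso_linf_nat A" using assms(2) by (auto simp: roe_cartan_def)
  obtain E where E: "faithful_cond_exp E uroe A" using c by (auto simp: cartan_masa_def)
  obtain \<phi> where \<phi>: "bij_betw \<phi> A linf_nat"
     "\<forall>c. \<forall>a\<in>A. \<phi> (msmult c a) = (\<lambda>n. c * \<phi> a n)"
     "\<forall>a\<in>A. \<forall>b\<in>A. \<phi> (mmult a b) = (\<lambda>n. \<phi> a n * \<phi> b n)"
     "\<forall>a\<in>A. \<phi> (madj a) = (\<lambda>n. cnj (\<phi> a n))"
    using s unfolding star_iso_linf_nat_def by blast
  interpret roe_cartan_data A \<phi> E
  proof
    show "C = A" if "cstar_subalg C" "abelian C" "A \<subseteq> C" "C \<subseteq> uroe" for C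
      using c that unfolding cartan_masa_def by blast
    show "uroe = cstar_gen (normaliser A uroe)" using c unfolding cartan_masa_def by blast
  qed (use assms(1) c E \<phi> in \<open>auto simp: cartan_masa_def\<close>)
  show ?thesis by (rule conjugating_unitary)
qed

end
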